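(* Let $S$ be a smooth compact manifold with nonempty smooth boundary and $M$ a finite dimensional manifold without boundary, with $\dim S=\dim M$. Let $\mu$ be a volume form on $S$ and $\mu_M$ a volume form on $M$. The projection $$\pi_0:\operatorname{Emb}_0(S,M)\to\operatorname{Gr}^S_0(M),\qquad f\mapsto f(S)$$ is a Fréchet principal $\operatorname{Diff}(S)$-bundle.
   Context: All finite dimensional manifolds are smooth, connected and orientable. $\operatorname{Emb}(S,M)$ is the set of all smooth embeddings $S\to M$, an open submanifold of the Fréchet manifold $C^\infty(S,M)$; $\operatorname{Diff}(S)$ is the Fréchet Lie group of diffeomorphisms of $S$, acting on the right by composition. $\operatorname{Gr}^S(M)$ is the set of submanifolds $N\subset M$ (with boundary) diffeomorphic to $S$, endowed with the Fréchet manifold structure for which $f\mapsto f(S)$, $\operatorname{Emb}(S,M)\to\operatorname{Gr}^S(M)$, is a Fréchet principal $\operatorname{Diff}(S)$-bundle. $$\operatorname{Emb}_0(S,M):=\left\{f\in\operatorname{Emb}(S,M):\int_{f(S)}\mu_M=\int_S\mu\right\},\qquad \operatorname{Gr}_0^S(M):=\left\{N\in\operatorname{Gr}^S(M):\int_N\mu_M=\int_S\mu\right\},$$ where integrals over $S$ use the orientation given by $\mu$ and integrals over $f(S)$ and $N$ the orientation given by $\mu_M$. These sets carry the submanifold structures induced from $\operatorname{Emb}(S,M)$ and $\operatorname{Gr}^S(M)$, in which they are codimension one Fréchet submanifolds. A Fréchet principal $G$-bundle, for a Fréchet Lie group $G$, consists of a Fréchet manifold $Q$ with a right $G$-action and a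 submersion $\pi:Q\to B$ onto a Fréchet manifold $B$ such that each $b\in B$ has a neighborhood $U$ with a diffeomorphism $\pi^{-1}(U)\cong G\times U$ which turns the action into right translation on the factor $G$ and $\pi$ into the projection on $U$. *)

theory Defs
  imports
    "HOL-Analysis.Analysis"
    "HOL-Library.Function_Algebras"
    "HOL-Algebra.Group"
begin

instantiation "fun" :: (type, real_vector) real_vector
begin

definition scaleR_fun :: "real \<Rightarrow> ('a \<Rightarrow> 'b) \<Rightarrow> 'a \<Rightarrow> 'b"
  where "scaleR_fun a f = (\<lambda>x. a *\<^sub>R f x)"

instance
  by standard (auto simp: scaleR_fun_def plus_fun_def fun_eq_iff scaleR_add_right scaleR_add_left)

end


section \<open>Frechet spaces and smooth maps between them\<close>

text \<open>A Frechet space is represented by a topology whose underlying set is a linear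
  subspace of a real vector space; the vector operations are those of the ambient type.\<close>

definition seminorm_on :: "'e::real_vector set \<Rightarrow> ('e \<Rightarrow> real) \<Rightarrow> bool"
  where "seminorm_on V p \<longleftrightarrow>
    (\<forall>x\<in>V. 0 \<le> p x) \<and> (\<forall>x\<in>V. \<forall>a. p (a *\<^sub>R x) = \<bar>a\<bar> * p x) \<and>
    (\<forall>x\<in>V. \<forall>y\<in>V. p (x + y) \<le> p x + p y)"

definition seminorm_topology :: "'e::real_vector set \<Rightarrow> ('e \<Rightarrow> real) set \<Rightarrow> 'e topology"
  where "seminorm_topology V P = topology (\<lambda>W. W \<subseteq> V \<and>
    (\<forall>x\<in>W. \<exists>F \<epsilon>. finite F \<and> F \<subseteq> P \<and> 0 < \<epsilon> \<and> {y \<in> V. \<forall>p\<in>F. p (y - x) < \<epsilon>} \<subseteq> W))"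

lemma openin_seminorm_topology:
  "openin (seminorm_topology V P) W \<longleftrightarrow> W \<subseteq> V \<and>
    (\<forall>x\<in>W. \<exists>F \<epsilon>. finite F \<and> F \<subseteq> P \<and> 0 < \<epsilon> \<and> {y \<in> V. \<forall>p\<in>F. p (y - x) < \<epsilon>} \<subseteq> W)"
proof -
  define nb where "nb W x \<longleftrightarrow>
    (\<exists>F \<epsilon>. finite F \<and> F \<subseteq> P \<and> 0 < \<epsilon> \<and> {y \<in> V. \<forall>p\<in>F. p (y - x) < \<epsilon>} \<subseteq> W)" for W x
  have mono: "nb T x" if "nb S x" "S \<subseteq> T" for S T x
    using that unfolding nb_def by (meson order_trans)
  have int: "nb (S \<inter> T) x" if S: "nb S x" and T: "nb T x" for S T x
  proof -
    obtain F e where 1: "finite F" "F \<subseteq> P" "0 < e" "{y \<in> V. \<forall>p\<in>F. p (y - x) < e} \<subseteq> S"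
      using S unfolding nb_def by (elim exE conjE)
    obtain G d where 2: "finite G" "G \<subseteq> P" "0 < d" "{y \<in> V. \<forall>p\<in>G. p (y - x) < d} \<subseteq> T"
      using T unfolding nb_def by (elim exE conjE)
    have "{y \<in> V. \<forall>p\<in>F \<union> G. p (y - x) < min e d} \<subseteq>
        {y \<in> V. \<forall>p\<in>F. p (y - x) < e} \<inter> {y \<in> V. \<forall>p\<in>G. p (y - x) < d}"
      by (simp add: subset_iff)
    also have "\<dots> \<subseteq> S \<inter> T" using 1(4) 2(4) by (rule Int_mono)
    finally show ?thesis
      unfolding nb_def using 1(1-3) 2(1-3)
      by (intro exI[of _ "F \<union> G"] exI[of _ "min e d"] conjI) simp_all
  qed
  have "istopology (\<lambda>W. W \<subseteq> V \<and> (\<forall>x\<in>W. nb W x))"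
    unfolding istopology_def by (meson IntD1 IntD2 Sup_le_iff UnionE Union_upper int le_infI1 mono)
  then show ?thesis
    unfolding seminorm_topology_def nb_def by (simp add: topology_inverse')
qed

definition frechet_space :: "'e::real_vector topology \<Rightarrow> bool"
  where "frechet_space E \<longleftrightarrow> subspace (topspace E) \<and>
    (\<exists>p :: nat \<Rightarrow> 'e \<Rightarrow> real.
      (\<forall>i. seminorm_on (topspace E) (p i)) \<and>
      E = seminorm_topology (topspace E) (range p) \<and>
      (\<forall>x\<in>topspace E. (\<forall>i. p i x = 0) \<longrightarrow> x = 0) \<and>
      (\<forall>\<sigma> :: nat \<Rightarrow> 'e. range \<sigma> \<subseteq> topspace E \<and>
          (\<forall>i. \<forall>\<epsilon>>0. \<exists>N. \<forall>m\<ge>N. \<forall>n\<ge>N. p i (\<sigma> m - \<sigma> n) < \<epsilon>) \<longrightarrow>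
        (\<exists>x\<in>topspace E. \<forall>i. (\<lambda>n. p i (\<sigma> n - x)) \<longlonglongrightarrow> 0)))"

text \<open>Smoothness in the sense of Michal, Bastiani and Hamilton: all iterated directional
  derivatives exist and are jointly continuous.  The value \<open>D [h\<^sub>k, \<dots>, h\<^sub>1] x\<close> is the
  \<open>k\<close>-th derivative at \<open>x\<close> in the directions \<open>h\<^sub>1, \<dots>, h\<^sub>k\<close>.\<close>

definition frechet_smooth ::
    "'e::real_vector topology \<Rightarrow> 'e set \<Rightarrow> 'f::real_vector topology \<Rightarrow> ('e \<Rightarrow> 'f) \<Rightarrow> bool"
  where "frechet_smooth E U F f \<longleftrightarrow> openin E U \<and>
    (\<exists>D :: 'e list \<Rightarrow> 'e \<Rightarrow> 'f.
      (\<forall>x\<in>U. D [] x = f x) \<and>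
      (\<forall>hs\<in>lists (topspace E). \<forall>h\<in>topspace E. \<forall>x\<in>U.
        limitin F (\<lambda>t::real. (1 / t) *\<^sub>R (D hs (x + t *\<^sub>R h) - D hs x)) (D (h # hs) x) (at 0)) \<and>
      (\<forall>k::nat. continuous_map
        (prod_topology (subtopology E U) (product_topology (\<lambda>_. E) {..<k})) F
        (\<lambda>(x, h). D (map h [0..<k]) x)))"

definition continuous_linear_map ::
    "'e::real_vector topology \<Rightarrow> 'f::real_vector topology \<Rightarrow> ('e \<Rightarrow> 'f) \<Rightarrow> bool"
  where "continuous_linear_map E F L \<longleftrightarrow> continuous_map E F L \<and>
    (\<forall>x\<in>topspace E. \<forall>y\<in>topspace E. L (x + y) = L x + L y) \<and>
    (\<forall>x\<in>topspace E. \<forall>a. L (a *\<^sub>R x) = a *\<^sub>R L x)"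

definition continuous_projection :: "'e::real_vector topology \<Rightarrow> 'e set \<Rightarrow> ('e \<Rightarrow> 'e) \<Rightarrow> bool"
  where "continuous_projection E F P \<longleftrightarrow> continuous_linear_map E E P \<and>
    P ` topspace E = F \<and> (\<forall>x\<in>F. P x = x)"

definition complemented_in :: "'e::real_vector topology \<Rightarrow> 'e set \<Rightarrow> bool"
  where "complemented_in E F \<longleftrightarrow> (\<exists>P. continuous_projection E F P)"

definition codim_one_in :: "'e::real_vector topology \<Rightarrow> 'e set \<Rightarrow> bool"
  where "codim_one_in E F \<longleftrightarrow> (\<exists>P v. continuous_projection E F P \<and> v \<noteq> 0 \<and>
    {x \<in> topspace E. P x = 0} = span {v})"


section \<open>Frechet manifolds\<close>

text \<open>A chart has a domain, a coordinate map and a model Frechet space.  A Frechet manifold is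
  a set together with an atlas; its topology is the one determined by the atlas.\<close>

datatype ('q, 'e) fchart = FChart (fdom: "'q set") (fcoord: "'q \<Rightarrow> 'e") (fmodel: "'e topology")

definition is_fchart :: "('q, 'e::real_vector) fchart \<Rightarrow> bool"
  where "is_fchart c \<longleftrightarrow> frechet_space (fmodel c) \<and> inj_on (fcoord c) (fdom c) \<and>
    openin (fmodel c) (fcoord c ` fdom c)"

definition finv :: "('q, 'e) fchart \<Rightarrow> 'e \<Rightarrow> 'q"
  where "finv c = inv_into (fdom c) (fcoord c)"

definition fchart_change_smooth ::
    "('q, 'e::real_vector) fchart \<Rightarrow> ('q, 'f::real_vector) fchart \<Rightarrow> bool"
  where "fchart_change_smooth c d \<longleftrightarrow>
    frechet_smooth (fmodel c) (fcoord c ` (fdom c \<inter> fdom d)) (fmodel d) (fcoord d \<circ> finv c)"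

definition atlas_topology :: "('q, 'e::real_vector) fchart set \<Rightarrow> 'q topology"
  where "atlas_topology A = topology (\<lambda>W. W \<subseteq> (\<Union>c\<in>A. fdom c) \<and>
    (\<forall>c\<in>A. openin (fmodel c) (fcoord c ` (W \<inter> fdom c))))"

definition frechet_manifold :: "'q set \<Rightarrow> ('q, 'e::real_vector) fchart set \<Rightarrow> bool"
  where "frechet_manifold X A \<longleftrightarrow>
    X = (\<Union>c\<in>A. fdom c) \<and> (\<forall>c\<in>A. is_fchart c) \<and>
    (\<forall>c\<in>A. \<forall>d\<in>A. fchart_change_smooth c d) \<and> Hausdorff_space (atlas_topology A)"

text \<open>Charts belonging to the maximal atlas generated by \<open>A\<close>.  The type of the model
  space may differ from that of the charts in \<open>A\<close>.\<close>

definition compatible_chart ::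
    "('q, 'e::real_vector) fchart set \<Rightarrow> ('q, 'f::real_vector) fchart \<Rightarrow> bool"
  where "compatible_chart A c \<longleftrightarrow> is_fchart c \<and> fdom c \<subseteq> (\<Union>d\<in>A. fdom d) \<and>
    (\<forall>d\<in>A. fchart_change_smooth c d \<and> fchart_change_smooth d c)"

definition frechet_smooth_map ::
    "'q set \<Rightarrow> ('q, 'e::real_vector) fchart set \<Rightarrow> 'r set \<Rightarrow> ('r, 'f::real_vector) fchart set \<Rightarrow>
      ('q \<Rightarrow> 'r) \<Rightarrow> bool"
  where "frechet_smooth_map X A Y B f \<longleftrightarrow> f ` X \<subseteq> Y \<and>
    (\<forall>c\<in>A. \<forall>d\<in>B. frechet_smooth (fmodel c) (fcoord c ` (fdom c \<inter> f -` fdom d)) (fmodel d)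
      (fcoord d \<circ> f \<circ> finv c))"

definition frechet_diffeo ::
    "'q set \<Rightarrow> ('q, 'e::real_vector) fchart set \<Rightarrow> 'r set \<Rightarrow> ('r, 'f::real_vector) fchart set \<Rightarrow>
      ('q \<Rightarrow> 'r) \<Rightarrow> bool"
  where "frechet_diffeo X A Y B f \<longleftrightarrow> bij_betw f X Y \<and>
    frechet_smooth_map X A Y B f \<and> frechet_smooth_map Y B X A (inv_into X f)"

definition product_atlas ::
    "('q, 'e) fchart set \<Rightarrow> ('r, 'f) fchart set \<Rightarrow> ('q \<times> 'r, 'e \<times> 'f) fchart set"
  where "product_atlas A B =
    {FChart (fdom c \<times> fdom d) (map_prod (fcoord c) (fcoord d)) (prod_topology (fmodel c) (fmodel d))
      | c d. c \<in> A \<and> d \<in> B}"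

text \<open>The structure induced on an open subset.\<close>

definition open_subatlas :: "('q, 'e) fchart set \<Rightarrow> 'q set \<Rightarrow> ('q, 'e) fchart set"
  where "open_subatlas A W = (\<lambda>c. FChart (fdom c \<inter> W) (fcoord c) (fmodel c)) ` A"

definition adapted_chart ::
    "('q, 'e::real_vector) fchart set \<Rightarrow> 'q set \<Rightarrow> ('q, 'e) fchart \<Rightarrow> 'e set \<Rightarrow> bool"
  where "adapted_chart A N c F \<longleftrightarrow> compatible_chart A c \<and> complemented_in (fmodel c) F \<and>
    fcoord c ` (fdom c \<inter> N) = fcoord c ` fdom c \<inter> F"

text \<open>The structure induced on a submanifold.\<close>

definition submanifold_atlas ::
    "('q, 'e::real_vector) fchart set \<Rightarrow> 'q set \<Rightarrow> ('q, 'e) fchart set"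
  where "submanifold_atlas A N =
    {FChart (fdom c \<inter> N) (fcoord c) (subtopology (fmodel c) F) | c F. adapted_chart A N c F}"

definition codim_one_submanifold ::
    "'q set \<Rightarrow> ('q, 'e::real_vector) fchart set \<Rightarrow> 'q set \<Rightarrow> bool"
  where "codim_one_submanifold X A N \<longleftrightarrow> N \<subseteq> X \<and>
    (\<forall>x\<in>N. \<exists>c F. x \<in> fdom c \<and> adapted_chart A N c F \<and> codim_one_in (fmodel c) F)"

text \<open>A submersion is a smooth map which in suitable charts is the projection of a product
  of Frechet spaces onto one of its factors.  The first factor may be taken in the model type
  of the source because it is isomorphic to the kernel of the differential.\<close>

definition frechet_submersion ::
    "'q set \<Rightarrow> ('q, 'e::real_vector) fchart set \<Rightarrow> 'r set \<Rightarrow> ('r, 'f::real_vector) fchart set \<Rightarrow>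
      ('q \<Rightarrow> 'r) \<Rightarrow> bool"
  where "frechet_submersion X A Y B f \<longleftrightarrow> frechet_smooth_map X A Y B f \<and>
    (\<forall>q\<in>X. \<exists>(c :: ('q, 'e \<times> 'f) fchart) (d :: ('r, 'f) fchart) (E :: 'e topology).
      frechet_space E \<and> compatible_chart A c \<and> compatible_chart B d \<and>
      fmodel c = prod_topology E (fmodel d) \<and> q \<in> fdom c \<and> f ` fdom c \<subseteq> fdom d \<and>
      (\<forall>x\<in>fdom c. fcoord d (f x) = snd (fcoord c x)))"


section \<open>Frechet Lie groups and principal bundles\<close>

definition frechet_lie_group :: "'g monoid \<Rightarrow> ('g, 'e::real_vector) fchart set \<Rightarrow> bool"
  where "frechet_lie_group G AG \<longleftrightarrow> group G \<and> frechet_manifold (carrier G) AG \<and>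
    frechet_smooth_map (carrier G \<times> carrier G) (product_atlas AG AG) (carrier G) AG
      (\<lambda>(g, h). g \<otimes>\<^bsub>G\<^esub> h) \<and>
    frechet_smooth_map (carrier G) AG (carrier G) AG (\<lambda>g. inv\<^bsub>G\<^esub> g)"

definition smooth_right_action ::
    "'g monoid \<Rightarrow> ('g, 'd::real_vector) fchart set \<Rightarrow> 'q set \<Rightarrow> ('q, 'e::real_vector) fchart set \<Rightarrow>
      ('q \<Rightarrow> 'g \<Rightarrow> 'q) \<Rightarrow> bool"
  where "smooth_right_action G AG Q AQ act \<longleftrightarrow>
    frechet_smooth_map (Q \<times> carrier G) (product_atlas AQ AG) Q AQ (\<lambda>(q, g). act q g) \<and>
    (\<forall>q\<in>Q. act q \<one>\<^bsub>G\<^esub> = q) \<and>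
    (\<forall>q\<in>Q. \<forall>g\<in>carrier G. \<forall>h\<in>carrier G. act q (g \<otimes>\<^bsub>G\<^esub> h) = act (act q g) h)"

definition local_trivialization ::
    "'g monoid \<Rightarrow> ('g, 'd::real_vector) fchart set \<Rightarrow> 'q set \<Rightarrow> ('q, 'e::real_vector) fchart set \<Rightarrow>
      ('q \<Rightarrow> 'g \<Rightarrow> 'q) \<Rightarrow> ('b, 'f::real_vector) fchart set \<Rightarrow> ('q \<Rightarrow> 'b) \<Rightarrow> 'b set \<Rightarrow>
      ('q \<Rightarrow> 'g \<times> 'b) \<Rightarrow> bool"
  where "local_trivialization G AG Q AQ act AB \<pi> U \<Psi> \<longleftrightarrow>
    frechet_diffeo (Q \<inter> \<pi> -` U) (open_subatlas AQ (Q \<inter> \<pi> -` U))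
      (carrier G \<times> U) (product_atlas AG (open_subatlas AB U)) \<Psi> \<and>
    (\<forall>q\<in>Q \<inter> \<pi> -` U. snd (\<Psi> q) = \<pi> q \<and>
      (\<forall>g\<in>carrier G. \<Psi> (act q g) = (fst (\<Psi> q) \<otimes>\<^bsub>G\<^esub> g, \<pi> q)))"

definition frechet_principal_bundle ::
    "'g monoid \<Rightarrow> ('g, 'd::real_vector) fchart set \<Rightarrow> 'q set \<Rightarrow> ('q, 'e::real_vector) fchart set \<Rightarrow>
      ('q \<Rightarrow> 'g \<Rightarrow> 'q) \<Rightarrow> 'b set \<Rightarrow> ('b, 'f::real_vector) fchart set \<Rightarrow> ('q \<Rightarrow> 'b) \<Rightarrow> bool"
  where "frechet_principal_bundle G AG Q AQ act B AB \<pi> \<longleftrightarrow>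
    frechet_lie_group G AG \<and> frechet_manifold Q AQ \<and> frechet_manifold B AB \<and>
    smooth_right_action G AG Q AQ act \<and>
    \<pi> ` Q = B \<and> frechet_submersion Q AQ B AB \<pi> \<and>
    (\<forall>b\<in>B. \<exists>U \<Psi>. openin (atlas_topology AB) U \<and> b \<in> U \<and>
      local_trivialization G AG Q AQ act AB \<pi> U \<Psi>)"


section \<open>Finite dimensional manifolds with boundary\<close>

definition boundary_coord :: "'n::finite"
  where "boundary_coord = (SOME i. True)"

definition half_space :: "(real ^ 'n::finite) set"
  where "half_space = {x. 0 \<le> x $ boundary_coord}"

text \<open>On subsets of a Euclidean space that need not be open, smoothness means local
  extendability to a smooth map on an open set.\<close>

definition smooth_on ::
    "'a::euclidean_space set \<Rightarrow> ('a \<Rightarrow> 'b::euclidean_space) \<Rightarrow> bool"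
  where "smooth_on A f \<longleftrightarrow> (\<forall>x\<in>A. \<exists>U g. open U \<and> x \<in> U \<and>
    frechet_smooth euclidean U euclidean g \<and> (\<forall>y\<in>U \<inter> A. g y = f y))"

datatype ('x, 'e) chart = Chart (cdom: "'x set") (coord: "'x \<Rightarrow> 'e")

definition cinv :: "('x, 'e) chart \<Rightarrow> 'e \<Rightarrow> 'x"
  where "cinv c = inv_into (cdom c) (coord c)"

text \<open>The points of a manifold form a subset of a topological type and carry the subspace
  topology; charts take values in open subsets of \<open>\<real>\<^sup>n\<close> or of the half space.\<close>

definition smooth_manifold ::
    "'x::{t2_space,second_countable_topology} set \<Rightarrow> ('x, real ^ 'n::finite) chart set \<Rightarrow> bool"
  where "smooth_manifold X A \<longleftrightarrow> X = (\<Union>c\<in>A. cdom c) \<and>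
    (\<forall>c\<in>A. openin (top_of_set X) (cdom c) \<and>
      homeomorphism (cdom c) (coord c ` cdom c) (coord c) (cinv c) \<and>
      (open (coord c ` cdom c) \<or> openin (top_of_set half_space) (coord c ` cdom c))) \<and>
    (\<forall>c\<in>A. \<forall>d\<in>A. smooth_on (coord c ` (cdom c \<inter> cdom d)) (coord d \<circ> cinv c))"

definition manifold_boundary :: "('x, real ^ 'n::finite) chart set \<Rightarrow> 'x set"
  where "manifold_boundary A = {p. \<exists>c\<in>A. p \<in> cdom c \<and> coord c p \<notin> interior (coord c ` cdom c)}"

definition local_rep_deriv ::
    "('x, real ^ 'k::finite) chart \<Rightarrow> ('y, real ^ 'n::finite) chart \<Rightarrow> ('x \<Rightarrow> 'y) \<Rightarrow> 'x \<Rightarrow>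
      real ^ 'k \<Rightarrow> real ^ 'n"
  where "local_rep_deriv c d f p = frechet_derivative (coord d \<circ> f \<circ> cinv c)
    (at (coord c p) within coord c ` (cdom c \<inter> f -` cdom d))"

definition smooth_map ::
    "'x::topological_space set \<Rightarrow> ('x, real ^ 'k::finite) chart set \<Rightarrow>
      'y::topological_space set \<Rightarrow> ('y, real ^ 'n::finite) chart set \<Rightarrow> ('x \<Rightarrow> 'y) \<Rightarrow> bool"
  where "smooth_map X A Y B f \<longleftrightarrow> f ` X \<subseteq> Y \<and> continuous_on X f \<and>
    (\<forall>c\<in>A. \<forall>d\<in>B. smooth_on (coord c ` (cdom c \<inter> f -` cdom d)) (coord d \<circ> f \<circ> cinv c))"

definition smooth_function :: "('x, real ^ 'n::finite) chart set \<Rightarrow> ('x \<Rightarrow> real) \<Rightarrow> bool"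
  where "smooth_function A h \<longleftrightarrow> (\<forall>c\<in>A. smooth_on (coord c ` cdom c) (h \<circ> cinv c))"

definition diffeomorphism ::
    "'x::topological_space set \<Rightarrow> ('x, real ^ 'k::finite) chart set \<Rightarrow>
      'y::topological_space set \<Rightarrow> ('y, real ^ 'n::finite) chart set \<Rightarrow> ('x \<Rightarrow> 'y) \<Rightarrow> bool"
  where "diffeomorphism X A Y B f \<longleftrightarrow> bij_betw f X Y \<and>
    smooth_map X A Y B f \<and> smooth_map Y B X A (inv_into X f)"

definition smooth_embedding ::
    "'x::topological_space set \<Rightarrow> ('x, real ^ 'k::finite) chart set \<Rightarrow>
      'y::topological_space set \<Rightarrow> ('y, real ^ 'n::finite) chart set \<Rightarrow> ('x \<Rightarrow> 'y) \<Rightarrow> bool"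
  where "smooth_embedding X A Y B f \<longleftrightarrow> smooth_map X A Y B f \<and>
    (\<forall>c\<in>A. \<forall>d\<in>B. \<forall>p\<in>cdom c \<inter> f -` cdom d. inj (local_rep_deriv c d f p)) \<and>
    (\<exists>g. homeomorphism X (f ` X) f g)"

text \<open>A tangent vector at \<open>p\<close> is a family of coordinate vectors, one for each chart around
  \<open>p\<close>, transforming by the differentials of the chart changes; entries for charts not
  containing \<open>p\<close> are zero.\<close>

type_synonym ('x, 'n) tvec = "('x, real ^ 'n) chart \<Rightarrow> real ^ 'n"

definition tangent_space :: "('x, real ^ 'n::finite) chart set \<Rightarrow> 'x \<Rightarrow> ('x, 'n) tvec set"
  where "tangent_space A p = {v.
    (\<forall>c. \<not> (c \<in> A \<and> p \<in> cdom c) \<longrightarrow> v c = 0) \<and>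
    (\<forall>c\<in>A. \<forall>d\<in>A. p \<in> cdom c \<and> p \<in> cdom d \<longrightarrow> v d = local_rep_deriv c d id p (v c))}"

definition coord_tvec ::
    "('x, real ^ 'n::finite) chart set \<Rightarrow> ('x, real ^ 'n) chart \<Rightarrow> 'x \<Rightarrow> 'n \<Rightarrow> ('x, 'n) tvec"
  where "coord_tvec A c p i =
    (\<lambda>d. if d \<in> A \<and> p \<in> cdom d then local_rep_deriv c d id p (axis i 1) else 0)"

definition boundary_tangent :: "('x, real ^ 'n::finite) chart set \<Rightarrow> 'x \<Rightarrow> ('x, 'n) tvec \<Rightarrow> bool"
  where "boundary_tangent A p v \<longleftrightarrow> (\<forall>c\<in>A. p \<in> cdom c \<longrightarrow> v c $ boundary_coord = 0)"


section \<open>Volume forms and integration\<close>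

text \<open>A top degree form assigns to \<open>p\<close> an alternating multilinear function of \<open>n\<close>-tuples
  of tangent vectors at \<open>p\<close>, the tuples being indexed by the dimension type.\<close>

type_synonym ('x, 'n) top_form = "'x \<Rightarrow> ('n \<Rightarrow> ('x, 'n) tvec) \<Rightarrow> real"

definition form_coeff ::
    "('x, real ^ 'n::finite) chart set \<Rightarrow> ('x, 'n) top_form \<Rightarrow> ('x, real ^ 'n) chart \<Rightarrow> 'x \<Rightarrow> real"
  where "form_coeff A \<omega> c p = \<omega> p (coord_tvec A c p)"

definition volume_form ::
    "'x set \<Rightarrow> ('x, real ^ 'n::finite) chart set \<Rightarrow> ('x, 'n) top_form \<Rightarrow> bool"
  where "volume_form X A \<omega> \<longleftrightarrow>
    (\<forall>p\<in>X. \<forall>v\<in>UNIV \<rightarrow> tangent_space A p.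
      (\<forall>i. \<forall>u\<in>tangent_space A p. \<forall>w\<in>tangent_space A p. \<forall>a b.
        \<omega> p (v(i := a *\<^sub>R u + b *\<^sub>R w)) = a * \<omega> p (v(i := u)) + b * \<omega> p (v(i := w))) \<and>
      (\<forall>i j. i \<noteq> j \<and> v i = v j \<longrightarrow> \<omega> p v = 0)) \<and>
    (\<forall>c\<in>A. smooth_on (coord c ` cdom c) (form_coeff A \<omega> c \<circ> cinv c)) \<and>
    (\<forall>p\<in>X. \<exists>v\<in>UNIV \<rightarrow> tangent_space A p. \<omega> p v \<noteq> 0)"

text \<open>The integral over a compact subset \<open>N\<close> (a submanifold of codimension zero, possibly
  with boundary) of the form \<open>\<omega>\<close> with respect to the orientation given by the volume form
  \<open>\<sigma>\<close>, computed by a partition of unity.  The factor \<open>sgn\<close> is \<open>1\<close> on positively oriented charts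
  and \<open>-1\<close> on negatively oriented ones; charts into the half space cannot always be chosen
  positively oriented in dimension one.\<close>

definition is_form_integral ::
    "('x::topological_space, real ^ 'n::finite) chart set \<Rightarrow> ('x, 'n) top_form \<Rightarrow>
      ('x, 'n) top_form \<Rightarrow> 'x set \<Rightarrow> real \<Rightarrow> bool"
  where "is_form_integral A \<sigma> \<omega> N I \<longleftrightarrow> (\<exists>(k::nat) c \<rho>.
    (\<forall>i<k. c i \<in> A \<and> smooth_function A (\<rho> i) \<and> (\<forall>x. 0 \<le> \<rho> i x) \<and>
      (\<exists>K. compact K \<and> K \<subseteq> cdom (c i) \<and> (\<forall>x. x \<notin> K \<longrightarrow> \<rho> i x = 0))) \<and>
    (\<forall>x\<in>N. (\<Sum>i<k. \<rho> i x) = 1) \<and>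
    I = (\<Sum>i<k. set_lebesgue_integral lborel (coord (c i) ` (cdom (c i) \<inter> N))
      (\<lambda>y. let x = cinv (c i) y in
        \<rho> i x * sgn (form_coeff A \<sigma> (c i) x) * form_coeff A \<omega> (c i) x)))"

definition form_integral ::
    "('x::topological_space, real ^ 'n::finite) chart set \<Rightarrow> ('x, 'n) top_form \<Rightarrow>
      ('x, 'n) top_form \<Rightarrow> 'x set \<Rightarrow> real"
  where "form_integral A \<sigma> \<omega> N = (THE I. is_form_integral A \<sigma> \<omega> N I)"


section \<open>Manifolds of maps\<close>

text \<open>From here on the source and target manifolds are the whole of their types.\<close>

primrec iterated_deriv ::
    "'a::real_normed_vector set \<Rightarrow> 'a list \<Rightarrow> ('a \<Rightarrow> 'b::real_normed_vector) \<Rightarrow> 'a \<Rightarrow> 'b"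
  where
    "iterated_deriv S [] h = h"
  | "iterated_deriv S (u # us) h = (\<lambda>x. frechet_derivative (iterated_deriv S us h) (at x within S) u)"

text \<open>Smooth sections of \<open>f\<^sup>*TX\<close> that are tangent to the boundary of \<open>X\<close> over those points that
  \<open>f\<close> maps into the boundary (no condition if \<open>X\<close> has no boundary).\<close>

definition sections_along ::
    "('s, real ^ 'k::finite) chart set \<Rightarrow> ('x, real ^ 'n::finite) chart set \<Rightarrow> ('s \<Rightarrow> 'x) \<Rightarrow>
      ('s \<Rightarrow> ('x, 'n) tvec) set"
  where "sections_along A B f = {\<xi>.
    (\<forall>x. \<xi> x \<in> tangent_space B (f x)) \<and>
    (\<forall>c\<in>A. \<forall>d\<in>B. smooth_on (coord c ` (cdom c \<inter> f -` cdom d)) (\<lambda>y. \<xi> (cinv c y) d)) \<and>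
    (\<forall>x. f x \<in> manifold_boundary B \<longrightarrow> boundary_tangent B (f x) (\<xi> x))}"

text \<open>The \<open>C\<^sup>\<infinity>\<close> topology: uniform convergence of all derivatives of the local representatives on
  compact subsets of chart domains.\<close>

definition section_seminorm ::
    "('s \<Rightarrow> 'x) \<Rightarrow> ('s, real ^ 'k::finite) chart \<Rightarrow> ('x, real ^ 'n::finite) chart \<Rightarrow> 's set \<Rightarrow>
      (real ^ 'k) list \<Rightarrow> ('s \<Rightarrow> ('x, 'n) tvec) \<Rightarrow> real"
  where "section_seminorm f c d K us \<xi> = (SUP y\<in>coord c ` K.
    norm (iterated_deriv (coord c ` (cdom c \<inter> f -` cdom d)) us (\<lambda>z. \<xi> (cinv c z) d) y))"

definition section_space ::
    "('s::topological_space, real ^ 'k::finite) chart set \<Rightarrow> ('x, real ^ 'n::finite) chart set \<Rightarrow>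
      ('s \<Rightarrow> 'x) \<Rightarrow> ('s \<Rightarrow> ('x, 'n) tvec) topology"
  where "section_space A B f = seminorm_topology (sections_along A B f)
    {section_seminorm f c d K us | c d K us.
      c \<in> A \<and> d \<in> B \<and> compact K \<and> K \<noteq> {} \<and> K \<subseteq> cdom c \<inter> f -` cdom d}"

text \<open>A local addition \<open>\<alpha>\<close> (such as the exponential map of a Riemannian metric, the boundary
  being totally geodesic) makes \<open>(proj, \<alpha>)\<close> a diffeomorphism from a neighbourhood of the zero
  section onto a neighbourhood \<open>W\<close> of the diagonal.  It is represented by the fibre
  component \<open>\<theta>\<close> of the inverse: \<open>\<theta> p q\<close> is the vector \<open>v\<close> at \<open>p\<close> with \<open>\<alpha> v = q\<close>.  Since
  \<open>(p, q) \<mapsto> (p, \<theta> p q)\<close> preserves the first component, injectivity and invertibility of its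
  differential are conditions on the maps \<open>\<theta> p\<close>.  Boundary points are required to stay in the
  boundary exactly when moved in a direction tangent to it.\<close>

definition local_addition_inverse ::
    "('x::topological_space, real ^ 'n::finite) chart set \<Rightarrow> ('x \<times> 'x) set \<Rightarrow>
      ('x \<Rightarrow> 'x \<Rightarrow> ('x, 'n) tvec) \<Rightarrow> bool"
  where "local_addition_inverse B W \<theta> \<longleftrightarrow> open W \<and>
    (\<forall>p. (p, p) \<in> W \<and> \<theta> p p = 0) \<and>
    (\<forall>(p, q)\<in>W. \<theta> p q \<in> tangent_space B p) \<and>
    (\<forall>c\<in>B. \<forall>d\<in>B. smooth_on (map_prod (coord c) (coord d) ` (W \<inter> cdom c \<times> cdom d))
      (\<lambda>(x, y). \<theta> (cinv c x) (cinv d y) c)) \<and>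
    (\<forall>p. inj_on (\<theta> p) {q. (p, q) \<in> W}) \<and>
    (\<forall>(p, q)\<in>W. \<forall>c\<in>B. \<forall>d\<in>B. p \<in> cdom c \<and> q \<in> cdom d \<longrightarrow>
      inj (frechet_derivative (\<lambda>y. \<theta> p (cinv d y) c)
        (at (coord d q) within coord d ` {q'\<in>cdom d. (p, q') \<in> W}))) \<and>
    (\<forall>(p, q)\<in>W. p \<in> manifold_boundary B \<longrightarrow>
      (q \<in> manifold_boundary B \<longleftrightarrow> boundary_tangent B p (\<theta> p q)))"

text \<open>The standard charts \<open>g \<mapsto> (proj, \<alpha>)\<inverse> \<circ> (f, g)\<close> centred at the elements \<open>f\<close> of a set of
  maps.\<close>

definition mapping_atlas ::
    "('s::topological_space, real ^ 'k::finite) chart set \<Rightarrow>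
      ('x::topological_space, real ^ 'n::finite) chart set \<Rightarrow> ('s \<Rightarrow> 'x) set \<Rightarrow>
      ('s \<Rightarrow> 'x, 's \<Rightarrow> ('x, 'n) tvec) fchart set"
  where "mapping_atlas A B H =
    {FChart {g \<in> H. \<forall>x. (f x, g x) \<in> W} (\<lambda>g x. \<theta> (f x) (g x)) (section_space A B f)
      | f W \<theta>. f \<in> H \<and> local_addition_inverse B W \<theta>}"

definition Cinf ::
    "('s::topological_space, real ^ 'k::finite) chart set \<Rightarrow>
      ('x::topological_space, real ^ 'n::finite) chart set \<Rightarrow> ('s \<Rightarrow> 'x) set"
  where "Cinf A B = {f. smooth_map UNIV A UNIV B f}"

definition Emb ::
    "('s::topological_space, real ^ 'k::finite) chart set \<Rightarrow>
      ('x::topological_space, real ^ 'n::finite) chart set \<Rightarrow> ('s \<Rightarrow> 'x) set"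
  where "Emb A B = {f. smooth_embedding UNIV A UNIV B f}"

definition Emb_atlas ::
    "('s::topological_space, real ^ 'k::finite) chart set \<Rightarrow>
      ('x::topological_space, real ^ 'n::finite) chart set \<Rightarrow>
      ('s \<Rightarrow> 'x, 's \<Rightarrow> ('x, 'n) tvec) fchart set"
  where "Emb_atlas A B = open_subatlas (mapping_atlas A B (Cinf A B)) (Emb A B)"

definition Diff :: "('s::topological_space, real ^ 'n::finite) chart set \<Rightarrow> ('s \<Rightarrow> 's) monoid"
  where "Diff A = \<lparr>carrier = {\<phi>. diffeomorphism UNIV A UNIV A \<phi>},
    monoid.mult = (\<lambda>\<phi> \<psi>. \<phi> \<circ> \<psi>), one = id\<rparr>"

text \<open>The charts of the diffeomorphism group take values in the vector fields along
  diffeomorphisms that are tangent to the boundary.\<close>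

definition Diff_atlas ::
    "('s::topological_space, real ^ 'n::finite) chart set \<Rightarrow>
      ('s \<Rightarrow> 's, 's \<Rightarrow> ('s, 'n) tvec) fchart set"
  where "Diff_atlas A = mapping_atlas A A (carrier (Diff A))"

definition Gr ::
    "('s::topological_space, real ^ 'k::finite) chart set \<Rightarrow>
      ('x::{t2_space,second_countable_topology}, real ^ 'n::finite) chart set \<Rightarrow> 'x set set"
  where "Gr A B = {N. \<exists>(C :: ('x, real ^ 'k) chart set) \<phi>. smooth_manifold N C \<and>
    smooth_embedding N C UNIV B id \<and> diffeomorphism UNIV A N C \<phi>}"

definition Emb0 ::
    "('s::topological_space, real ^ 'n::finite) chart set \<Rightarrow> ('s, 'n) top_form \<Rightarrow>
      ('x::topological_space, real ^ 'n) chart set \<Rightarrow> ('x, 'n) top_form \<Rightarrow> ('s \<Rightarrow> 'x) set"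
  where "Emb0 A \<mu> B \<mu>' = {f \<in> Emb A B. form_integral B \<mu>' \<mu>' (range f) = form_integral A \<mu> \<mu> UNIV}"

definition Gr0 ::
    "('s::topological_space, real ^ 'n::finite) chart set \<Rightarrow> ('s, 'n) top_form \<Rightarrow>
      ('x::{t2_space,second_countable_topology}, real ^ 'n) chart set \<Rightarrow> ('x, 'n) top_form \<Rightarrow>
      'x set set"
  where "Gr0 A \<mu> B \<mu>' = {N \<in> Gr A B. form_integral B \<mu>' \<mu>' N = form_integral A \<mu> \<mu> UNIV}"

end

theory Submission
  imports Defs
begin

text \<open>Volume constraints cut out \<open>Emb0\<close> as the full preimage of \<open>Gr0\<close>, so the claim is that a
  Frechet principal bundle restricts to a principal bundle over a submanifold \<open>N\<close> of its base, where
  both \<open>N\<close> and its preimage carry their submanifold structures.  All structure maps are restrictions of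
  ambient smooth maps.  Since submanifold charts come from the whole maximal atlas, this rests on the
  chain rule for Michal-Bastiani smooth maps, and on the fact that a smooth map which sends a
  linear subspace into a closed one has derivatives that do so too.  A submersion chart for the
  restricted projection arises by replacing the base component of a given one by an adapted chart
  of \<open>N\<close>.\<close>

subsection \<open>Frechet spaces\<close>

text \<open>Two obstacles shape the calculus. \<open>frechet_smooth\<close> demands one family of
  iterated directional derivatives, jointly continuous at every order; linearity in the directions
  is not part of it. The chain rule therefore needs an explicit family of all orders for a
  composite, and a proof that each slot is linear. Both rest on strict differentiability, obtained
  from joint continuity by a mean value inequality for each seminorm separately. Moreover, two
  charts of the maximal atlas are compared only through atlas charts, and a different one may be
  needed near each point. Composition thus yields smoothness on small pieces, each with its own
  family of derivatives. They fit together because limits in a Frechet space are unique. On the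
  manifold side, complemented subspaces are replaced by closed ones. Closedness is all that the
  restriction of derivatives and completeness require, and it passes to products and open subsets
  without carrying projections along. All smoothness claims about the restricted bundle then become
  instances of one statement on charts cut out by closed subspaces.\<close>

lemma topspace_seminorm_topology [simp]: "topspace (seminorm_topology V P) = V"
proof -
  have "openin (seminorm_topology V P) V"
    unfolding openin_seminorm_topology
    by (auto intro!: exI[of _ "{}"] exI[of _ "1::real"])
  then show ?thesis
    by (metis openin_seminorm_topology openin_subset openin_topspace subset_antisym)
qed

text \<open>\<open>frechet_space\<close> only asserts that a defining sequence exists. Fixing one by
  choice lets all estimates refer to an index \<open>i\<close>.\<close>

definition frechet_seminorm :: "'e::real_vector topology \<Rightarrow> nat \<Rightarrow> 'e \<Rightarrow> real"
  where "frechet_seminorm E = (SOME p.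
      (\<forall>i. seminorm_on (topspace E) (p i)) \<and>
      E = seminorm_topology (topspace E) (range p) \<and>
      (\<forall>x\<in>topspace E. (\<forall>i. p i x = 0) \<longrightarrow> x = 0) \<and>
      (\<forall>\<sigma> :: nat \<Rightarrow> 'e. range \<sigma> \<subseteq> topspace E \<and>
          (\<forall>i. \<forall>\<epsilon>>0. \<exists>N. \<forall>m\<ge>N. \<forall>n\<ge>N. p i (\<sigma> m - \<sigma> n) < \<epsilon>) \<longrightarrow>
        (\<exists>x\<in>topspace E. \<forall>i. (\<lambda>n. p i (\<sigma> n - x)) \<longlonglongrightarrow> 0)))"

lemma frechet_space_subspace: "frechet_space E \<Longrightarrow> subspace (topspace E)"
  by (simp add: frechet_space_def)

lemma frechet_seminorm:
  assumes "frechet_space E"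
  shows "seminorm_on (topspace E) (frechet_seminorm E i)"
    and "E = seminorm_topology (topspace E) (range (frechet_seminorm E))"
    and "x \<in> topspace E \<Longrightarrow> (\<And>i. frechet_seminorm E i x = 0) \<Longrightarrow> x = 0"
    and "range \<sigma> \<subseteq> topspace E \<Longrightarrow>
      (\<And>i \<epsilon>. 0 < \<epsilon> \<Longrightarrow> \<exists>N. \<forall>m\<ge>N. \<forall>n\<ge>N. frechet_seminorm E i (\<sigma> m - \<sigma> n) < \<epsilon>) \<Longrightarrow>
      \<exists>x\<in>topspace E. \<forall>i. (\<lambda>n. frechet_seminorm E i (\<sigma> n - x)) \<longlonglongrightarrow> 0"
proof -
  have "\<exists>p :: nat \<Rightarrow> 'a \<Rightarrow> real.
      (\<forall>i. seminorm_on (topspace E) (p i)) \<and>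
      E = seminorm_topology (topspace E) (range p) \<and>
      (\<forall>x\<in>topspace E. (\<forall>i. p i x = 0) \<longrightarrow> x = 0) \<and>
      (\<forall>\<sigma> :: nat \<Rightarrow> 'a. range \<sigma> \<subseteq> topspace E \<and>
          (\<forall>i. \<forall>\<epsilon>>0. \<exists>N. \<forall>m\<ge>N. \<forall>n\<ge>N. p i (\<sigma> m - \<sigma> n) < \<epsilon>) \<longrightarrow>
        (\<exists>x\<in>topspace E. \<forall>i. (\<lambda>n. p i (\<sigma> n - x)) \<longlonglongrightarrow> 0))"
    using assms unfolding frechet_space_def by blast
  from someI_ex[OF this, folded frechet_seminorm_def]
  show "seminorm_on (topspace E) (frechet_seminorm E i)"
    and "E = seminorm_topology (topspace E) (range (frechet_seminorm E))"
    and "x \<in> topspace E \<Longrightarrow> (\<And>i. frechet_seminorm E i x = 0) \<Longrightarrow> x = 0"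
    and "range \<sigma> \<subseteq> topspace E \<Longrightarrow>
      (\<And>i \<epsilon>. 0 < \<epsilon> \<Longrightarrow> \<exists>N. \<forall>m\<ge>N. \<forall>n\<ge>N. frechet_seminorm E i (\<sigma> m - \<sigma> n) < \<epsilon>) \<Longrightarrow>
      \<exists>x\<in>topspace E. \<forall>i. (\<lambda>n. frechet_seminorm E i (\<sigma> n - x)) \<longlonglongrightarrow> 0"
    by simp_all
qed

context
  fixes V :: "'e::real_vector set" and p
  assumes V: "subspace V" and p: "seminorm_on V p"
begin

lemma seminorm_nonneg: "x \<in> V \<Longrightarrow> 0 \<le> p x"
  and seminorm_scaleR: "x \<in> V \<Longrightarrow> p (a *\<^sub>R x) = \<bar>a\<bar> * p x"
  and seminorm_add: "x \<in> V \<Longrightarrow> y \<in> V \<Longrightarrow> p (x + y) \<le> p x + p y"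
  using p by (auto simp: seminorm_on_def)

lemma seminorm_zero: "p 0 = 0"
  using seminorm_scaleR[of 0 0] V by (simp add: subspace_0)

lemma seminorm_uminus: "x \<in> V \<Longrightarrow> p (- x) = p x"
  using seminorm_scaleR[of x "-1"] by simp

lemma seminorm_diff_commute: "x \<in> V \<Longrightarrow> y \<in> V \<Longrightarrow> p (x - y) = p (y - x)"
  using seminorm_uminus[of "x - y"] V by (simp add: subspace_diff)

lemma seminorm_triangle_sub:
  assumes "x \<in> V" "y \<in> V" "z \<in> V"
  shows "p (x - z) \<le> p (x - y) + p (y - z)"
  using seminorm_add[of "x - y" "y - z"] assms V by (simp add: subspace_diff)

end

section \<open>Topology and convergence in terms of seminorms\<close>

lemma openin_seminorm_ball:
  assumes V: "subspace V" and P: "\<And>p. p \<in> P \<Longrightarrow> seminorm_on V p"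
    and "finite F" "F \<subseteq> P" "0 < e" "x \<in> V"
  shows "openin (seminorm_topology V P) {y \<in> V. \<forall>p\<in>F. p (y - x) < e}"
  unfolding openin_seminorm_topology
proof (intro conjI ballI)
  fix y assume y: "y \<in> {y \<in> V. \<forall>p\<in>F. p (y - x) < e}"
  \<comment> \<open>The smallest slack left by the finitely many inequalities at \<open>y\<close>;
    inserting \<open>e\<close> keeps the set nonempty when \<open>F\<close> is empty.\<close>
  define d where "d = Min (insert e ((\<lambda>p. e - p (y - x)) ` F))"
  have d: "0 < d" "\<And>p. p \<in> F \<Longrightarrow> d \<le> e - p (y - x)"
    using \<open>finite F\<close> \<open>0 < e\<close> y by (auto simp: d_def)
  have "p (z - x) < e" if "z \<in> V" "\<forall>p\<in>F. p (z - y) < d" "p \<in> F" for z p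
  proof -
    have "p (z - x) \<le> p (z - y) + p (y - x)"
      using seminorm_triangle_sub[OF V P[of p]] that y \<open>F \<subseteq> P\<close> \<open>x \<in> V\<close> by blast
    then show ?thesis using that d(2)[of p] by force
  qed
  then show "\<exists>F' \<epsilon>. finite F' \<and> F' \<subseteq> P \<and> 0 < \<epsilon> \<and>
      {z \<in> V. \<forall>p\<in>F'. p (z - y) < \<epsilon>} \<subseteq> {y \<in> V. \<forall>p\<in>F. p (y - x) < e}"
    using assms(3,4) d(1) by (intro exI[of _ F] exI[of _ d]) auto
qed auto

lemma openin_seminorm_topologyE:
  assumes "openin (seminorm_topology V P) W" "x \<in> W"
  obtains F e where "finite F" "F \<subseteq> P" "0 < e" "{y \<in> V. \<forall>p\<in>F. p (y - x) < e} \<subseteq> W"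
  using bspec[OF conjunct2[OF assms(1)[unfolded openin_seminorm_topology]] assms(2)] that
  by (elim exE conjE)

text \<open>Reduces convergence along an arbitrary filter to real limits. The eventual membership in
  \<open>V\<close> is a separate condition because the seminorms are controlled on \<open>V\<close>
  only.\<close>

lemma limitin_seminorm_topology:
  assumes V: "subspace V" and P: "\<And>p. p \<in> P \<Longrightarrow> seminorm_on V p"
  shows "limitin (seminorm_topology V P) f l net \<longleftrightarrow>
    l \<in> V \<and> (\<forall>\<^sub>F t in net. f t \<in> V) \<and> (\<forall>p\<in>P. ((\<lambda>t. p (f t - l)) \<longlongrightarrow> 0) net)"
proof (intro iffI conjI ballI)
  assume L: "limitin (seminorm_topology V P) f l net"
  then show l: "l \<in> V" using limitin_topspace by fastforce
  show ev: "\<forall>\<^sub>F t in net. f t \<in> V"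
    using limitinD[OF L openin_topspace] l by simp
  fix p assume p: "p \<in> P"
  show "((\<lambda>t. p (f t - l)) \<longlongrightarrow> 0) net"
  proof (rule tendstoI)
    fix e :: real assume e: "0 < e"
    have "\<forall>\<^sub>F t in net. f t \<in> {y \<in> V. \<forall>q\<in>{p}. q (y - l) < e}"
      by (rule limitinD[OF L openin_seminorm_ball[OF V P]])
         (use p e l seminorm_zero[OF V P[OF p]] in auto)
    then show "\<forall>\<^sub>F t in net. dist (p (f t - l)) 0 < e"
      by eventually_elim (use seminorm_nonneg[OF V P[OF p]] l V in \<open>auto simp: subspace_diff\<close>)
  qed
next
  assume R: "l \<in> V \<and> (\<forall>\<^sub>F t in net. f t \<in> V) \<and> (\<forall>p\<in>P. ((\<lambda>t. p (f t - l)) \<longlongrightarrow> 0) net)"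
  show "limitin (seminorm_topology V P) f l net"
    unfolding limitin_def
  proof (intro conjI allI impI)
    fix U assume U: "openin (seminorm_topology V P) U \<and> l \<in> U"
    then obtain F e where F: "finite F" "F \<subseteq> P" "0 < e" "{y \<in> V. \<forall>p\<in>F. p (y - l) < e} \<subseteq> U"
      unfolding openin_seminorm_topology by blast
    have "\<forall>\<^sub>F t in net. \<forall>p\<in>F. p (f t - l) < e"
      using F R by (intro eventually_ball_finite ballI order_tendstoD(2)[where y = 0]) auto
    moreover have "\<forall>\<^sub>F t in net. f t \<in> V" using R by blast
    ultimately show "\<forall>\<^sub>F t in net. f t \<in> U"
      by eventually_elim (use F(4) in blast)
  qed (use R in simp)
qed

lemma limitin_frechet_space:
  assumes "frechet_space E"
  shows "limitin E f l net \<longleftrightarrow> l \<in> topspace E \<and> (\<forall>\<^sub>F t in net. f t \<in> topspace E) \<and>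
    (\<forall>i. ((\<lambda>t. frechet_seminorm E i (f t - l)) \<longlongrightarrow> 0) net)"
proof -
  have "limitin (seminorm_topology (topspace E) (range (frechet_seminorm E))) f l net \<longleftrightarrow>
    l \<in> topspace E \<and> (\<forall>\<^sub>F t in net. f t \<in> topspace E) \<and>
    (\<forall>p\<in>range (frechet_seminorm E). ((\<lambda>t. p (f t - l)) \<longlongrightarrow> 0) net)"
    by (rule limitin_seminorm_topology)
      (use assms frechet_seminorm(1) in \<open>auto simp: frechet_space_def\<close>)
  then show ?thesis
    using frechet_seminorm(2)[OF assms] by simp
qed

lemma limitin_eventually_topspace: "limitin X f l net \<Longrightarrow> \<forall>\<^sub>F t in net. f t \<in> topspace X"
  using limitinD[OF _ openin_topspace limitin_topspace] .

lemma limitin_add: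
  assumes E: "frechet_space E" and f: "limitin E f a net" and g: "limitin E g b net"
  shows "limitin E (\<lambda>t. f t + g t) (a + b) net"
  unfolding limitin_frechet_space[OF E]
proof (intro conjI allI)
  note V = frechet_space_subspace[OF E]
  have ab: "a \<in> topspace E" "b \<in> topspace E" using f g limitin_topspace by metis+
  show "a + b \<in> topspace E" using V ab by (rule subspace_add)
  have ev: "\<forall>\<^sub>F t in net. f t \<in> topspace E" "\<forall>\<^sub>F t in net. g t \<in> topspace E"
    using f g limitin_eventually_topspace by metis+
  then show "\<forall>\<^sub>F t in net. f t + g t \<in> topspace E"
    by eventually_elim (use V in \<open>rule subspace_add\<close>)
  fix i
  let ?q = "frechet_seminorm E i"
  note q = frechet_seminorm(1)[OF E, of i]
  show "((\<lambda>t. ?q (f t + g t - (a + b))) \<longlongrightarrow> 0) net"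
  proof (rule tendsto_sandwich[where f = "\<lambda>_. 0"])
    show "((\<lambda>t. ?q (f t - a) + ?q (g t - b)) \<longlongrightarrow> 0) net"
      using f g unfolding limitin_frechet_space[OF E] by (auto intro: tendsto_add_zero)
    show "\<forall>\<^sub>F t in net. ?q (f t + g t - (a + b)) \<le> ?q (f t - a) + ?q (g t - b)"
      using ev
    proof eventually_elim
      case (elim t)
      then show ?case
        using seminorm_add[OF V q, of "f t - a" "g t - b"] ab V
        by (simp add: subspace_diff algebra_simps)
    qed
    show "\<forall>\<^sub>F t in net. 0 \<le> ?q (f t + g t - (a + b))"
      using ev by eventually_elim
        (rule seminorm_nonneg[OF V q], use ab V in \<open>auto intro!: subspace_diff subspace_add\<close>)
  qed simp
qed

lemma limitin_scaleR:
  assumes E: "frechet_space E" and c: "(c \<longlongrightarrow> k) net" and f: "limitin E f a net"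
  shows "limitin E (\<lambda>t. c t *\<^sub>R f t) (k *\<^sub>R a) net"
  unfolding limitin_frechet_space[OF E]
proof (intro conjI allI)
  note V = frechet_space_subspace[OF E]
  have a: "a \<in> topspace E" using f limitin_topspace by metis
  show "k *\<^sub>R a \<in> topspace E" using V a by (rule subspace_scale)
  have ev: "\<forall>\<^sub>F t in net. f t \<in> topspace E"
    using f limitin_eventually_topspace by metis
  then show "\<forall>\<^sub>F t in net. c t *\<^sub>R f t \<in> topspace E"
    by eventually_elim (use V in \<open>rule subspace_scale\<close>)
  fix i
  let ?q = "frechet_seminorm E i"
  note q = frechet_seminorm(1)[OF E, of i]
  show "((\<lambda>t. ?q (c t *\<^sub>R f t - k *\<^sub>R a)) \<longlongrightarrow> 0) net"
  proof (rule tendsto_sandwich[where f = "\<lambda>_. 0"])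
    have "((\<lambda>t. ?q (f t - a)) \<longlongrightarrow> 0) net"
      using f unfolding limitin_frechet_space[OF E] by blast
    moreover have "((\<lambda>t. \<bar>c t - k\<bar> * ?q a) \<longlongrightarrow> \<bar>k - k\<bar> * ?q a) net"
      by (intro tendsto_intros c)
    ultimately have "((\<lambda>t. \<bar>c t\<bar> * ?q (f t - a) + \<bar>c t - k\<bar> * ?q a) \<longlongrightarrow> \<bar>k\<bar> * 0 + \<bar>k - k\<bar> * ?q a) net"
      by (intro tendsto_intros c) auto
    then show "((\<lambda>t. \<bar>c t\<bar> * ?q (f t - a) + \<bar>c t - k\<bar> * ?q a) \<longlongrightarrow> 0) net"
      by simp
    show "\<forall>\<^sub>F t in net. ?q (c t *\<^sub>R f t - k *\<^sub>R a) \<le> \<bar>c t\<bar> * ?q (f t - a) + \<bar>c t - k\<bar> * ?q a"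
      using ev
    proof eventually_elim
      case (elim t)
      have "c t *\<^sub>R f t - k *\<^sub>R a = c t *\<^sub>R (f t - a) + (c t - k) *\<^sub>R a"
        by (simp add: algebra_simps)
      moreover have "?q \<dots> \<le> ?q (c t *\<^sub>R (f t - a)) + ?q ((c t - k) *\<^sub>R a)"
        using a elim V by (intro seminorm_add[OF V q] subspace_scale subspace_diff)
      ultimately show ?case
        using a elim V by (simp add: seminorm_scaleR[OF V q] subspace_diff)
    qed
    show "\<forall>\<^sub>F t in net. 0 \<le> ?q (c t *\<^sub>R f t - k *\<^sub>R a)"
      using ev by eventually_elim
        (rule seminorm_nonneg[OF V q], use a V in \<open>auto intro!: subspace_diff subspace_scale\<close>)
  qed simp
qed

lemma limitin_scaleR_const:
  "frechet_space E \<Longrightarrow> limitin E f a net \<Longrightarrow> limitin E (\<lambda>t. k *\<^sub>R f t) (k *\<^sub>R a) net"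
  by (rule limitin_scaleR) auto

lemma limitin_sum_list:
  assumes "frechet_space E" "\<And>x. x \<in> set xs \<Longrightarrow> limitin E (\<lambda>t. f x t) (a x) net"
  shows "limitin E (\<lambda>t. \<Sum>x\<leftarrow>xs. f x t) (\<Sum>x\<leftarrow>xs. a x) net"
  using assms(2)
  by (induction xs)
     (use assms(1) in \<open>auto intro!: limitin_add simp: frechet_space_subspace subspace_0\<close>)

lemma frechet_space_Hausdorff:
  assumes E: "frechet_space E"
  shows "Hausdorff_space E"
  unfolding Hausdorff_space_def
proof (intro allI impI, elim conjE)
  note V = frechet_space_subspace[OF E]
  fix x y assume xy: "x \<in> topspace E" "y \<in> topspace E" "x \<noteq> y"
  then have "x - y \<in> topspace E" "x - y \<noteq> 0" using V by (auto simp: subspace_diff)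
  then obtain i where i: "frechet_seminorm E i (x - y) \<noteq> 0"
    using frechet_seminorm(3)[OF E] by blast
  define q where "q = frechet_seminorm E i"
  have q: "seminorm_on (topspace E) q" unfolding q_def by (rule frechet_seminorm(1)[OF E])
  define e where "e = q (x - y) / 2"
  have e: "0 < e"
    using i seminorm_nonneg[OF V q, of "x - y"] \<open>x - y \<in> topspace E\<close> by (auto simp: e_def q_def)
  define B where "B z = {w \<in> topspace E. \<forall>r\<in>{q}. r (w - z) < e}" for z
  have B: "openin E (B z)" if "z \<in> topspace E" for z
  proof -
    have "openin (seminorm_topology (topspace E) (range (frechet_seminorm E))) (B z)"
      unfolding B_def
      by (rule openin_seminorm_ball[OF V]) (use e that frechet_seminorm(1)[OF E] in \<open>auto simp: q_def\<close>)
    then show ?thesis using frechet_seminorm(2)[OF E] by simp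
  qed
  have mem: "z \<in> B z" if "z \<in> topspace E" for z
    using that e seminorm_zero[OF V q] by (simp add: B_def)
  have False if "w \<in> B x" "w \<in> B y" for w
  proof -
    have w: "w \<in> topspace E" "q (w - x) < e" "q (w - y) < e" using that by (auto simp: B_def)
    have "q (x - y) \<le> q (w - x) + q (w - y)"
      using seminorm_triangle_sub[OF V q xy(1) w(1) xy(2)] seminorm_diff_commute[OF V q xy(1) w(1)]
      by simp
    then show False using w by (simp add: e_def)
  qed
  then show "\<exists>U W. openin E U \<and> openin E W \<and> x \<in> U \<and> y \<in> W \<and> disjnt U W"
    using B mem xy by (intro exI[of _ "B x"] exI[of _ "B y"]) (auto simp: disjnt_iff)
qed

lemma limitin_frechet_unique:
  "frechet_space E \<Longrightarrow> limitin E f a net \<Longrightarrow> limitin E f b net \<Longrightarrow> net \<noteq> bot \<Longrightarrow> a = b"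
  using limitin_Hausdorff_unique[OF _ _ _ frechet_space_Hausdorff] by blast

section \<open>Closed subspaces and products of Frechet spaces\<close>

lemma subtopology_seminorm_topology:
  assumes V: "subspace V" and P: "\<And>p. p \<in> P \<Longrightarrow> seminorm_on V p" and F: "F \<subseteq> V"
  shows "subtopology (seminorm_topology V P) F = seminorm_topology F P"
proof (rule topology_eq[THEN iffD2, rule_format], rule iffI)
  fix W assume "openin (subtopology (seminorm_topology V P) F) W"
  then obtain T where T: "openin (seminorm_topology V P) T" "W = T \<inter> F"
    by (auto simp: openin_subtopology)
  have "\<exists>G \<epsilon>. finite G \<and> G \<subseteq> P \<and> 0 < \<epsilon> \<and> {y \<in> F. \<forall>p\<in>G. p (y - x) < \<epsilon>} \<subseteq> W" if "x \<in> W" for x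
  proof -
    obtain G e where "finite G" "G \<subseteq> P" "0 < e" "{y \<in> V. \<forall>p\<in>G. p (y - x) < e} \<subseteq> T"
      by (rule openin_seminorm_topologyE[OF T(1), of x]) (use T(2) \<open>x \<in> W\<close> in auto)
    then show ?thesis using T(2) F by (intro exI[of _ G] exI[of _ e]) blast
  qed
  then show "openin (seminorm_topology F P) W"
    unfolding openin_seminorm_topology using T(2) by blast
next
  fix W assume W: "openin (seminorm_topology F P) W"
  \<comment> \<open>The largest ambient open set whose trace on \<open>F\<close> lies in
    \<open>W\<close>; no radius has to be chosen for each point.\<close>
  define T where "T = \<Union>{B. openin (seminorm_topology V P) B \<and> B \<inter> F \<subseteq> W}"
  have "openin (seminorm_topology V P) T" unfolding T_def by blast
  moreover have "W = T \<inter> F"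
  proof
    have "W \<subseteq> F" using W openin_subset by fastforce
    moreover have "x \<in> T" if "x \<in> W" for x
    proof -
      obtain G e where G: "finite G" "G \<subseteq> P" "0 < e" "{y \<in> F. \<forall>p\<in>G. p (y - x) < e} \<subseteq> W"
        by (rule openin_seminorm_topologyE[OF W \<open>x \<in> W\<close>])
      have x: "x \<in> V" using that \<open>W \<subseteq> F\<close> F by blast
      let ?B = "{y \<in> V. \<forall>p\<in>G. p (y - x) < e}"
      have "openin (seminorm_topology V P) ?B"
        by (rule openin_seminorm_ball[OF V P]) (use G x in auto)
      moreover have "p 0 < e" if "p \<in> G" for p
        using \<open>0 < e\<close> seminorm_zero[OF V P, of p] subsetD[OF G(2) that] by simp
      then have "x \<in> ?B" using x by simp
      moreover have "?B \<inter> F \<subseteq> W" using G(4) by blast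
      ultimately show ?thesis unfolding T_def by blast
    qed
    ultimately show "W \<subseteq> T \<inter> F" by blast
  qed (auto simp: T_def)
  ultimately show "openin (subtopology (seminorm_topology V P) F) W"
    unfolding openin_subtopology by blast
qed

text \<open>The ambient seminorms serve again. Completeness is where closedness enters: a Cauchy
  sequence in \<open>F\<close> converges in \<open>E\<close>, and its limit stays in
  \<open>F\<close>.\<close>

lemma frechet_space_subtopology:
  assumes E: "frechet_space E" and F: "subspace F" "closedin E F"
  shows "frechet_space (subtopology E F)"
proof -
  note V = frechet_space_subspace[OF E]
  have sub: "F \<subseteq> topspace E" using F(2) closedin_subset by blast
  then have top: "topspace (subtopology E F) = F" by (simp add: Int_absorb1)
  let ?p = "frechet_seminorm E"
  have "subtopology E F = seminorm_topology F (range ?p)"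
    by (rule trans[OF arg_cong[OF frechet_seminorm(2)[OF E], of "\<lambda>T. subtopology T F"]
          subtopology_seminorm_topology[OF V _ sub]])
       (use frechet_seminorm(1)[OF E] in auto)
  moreover have "seminorm_on F (?p i)" for i
    using frechet_seminorm(1)[OF E, of i] sub by (auto simp: seminorm_on_def subset_iff)
  moreover have "\<exists>x\<in>F. \<forall>i. (\<lambda>n. ?p i (\<sigma> n - x)) \<longlonglongrightarrow> 0"
    if \<sigma>: "range \<sigma> \<subseteq> F" "\<forall>i. \<forall>\<epsilon>>0. \<exists>N. \<forall>m\<ge>N. \<forall>n\<ge>N. ?p i (\<sigma> m - \<sigma> n) < \<epsilon>" for \<sigma> :: "nat \<Rightarrow> 'a"
  proof -
    obtain x where x: "x \<in> topspace E" "\<And>i. (\<lambda>n. ?p i (\<sigma> n - x)) \<longlonglongrightarrow> 0"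
      using frechet_seminorm(4)[OF E, of \<sigma>] \<sigma> sub by blast
    have "\<sigma> n \<in> topspace E" for n using \<sigma>(1) sub by blast
    then have lim: "limitin E \<sigma> x sequentially"
      unfolding limitin_frechet_space[OF E] using x by simp
    have "x \<in> F"
      by (rule limitin_closedin[OF lim F(2)]) (use \<sigma>(1) in \<open>auto intro!: always_eventually\<close>)
    then show ?thesis using x by blast
  qed
  moreover have "x = 0" if "x \<in> F" "\<forall>i. ?p i x = 0" for x
    using frechet_seminorm(3)[OF E] that sub by blast
  ultimately show ?thesis
    unfolding frechet_space_def top using F(1) by (intro conjI exI[of _ ?p]) blast+
qed

lemma seminorm_on_fst: "seminorm_on V p \<Longrightarrow> seminorm_on (V \<times> W) (p \<circ> fst)"
  and seminorm_on_snd: "seminorm_on W q \<Longrightarrow> seminorm_on (V \<times> W) (q \<circ> snd)"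
  by (auto simp: seminorm_on_def)

lemma prod_seminorm_topology:
  assumes V: "subspace V" "\<And>p. p \<in> P \<Longrightarrow> seminorm_on V p"
    and W: "subspace W" "\<And>q. q \<in> Q \<Longrightarrow> seminorm_on W q"
  shows "prod_topology (seminorm_topology V P) (seminorm_topology W Q) =
    seminorm_topology (V \<times> W) ((\<lambda>p. p \<circ> fst) ` P \<union> (\<lambda>q. q \<circ> snd) ` Q)"
    (is "?L = seminorm_topology _ ?R")
proof (rule topology_eq[THEN iffD2, rule_format], rule iffI)
  fix S assume S: "openin ?L S"
  have "\<exists>F e. finite F \<and> F \<subseteq> ?R \<and> 0 < e \<and> {z \<in> V \<times> W. \<forall>r\<in>F. r (z - x) < e} \<subseteq> S" if "x \<in> S" for x
  proof -
    obtain a b where x: "x = (a, b)" by fastforce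
    obtain A B where AB: "openin (seminorm_topology V P) A" "openin (seminorm_topology W Q) B"
      "a \<in> A" "b \<in> B" "A \<times> B \<subseteq> S"
      using S[unfolded openin_prod_topology_alt, rule_format, of a b] \<open>x \<in> S\<close> x by auto
    obtain F e where F: "finite F" "F \<subseteq> P" "0 < e" "{y \<in> V. \<forall>p\<in>F. p (y - a) < e} \<subseteq> A"
      by (rule openin_seminorm_topologyE[OF AB(1,3)])
    obtain G d where G: "finite G" "G \<subseteq> Q" "0 < d" "{y \<in> W. \<forall>p\<in>G. p (y - b) < d} \<subseteq> B"
      by (rule openin_seminorm_topologyE[OF AB(2,4)])
    let ?F = "(\<lambda>p. p \<circ> fst) ` F \<union> (\<lambda>q. q \<circ> snd) ` G"
    have "{z \<in> V \<times> W. \<forall>r\<in>?F. r (z - x) < min e d} \<subseteq> A \<times> B"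
      using F(4) G(4) by (auto simp: x ball_Un)
    then show ?thesis
      using F G AB by (intro exI[of _ ?F] exI[of _ "min e d"]) auto
  qed
  moreover have "S \<subseteq> V \<times> W" using openin_subset[OF S] by simp
  ultimately show "openin (seminorm_topology (V \<times> W) ?R) S"
    unfolding openin_seminorm_topology by blast
next
  fix S assume S: "openin (seminorm_topology (V \<times> W) ?R) S"
  then have sub: "S \<subseteq> V \<times> W" unfolding openin_seminorm_topology by blast
  show "openin ?L S"
    unfolding openin_prod_topology_alt
  proof (intro allI impI)
    fix a b assume ab: "(a, b) \<in> S"
    then obtain F e where F: "finite F" "F \<subseteq> ?R" "0 < e"
      "{z \<in> V \<times> W. \<forall>r\<in>F. r (z - (a, b)) < e} \<subseteq> S"
      using S by (elim openin_seminorm_topologyE)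
    \<comment> \<open>The finite set \<open>F\<close> mixes seminorms of the two factors. Each of
      its two parts is the image of a finite set, which gives a ball in that factor.\<close>
    obtain P' where P': "P' \<subseteq> P" "finite P'" "F \<inter> (\<lambda>p. p \<circ> fst) ` P = (\<lambda>p. p \<circ> fst) ` P'"
      using F(1) by (metis Int_lower2 finite_Int finite_subset_image)
    obtain Q' where Q': "Q' \<subseteq> Q" "finite Q'" "F \<inter> (\<lambda>q. q \<circ> snd) ` Q = (\<lambda>q. q \<circ> snd) ` Q'"
      using F(1) by (metis Int_lower2 finite_Int finite_subset_image)
    let ?A = "{y \<in> V. \<forall>p\<in>P'. p (y - a) < e}" and ?B = "{y \<in> W. \<forall>p\<in>Q'. p (y - b) < e}"
    have mem: "a \<in> V" "b \<in> W" using ab sub by auto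
    have FPQ: "F = (\<lambda>p. p \<circ> fst) ` P' \<union> (\<lambda>q. q \<circ> snd) ` Q'"
      using F(2) P'(3) Q'(3) by blast
    have "?A \<times> ?B \<subseteq> {z \<in> V \<times> W. \<forall>r\<in>F. r (z - (a, b)) < e}"
      by (auto simp: FPQ)
    then have "?A \<times> ?B \<subseteq> S" using F(4) by blast
    moreover have "openin (seminorm_topology V P) ?A"
      by (rule openin_seminorm_ball[OF V]) (use P' F mem in auto)
    moreover have "openin (seminorm_topology W Q) ?B"
      by (rule openin_seminorm_ball[OF W]) (use Q' F mem in auto)
    moreover have "a \<in> ?A"
    proof -
      have "p 0 < e" if "p \<in> P'" for p
        using \<open>0 < e\<close> seminorm_zero[OF V(1) V(2), of p] subsetD[OF P'(1) that] by simp
      then show ?thesis using mem by simp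
    qed
    moreover have "b \<in> ?B"
    proof -
      have "p 0 < e" if "p \<in> Q'" for p
        using \<open>0 < e\<close> seminorm_zero[OF W(1) W(2), of p] subsetD[OF Q'(1) that] by simp
      then show ?thesis using mem by simp
    qed
    ultimately show "\<exists>U Z. openin (seminorm_topology V P) U \<and> openin (seminorm_topology W Q) Z \<and>
        a \<in> U \<and> b \<in> Z \<and> U \<times> Z \<subseteq> S" by blast
  qed
qed

lemma frechet_space_prod_topology:
  assumes E: "frechet_space E" and F: "frechet_space F"
  shows "frechet_space (prod_topology E F)"
proof -
  let ?p = "frechet_seminorm E" and ?q = "frechet_seminorm F"
  \<comment> \<open>\<open>frechet_space\<close> asks for a sequence of seminorms, so the two
    sequences are interleaved by parity.\<close>
  define r where "r n = (if even n then ?p (n div 2) \<circ> fst else ?q (n div 2) \<circ> snd)" for n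
  have re: "r (2 * i) = ?p i \<circ> fst" and ro: "r (Suc (2 * i)) = ?q i \<circ> snd" for i
    by (auto simp: r_def)
  have range_r: "range r = (\<lambda>p. p \<circ> fst) ` range ?p \<union> (\<lambda>q. q \<circ> snd) ` range ?q"
    unfolding image_image
  proof (intro equalityI subsetI)
    fix s assume "s \<in> (\<lambda>i. ?p i \<circ> fst) ` UNIV \<union> (\<lambda>i. ?q i \<circ> snd) ` UNIV"
    then show "s \<in> range r" by (auto simp flip: re ro)
  qed (auto simp: r_def)
  have "subspace (topspace E \<times> topspace F)"
    using E F by (intro subspace_Times frechet_space_subspace)
  moreover have "seminorm_on (topspace E \<times> topspace F) (r n)" for n
    unfolding r_def using frechet_seminorm(1)[OF E] frechet_seminorm(1)[OF F]
    by (simp add: seminorm_on_fst seminorm_on_snd)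
  moreover have "prod_topology E F = seminorm_topology (topspace E \<times> topspace F) (range r)"
    unfolding range_r
    by (rule trans[OF arg_cong2[OF frechet_seminorm(2)[OF E] frechet_seminorm(2)[OF F],
            of prod_topology]
          prod_seminorm_topology[OF frechet_space_subspace[OF E] _ frechet_space_subspace[OF F]]])
       (use frechet_seminorm(1)[OF E] frechet_seminorm(1)[OF F] in auto)
  moreover have "x = 0" if "x \<in> topspace E \<times> topspace F" "\<forall>n. r n x = 0" for x
  proof -
    have "?p i (fst x) = 0" "?q i (snd x) = 0" for i
      using that(2) re[of i] ro[of i] by (metis comp_apply)+
    then show ?thesis
      using that(1) frechet_seminorm(3)[OF E, of "fst x"] frechet_seminorm(3)[OF F, of "snd x"]
      by (simp add: prod_eq_iff mem_Times_iff)
  qed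
  moreover have "\<exists>x\<in>topspace E \<times> topspace F. \<forall>n. (\<lambda>k. r n (\<sigma> k - x)) \<longlonglongrightarrow> 0"
    if \<sigma>: "range \<sigma> \<subseteq> topspace E \<times> topspace F"
      "\<forall>i. \<forall>\<epsilon>>0. \<exists>N. \<forall>m\<ge>N. \<forall>n\<ge>N. r i (\<sigma> m - \<sigma> n) < \<epsilon>" for \<sigma> :: "nat \<Rightarrow> 'a \<times> 'b"
  proof -
    have "\<exists>N. \<forall>m\<ge>N. \<forall>n\<ge>N. ?p i (fst (\<sigma> m) - fst (\<sigma> n)) < e" if "0 < e" for i e
      using \<sigma>(2)[rule_format, of e "2 * i"] that by (simp add: re)
    moreover have "range (fst \<circ> \<sigma>) \<subseteq> topspace E" using \<sigma>(1) by fastforce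
    ultimately have "\<exists>a\<in>topspace E. \<forall>i. (\<lambda>n. ?p i ((fst \<circ> \<sigma>) n - a)) \<longlonglongrightarrow> 0"
      by (intro frechet_seminorm(4)[OF E]) simp_all
    then obtain a where a: "a \<in> topspace E" "\<And>i. (\<lambda>n. ?p i (fst (\<sigma> n) - a)) \<longlonglongrightarrow> 0"
      by auto
    have "\<exists>N. \<forall>m\<ge>N. \<forall>n\<ge>N. ?q i (snd (\<sigma> m) - snd (\<sigma> n)) < e" if "0 < e" for i e
      using \<sigma>(2)[rule_format, of e "Suc (2 * i)"] that by (simp add: ro)
    moreover have "range (snd \<circ> \<sigma>) \<subseteq> topspace F" using \<sigma>(1) by fastforce
    ultimately have "\<exists>b\<in>topspace F. \<forall>i. (\<lambda>n. ?q i ((snd \<circ> \<sigma>) n - b)) \<longlonglongrightarrow> 0"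
      by (intro frechet_seminorm(4)[OF F]) simp_all
    then obtain b where b: "b \<in> topspace F" "\<And>i. (\<lambda>n. ?q i (snd (\<sigma> n) - b)) \<longlonglongrightarrow> 0"
      by auto
    show ?thesis
      by (rule bexI[of _ "(a, b)"]) (use a b in \<open>auto simp: r_def\<close>)
  qed
  ultimately show ?thesis
    unfolding frechet_space_def topspace_prod_topology by blast
qed

subsection \<open>Iterated derivatives\<close>

text \<open>The conditions that \<open>frechet_smooth\<close> puts on \<open>D\<close>, detached
  from \<open>f\<close>, so that concrete families can be built and compared.\<close>

definition frechet_derivs ::
    "'e::real_vector topology \<Rightarrow> 'e set \<Rightarrow> 'f::real_vector topology \<Rightarrow> ('e list \<Rightarrow> 'e \<Rightarrow> 'f) \<Rightarrow> bool"
  where "frechet_derivs E U F D \<longleftrightarrow> openin E U \<and>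
    (\<forall>hs\<in>lists (topspace E). \<forall>h\<in>topspace E. \<forall>x\<in>U.
      limitin F (\<lambda>t::real. (1 / t) *\<^sub>R (D hs (x + t *\<^sub>R h) - D hs x)) (D (h # hs) x) (at 0)) \<and>
    (\<forall>k::nat. continuous_map
      (prod_topology (subtopology E U) (product_topology (\<lambda>_. E) {..<k})) F
      (\<lambda>(x, h). D (map h [0..<k]) x))"

lemma frechet_smooth_iff_derivs:
  "frechet_smooth E U F f \<longleftrightarrow> (\<exists>D. frechet_derivs E U F D \<and> (\<forall>x\<in>U. D [] x = f x))"
  unfolding frechet_smooth_def frechet_derivs_def by blast

lemma frechet_derivs_openin: "frechet_derivs E U F D \<Longrightarrow> openin E U"
  by (simp add: frechet_derivs_def)

lemma frechet_derivs_deriv: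
  "frechet_derivs E U F D \<Longrightarrow> hs \<in> lists (topspace E) \<Longrightarrow> h \<in> topspace E \<Longrightarrow> x \<in> U \<Longrightarrow>
    limitin F (\<lambda>t::real. (1 / t) *\<^sub>R (D hs (x + t *\<^sub>R h) - D hs x)) (D (h # hs) x) (at 0)"
  by (simp add: frechet_derivs_def)

lemma limitin_filterlim_compose:
  assumes "limitin X f l G" and g: "filterlim g G N"
  shows "limitin X (\<lambda>t. f (g t)) l N"
  unfolding limitin_def
proof (intro conjI allI impI)
  show "l \<in> topspace X" using assms(1) by (rule limitin_topspace)
  fix W assume "openin X W \<and> l \<in> W"
  then have "\<forall>\<^sub>F s in G. f s \<in> W" using limitinD[OF assms(1)] by blast
  then show "\<forall>\<^sub>F t in N. f (g t) \<in> W" using g by (rule eventually_compose_filterlim)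
qed

text \<open>Joint continuity in the form used everywhere below: base point and all directions may
  move along one filter. Lists of moving directions replace the functions on \<open>{..<k}\<close>
  of the definition.\<close>

lemma frechet_derivs_limitin:
  assumes D: "frechet_derivs E U F D" and y: "limitin E y x net" "x \<in> U"
    and ws: "list_all2 (\<lambda>w l. limitin E w l net) ws ls"
  shows "limitin F (\<lambda>t. D (map (\<lambda>w. w t) ws) (y t)) (D ls x) net"
proof -
  define k where "k = length ws"
  have len: "length ls = k" using ws by (simp add: k_def list_all2_lengthD)
  have lim: "limitin E (ws ! j) (ls ! j) net" if "j < k" for j
    using list_all2_nthD[OF ws] that by (simp add: k_def)
  let ?X = "prod_topology (subtopology E U) (product_topology (\<lambda>_. E) {..<k})"
  \<comment> \<open>Points of \<open>product_topology\<close> are extensional functions, hence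
    \<open>restrict\<close>.\<close>
  let ?f = "\<lambda>t. (y t, restrict (\<lambda>j. (ws ! j) t) {..<k})" and ?l = "(x, restrict (\<lambda>j. ls ! j) {..<k})"
  have "\<forall>\<^sub>F t in net. \<forall>j\<in>{..<k}. (ws ! j) t \<in> topspace E"
    using lim by (intro eventually_ball_finite) (auto dest: limitin_eventually_topspace)
  then have "\<forall>\<^sub>F t in net. restrict (\<lambda>j. (ws ! j) t) {..<k} \<in> topspace (product_topology (\<lambda>_. E) {..<k})"
    by eventually_elim (simp add: restrict_PiE_iff)
  then have "limitin (product_topology (\<lambda>_. E) {..<k}) (snd \<circ> ?f) (snd ?l) net"
    unfolding limitin_componentwise using lim by (auto simp: o_def cong: conj_cong)
  moreover have "limitin (subtopology E U) (fst \<circ> ?f) (fst ?l) net"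
    using y limitinD[OF y(1) frechet_derivs_openin[OF D] y(2)]
    by (simp add: limitin_subtopology o_def)
  ultimately have "limitin ?X ?f ?l net"
    unfolding limitin_pairwise by blast
  moreover have "continuous_map ?X F (\<lambda>(x, h). D (map h [0..<k]) x)"
    using D by (simp add: frechet_derivs_def)
  ultimately have "limitin F ((\<lambda>(x, h). D (map h [0..<k]) x) \<circ> ?f) ((\<lambda>(x, h). D (map h [0..<k]) x) ?l) net"
    by (intro continuous_map_limit)
  moreover have "map (restrict (\<lambda>j. (ws ! j) t) {..<k}) [0..<k] = map (\<lambda>w. w t) ws" for t
    by (rule nth_equalityI) (auto simp: k_def)
  moreover have "map (restrict (\<lambda>j. ls ! j) {..<k}) [0..<k] = ls"
    by (rule nth_equalityI) (auto simp: len)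
  ultimately show ?thesis by (simp add: o_def)
qed

lemma list_all2_limitin_const: "hs \<in> lists (topspace E) \<Longrightarrow>
    list_all2 (\<lambda>w l. limitin E w l net) (map (\<lambda>h t. h) hs) hs"
  by (induction hs) auto

text \<open>Joint continuity along a constant net exhibits the value as a limit, and limits lie in
  the space.\<close>

lemma frechet_derivs_topspace:
  assumes "frechet_derivs E U F D" "x \<in> U" "hs \<in> lists (topspace E)"
  shows "D hs x \<in> topspace F"
proof -
  have "x \<in> topspace E" using assms frechet_derivs_openin openin_subset by blast
  then have "limitin F (\<lambda>t. D (map (\<lambda>w. w t) (map (\<lambda>h t. h) hs)) x) (D hs x) (at (0::real))"
    by (intro frechet_derivs_limitin[OF assms(1)] list_all2_limitin_const assms) auto
  then show ?thesis by (rule limitin_topspace)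
qed

lemma frechet_smooth_openin: "frechet_smooth E U F f \<Longrightarrow> openin E U"
  by (simp add: frechet_smooth_def)

lemma frechet_smooth_cong:
  "frechet_smooth E U F f \<Longrightarrow> (\<And>x. x \<in> U \<Longrightarrow> f x = g x) \<Longrightarrow> frechet_smooth E U F g"
  unfolding frechet_smooth_iff_derivs by metis

lemma frechet_smooth_limitin:
  assumes f: "frechet_smooth E U F f" and y: "limitin E y x net" "x \<in> U"
  shows "limitin F (\<lambda>t. f (y t)) (f x) net"
proof -
  obtain D where D: "frechet_derivs E U F D" "\<And>x. x \<in> U \<Longrightarrow> D [] x = f x"
    using f unfolding frechet_smooth_iff_derivs by blast
  have "\<forall>\<^sub>F t in net. y t \<in> U"
    using limitinD[OF y(1) frechet_smooth_openin[OF f] y(2)] .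
  then have "\<forall>\<^sub>F t in net. D [] (y t) = f (y t)"
    by eventually_elim (use D in simp)
  then show ?thesis
    using frechet_derivs_limitin[OF D(1) y, of "[]" "[]"] D(2) y(2)
    by (auto intro: limitin_transform_eventually)
qed

lemma frechet_smooth_continuous:
  assumes "frechet_smooth E U F f"
  shows "continuous_map (subtopology E U) F f"
  unfolding continuous_map_atin
proof
  fix x assume x: "x \<in> topspace (subtopology E U)"
  have "limitin (subtopology E U) (\<lambda>t. t) x (atin (subtopology E U) x)"
    by (rule limitin_continuous_map) (use x in auto)
  then show "limitin F f (f x) (atin (subtopology E U) x)"
    using frechet_smooth_limitin[OF assms, of "\<lambda>t. t"] x by (simp add: limitin_subtopology)
qed

lemma openin_frechet_smooth_preimage:
  assumes "frechet_smooth E U F f" "openin F V"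
  shows "openin E {x \<in> U. f x \<in> V}"
proof -
  have U: "openin E U" using assms(1) by (rule frechet_smooth_openin)
  have "openin (subtopology E U) {x \<in> topspace (subtopology E U). f x \<in> V}"
    using frechet_smooth_continuous[OF assms(1)] assms(2) by (rule openin_continuous_map_preimage)
  moreover have "topspace (subtopology E U) = U" using openin_subset[OF U] by auto
  ultimately show ?thesis using openin_trans_full[OF _ U] by metis
qed

text \<open>The converse of \<open>frechet_derivs_limitin\<close>: continuity is tested along
  filters. It is enough to take filters on pairs of a base point and a direction function, since the
  one that matters is \<open>atin\<close> at a point of the product.\<close>

lemma frechet_derivsI:
  assumes U: "openin E U"
    and deriv: "\<And>hs h x. hs \<in> lists (topspace E) \<Longrightarrow> h \<in> topspace E \<Longrightarrow> x \<in> U \<Longrightarrow>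
      limitin F (\<lambda>t::real. (1 / t) *\<^sub>R (D hs (x + t *\<^sub>R h) - D hs x)) (D (h # hs) x) (at 0)"
    and cont: "\<And>k x h (net :: ('e::real_vector \<times> (nat \<Rightarrow> 'e)) filter). x \<in> U \<Longrightarrow>
      limitin E fst x net \<Longrightarrow> (\<And>j. j < k \<Longrightarrow> h j \<in> topspace E) \<Longrightarrow>
      (\<And>j. j < k \<Longrightarrow> limitin E (\<lambda>p. snd p j) (h j) net) \<Longrightarrow>
      limitin F (\<lambda>p. D (map (snd p) [0..<k]) (fst p)) (D (map h [0..<k]) x) net"
  shows "frechet_derivs E U F D"
proof -
  have "continuous_map (prod_topology (subtopology E U) (product_topology (\<lambda>_. E) {..<k})) F
      (\<lambda>(x, h). D (map h [0..<k]) x)" for k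
    unfolding continuous_map_atin
  proof
    let ?X = "prod_topology (subtopology E U) (product_topology (\<lambda>_. E) {..<k})"
    fix p assume p: "p \<in> topspace ?X"
    obtain x h where xh: "p = (x, h)" by fastforce
    have "limitin ?X (\<lambda>q. q) p (atin ?X p)"
      by (rule limitin_continuous_map) (use p in auto)
    then have "limitin (subtopology E U) (\<lambda>q. fst q) x (atin ?X p)"
      and "limitin (product_topology (\<lambda>_. E) {..<k}) (\<lambda>q. snd q) h (atin ?X p)"
      unfolding limitin_pairwise by (auto simp: o_def xh)
    then have "limitin E fst x (atin ?X p)" "\<And>j. j < k \<Longrightarrow> limitin E (\<lambda>p. snd p j) (h j) (atin ?X p)"
      by (auto simp: limitin_subtopology limitin_componentwise)
    then have "limitin F (\<lambda>p. D (map (snd p) [0..<k]) (fst p)) (D (map h [0..<k]) x) (atin ?X p)"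
      using p by (intro cont) (auto simp: xh)
    then show "limitin F (\<lambda>(x, h). D (map h [0..<k]) x)
        ((\<lambda>(x, h). D (map h [0..<k]) x) p) (atin ?X p)"
      by (simp add: xh case_prod_unfold)
  qed
  then show ?thesis unfolding frechet_derivs_def using U deriv by simp
qed

section \<open>Mean value inequality and strict differentiability\<close>

lemma eventually_prod_principal:
  "eventually P (A \<times>\<^sub>F principal S) \<longleftrightarrow> (\<forall>\<^sub>F t in A. \<forall>s\<in>S. P (t, s))"
proof
  assume "eventually P (A \<times>\<^sub>F principal S)"
  then obtain Q R where "eventually Q A" "\<forall>s\<in>S. R s" "\<And>t s. Q t \<Longrightarrow> R s \<Longrightarrow> P (t, s)"
    by (auto simp: eventually_prod_filter eventually_principal)
  then show "\<forall>\<^sub>F t in A. \<forall>s\<in>S. P (t, s)"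
    by (auto elim: eventually_mono)
next
  assume "\<forall>\<^sub>F t in A. \<forall>s\<in>S. P (t, s)"
  then show "eventually P (A \<times>\<^sub>F principal S)"
    unfolding eventually_prod_filter eventually_principal
    by (intro exI[of _ "\<lambda>t. \<forall>s\<in>S. P (t, s)"] exI[of _ "\<lambda>s. s \<in> S"]) auto
qed

lemma filterlim_mult_at_0:
  fixes a :: real
  assumes "a \<noteq> 0"
  shows "filterlim (\<lambda>t. t * a) (at 0) (at 0)"
  unfolding filterlim_at
proof
  show "\<forall>\<^sub>F t in at 0. t * a \<in> UNIV \<and> t * a \<noteq> 0"
    using assms by (auto simp: eventually_at intro: exI[of _ 1])
  show "((\<lambda>t. t * a) \<longlongrightarrow> 0) (at 0)"
    by (rule tendsto_eq_intros refl | simp)+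
qed

text \<open>One seminorm at a time and without linear functionals: the estimate is additive over
  adjacent intervals, and the strict bound on the derivative makes it true on all short intervals
  around a given point.\<close>

lemma frechet_mean_value:
  fixes \<gamma> :: "real \<Rightarrow> 'f::real_vector"
  assumes F: "frechet_space F" and \<gamma>: "\<And>s. 0 \<le> s \<Longrightarrow> s \<le> 1 \<Longrightarrow> \<gamma> s \<in> topspace F"
    and deriv: "\<And>s. 0 \<le> s \<Longrightarrow> s \<le> 1 \<Longrightarrow>
      limitin F (\<lambda>r. (1 / r) *\<^sub>R (\<gamma> (s + r) - \<gamma> s)) (\<gamma>' s) (at 0)"
    and v: "v \<in> topspace F"
    and less: "\<And>s. 0 \<le> s \<Longrightarrow> s \<le> 1 \<Longrightarrow> frechet_seminorm F i (\<gamma>' s - v) < e"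
  shows "frechet_seminorm F i (\<gamma> 1 - \<gamma> 0 - v) \<le> e"
proof -
  let ?q = "frechet_seminorm F i"
  note V = frechet_space_subspace[OF F]
  note q = frechet_seminorm(1)[OF F, of i]
  define P where "P a b \<longleftrightarrow> (0 \<le> a \<and> b \<le> 1 \<longrightarrow> ?q (\<gamma> b - \<gamma> a - (b - a) *\<^sub>R v) \<le> (b - a) * e)" for a b
  \<comment> \<open>Bisection: a property that is additive over adjacent intervals and holds for all
    short intervals around each point holds for the whole interval.\<close>
  have "P 0 1"
  proof (rule Bolzano)
    fix a b c assume P: "P a b" "P b c" and le: "a \<le> b" "b \<le> c"
    show "P a c"
      unfolding P_def
    proof (intro impI, elim conjE)
      assume "0 \<le> a" "c \<le> 1"
      then have *: "?q (\<gamma> b - \<gamma> a - (b - a) *\<^sub>R v) \<le> (b - a) * e"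
        "?q (\<gamma> c - \<gamma> b - (c - b) *\<^sub>R v) \<le> (c - b) * e"
        and mem: "\<gamma> a \<in> topspace F" "\<gamma> b \<in> topspace F" "\<gamma> c \<in> topspace F"
        using P le \<gamma> by (auto simp: P_def)
      have eq: "\<gamma> c - \<gamma> a - (c - a) *\<^sub>R v =
          (\<gamma> b - \<gamma> a - (b - a) *\<^sub>R v) + (\<gamma> c - \<gamma> b - (c - b) *\<^sub>R v)"
        by (simp add: algebra_simps)
      have "?q (\<gamma> c - \<gamma> a - (c - a) *\<^sub>R v) \<le>
          ?q (\<gamma> b - \<gamma> a - (b - a) *\<^sub>R v) + ?q (\<gamma> c - \<gamma> b - (c - b) *\<^sub>R v)"
        unfolding eq by (rule seminorm_add[OF V q]; intro subspace_diff subspace_scale V mem v)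
      then have "?q (\<gamma> c - \<gamma> a - (c - a) *\<^sub>R v) \<le> (b - a) * e + (c - b) * e"
        using * by linarith
      then show "?q (\<gamma> c - \<gamma> a - (c - a) *\<^sub>R v) \<le> (c - a) * e"
        by (simp add: algebra_simps)
    qed
  next
    fix x :: real assume x: "0 \<le> x" "x \<le> 1"
    note lim = deriv[OF x, unfolded limitin_frechet_space[OF F]]
    \<comment> \<open>The slack in the strict bound at \<open>x\<close>; it absorbs the error of the
      difference quotient.\<close>
    define \<delta> where "\<delta> = e - ?q (\<gamma>' x - v)"
    have "0 < \<delta>" using less[OF x] by (simp add: \<delta>_def)
    have "\<forall>\<^sub>F r in at 0. ?q ((1 / r) *\<^sub>R (\<gamma> (x + r) - \<gamma> x) - \<gamma>' x) < \<delta>"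
      using lim \<open>0 < \<delta>\<close> by (intro order_tendstoD(2)[where y = 0]) auto
    then obtain d where d: "0 < d"
      "\<And>r. r \<noteq> 0 \<Longrightarrow> \<bar>r\<bar> < d \<Longrightarrow> ?q ((1 / r) *\<^sub>R (\<gamma> (x + r) - \<gamma> x) - \<gamma>' x) < \<delta>"
      unfolding eventually_at by auto
    have step: "?q (\<gamma> (x + r) - \<gamma> x - r *\<^sub>R v) \<le> \<bar>r\<bar> * e" if r: "\<bar>r\<bar> < d" "0 \<le> x + r" "x + r \<le> 1" for r
    proof (cases "r = 0")
      case True
      then show ?thesis using seminorm_zero[OF V q] by simp
    next
      case False
      let ?w = "(1 / r) *\<^sub>R (\<gamma> (x + r) - \<gamma> x)"
      have mem: "?w \<in> topspace F" "\<gamma>' x \<in> topspace F"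
        using \<gamma>[of "x + r"] \<gamma>[OF x] r V lim by (auto intro!: subspace_scale subspace_diff)
      have "?q (?w - v) \<le> ?q (?w - \<gamma>' x) + ?q (\<gamma>' x - v)"
        by (rule seminorm_triangle_sub[OF V q mem v])
      also have "\<dots> \<le> e" using d(2)[OF False r(1)] by (simp add: \<delta>_def)
      finally have "\<bar>r\<bar> * ?q (?w - v) \<le> \<bar>r\<bar> * e" by (simp add: mult_left_mono)
      moreover have "\<bar>r\<bar> * ?q (?w - v) = ?q (r *\<^sub>R (?w - v))"
        using seminorm_scaleR[OF V q, of "?w - v" r] mem v V by (simp add: subspace_diff)
      moreover have "r *\<^sub>R (?w - v) = \<gamma> (x + r) - \<gamma> x - r *\<^sub>R v"
        using False by (simp add: scaleR_diff_right)
      ultimately show ?thesis by simp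
    qed
    \<comment> \<open>The interval is split at \<open>x\<close>; \<open>step\<close> covers both
      halves, with increments of either sign.\<close>
    have "P a b" if ab: "a \<le> x" "x \<le> b" "b - a < d" for a b
      unfolding P_def
    proof (intro impI, elim conjE)
      assume a: "0 \<le> a" and b: "b \<le> 1"
      have 1: "?q (\<gamma> b - \<gamma> x - (b - x) *\<^sub>R v) \<le> (b - x) * e"
        using step[of "b - x"] a b ab by simp
      have 2: "?q (\<gamma> a - \<gamma> x - (a - x) *\<^sub>R v) \<le> (x - a) * e"
        using step[of "a - x"] a b ab by simp
      have mem: "\<gamma> a \<in> topspace F" "\<gamma> b \<in> topspace F" "\<gamma> x \<in> topspace F"
        using a b ab by (auto intro: \<gamma>)
      have eq: "\<gamma> b - \<gamma> a - (b - a) *\<^sub>R v =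
          (\<gamma> b - \<gamma> x - (b - x) *\<^sub>R v) + - (\<gamma> a - \<gamma> x - (a - x) *\<^sub>R v)"
        by (simp add: algebra_simps)
      have "?q (\<gamma> b - \<gamma> a - (b - a) *\<^sub>R v) \<le>
          ?q (\<gamma> b - \<gamma> x - (b - x) *\<^sub>R v) + ?q (- (\<gamma> a - \<gamma> x - (a - x) *\<^sub>R v))"
        unfolding eq by (rule seminorm_add[OF V q]; intro subspace_neg subspace_diff subspace_scale V mem v)
      moreover have "?q (- (\<gamma> a - \<gamma> x - (a - x) *\<^sub>R v)) = ?q (\<gamma> a - \<gamma> x - (a - x) *\<^sub>R v)"
        by (rule seminorm_uminus[OF V q]; intro subspace_diff subspace_scale V mem v)
      ultimately have "?q (\<gamma> b - \<gamma> a - (b - a) *\<^sub>R v) \<le> (b - x) * e + (x - a) * e"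
        using 1 2 by linarith
      then show "?q (\<gamma> b - \<gamma> a - (b - a) *\<^sub>R v) \<le> (b - a) * e" by (simp add: algebra_simps)
    qed
    with d(1) show "\<exists>d>0. \<forall>a b. a \<le> x \<and> x \<le> b \<and> b - a < d \<longrightarrow> P a b" by blast
  qed simp
  then show ?thesis by (simp add: P_def)
qed

text \<open>Strict differentiability: base point, direction and the remaining arguments may all
  vary with \<open>t\<close>.  Joint continuity of the derivative together with the mean value inequality
  gives this uniformly along the segment.\<close>

lemma frechet_derivs_increment:
  fixes y u :: "real \<Rightarrow> 'e::real_vector"
  assumes E: "frechet_space E" and F: "frechet_space F" and D: "frechet_derivs E U F D"
    and y: "limitin E y y0 (at 0)" "y0 \<in> U" and u: "limitin E u u0 (at 0)"
    and ws: "list_all2 (\<lambda>w l. limitin E w l (at 0)) ws ls"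
  shows "limitin F (\<lambda>t. (1 / t) *\<^sub>R
      (D (map (\<lambda>w. w t) ws) (y t + t *\<^sub>R u t) - D (map (\<lambda>w. w t) ws) (y t)))
    (D (u0 # ls) y0) (at 0)"
proof -
  \<comment> \<open>Convergence along \<open>N\<close> means \<open>t\<close> tends to 0 uniformly
    in the segment parameter \<open>s\<close>. Joint continuity along this filter yields the uniform
    estimate without a compactness argument.\<close>
  define N where "N = (at (0::real)) \<times>\<^sub>F principal {0..1::real}"
  define z where "z p = y (fst p) + (snd p * fst p) *\<^sub>R u (fst p)" for p :: "real \<times> real"
  have fst: "filterlim fst (at 0) N" unfolding N_def by (rule filterlim_fst)
  have lim_fst: "limitin E (\<lambda>p. w (fst p)) l N" if "limitin E w l (at 0)" for w l
    using that fst by (rule limitin_filterlim_compose)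
  have "((\<lambda>p. snd p * fst p) \<longlongrightarrow> 0) N"
  proof (rule Lim_null_comparison)
    show "\<forall>\<^sub>F p in N. norm (snd p * fst p) \<le> \<bar>fst p\<bar>"
      unfolding N_def eventually_prod_principal
      by (auto simp: abs_mult intro!: always_eventually mult_left_le_one_le)
    have "((\<lambda>t::real. \<bar>t\<bar>) \<longlongrightarrow> 0) (at 0)" by (rule tendsto_rabs_zero) simp
    from filterlim_compose[OF this fst] show "((\<lambda>p. \<bar>fst p\<bar>) \<longlongrightarrow> 0) N" .
  qed
  then have "limitin E z (y0 + 0 *\<^sub>R u0) N"
    unfolding z_def by (intro limitin_add[OF E] limitin_scaleR[OF E] lim_fst y u)
  then have z: "limitin E z y0 N" by simp
  have ev_z: "\<forall>\<^sub>F t in at 0. \<forall>s\<in>{0..1}. z (t, s) \<in> U"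
    using limitinD[OF z frechet_derivs_openin[OF D] y(2)]
    unfolding N_def eventually_prod_principal .
  have "list_all2 (\<lambda>w l. limitin E w l N) (map (\<lambda>w p. w (fst p)) (u # ws)) (u0 # ls)"
    unfolding list_all2_map1 using ws u
    by (auto intro: lim_fst elim!: list_all2_mono)
  from frechet_derivs_limitin[OF D z y(2) this]
  have L: "limitin F (\<lambda>p. D (u (fst p) # map (\<lambda>w. w (fst p)) ws) (z p)) (D (u0 # ls) y0) N"
    by (simp add: o_def)
  then have v: "D (u0 # ls) y0 \<in> topspace F" by (rule limitin_topspace)
  have ev_ws: "\<forall>\<^sub>F t in at 0. map (\<lambda>w. w t) ws \<in> lists (topspace E)"
    using ws
    by (induction rule: list_all2_induct)
       (auto dest!: limitin_eventually_topspace elim: eventually_elim2)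
  have ev_u: "\<forall>\<^sub>F t in at 0. u t \<in> topspace E"
    using u by (rule limitin_eventually_topspace)
  \<comment> \<open>With the factor \<open>1 / t\<close>, the derivative of \<open>G t\<close> in
    \<open>s\<close> is the next member of the family \<open>D\<close> at \<open>z (t, s)\<close>,
    and \<open>G t 1 - G t 0\<close> is the difference quotient in question.\<close>
  define G where "G t s = (1 / t) *\<^sub>R D (map (\<lambda>w. w t) ws) (z (t, s))" for t s
  have ev_G: "\<forall>\<^sub>F t in at 0. \<forall>s\<in>{0..1}. G t s \<in> topspace F"
    using ev_z ev_ws
    by eventually_elim
       (auto simp: G_def intro!: subspace_scale frechet_space_subspace F frechet_derivs_topspace[OF D])
  have ev_deriv: "\<forall>\<^sub>F t in at 0. \<forall>s\<in>{0..1}. limitin F (\<lambda>r. (1 / r) *\<^sub>R (G t (s + r) - G t s))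
      (D (u t # map (\<lambda>w. w t) ws) (z (t, s))) (at 0)"
    using ev_z ev_ws ev_u eventually_neq_at_within[of "0::real" 0 UNIV]
  proof eventually_elim
    case (elim t)
    show ?case
    proof
      fix s :: real assume s: "s \<in> {0..1}"
      let ?Q = "\<lambda>r. (1 / r) *\<^sub>R (D (map (\<lambda>w. w t) ws) (z (t, s) + r *\<^sub>R u t) -
        D (map (\<lambda>w. w t) ws) (z (t, s)))"
      have "limitin F ?Q (D (u t # map (\<lambda>w. w t) ws) (z (t, s))) (at 0)"
        by (rule frechet_derivs_deriv[OF D]) (use elim s in auto)
      from limitin_filterlim_compose[OF this filterlim_mult_at_0[of t]]
      have "limitin F (\<lambda>r. ?Q (r * t)) (D (u t # map (\<lambda>w. w t) ws) (z (t, s))) (at 0)"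
        using elim by simp
      moreover have "z (t, s) + (r * t) *\<^sub>R u t = z (t, s + r)" for r
        by (simp add: z_def algebra_simps)
      ultimately show "limitin F (\<lambda>r. (1 / r) *\<^sub>R (G t (s + r) - G t s))
          (D (u t # map (\<lambda>w. w t) ws) (z (t, s))) (at 0)"
        by (simp add: G_def scaleR_diff_right)
    qed
  qed
  have quot: "(1 / t) *\<^sub>R (D (map (\<lambda>w. w t) ws) (y t + t *\<^sub>R u t) - D (map (\<lambda>w. w t) ws) (y t)) =
      G t 1 - G t 0" for t
    by (simp add: G_def z_def scaleR_diff_right)
  show ?thesis
    unfolding quot limitin_frechet_space[OF F]
  proof (intro conjI allI v)
    show "\<forall>\<^sub>F t in at 0. G t 1 - G t 0 \<in> topspace F"
      using ev_G by eventually_elim (simp add: subspace_diff frechet_space_subspace F)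
    fix i
    show "((\<lambda>t. frechet_seminorm F i (G t 1 - G t 0 - D (u0 # ls) y0)) \<longlongrightarrow> 0) (at 0)"
    proof (rule tendstoI)
      fix e :: real assume e: "0 < e"
      have "((\<lambda>p. frechet_seminorm F i (D (u (fst p) # map (\<lambda>w. w (fst p)) ws) (z p) - D (u0 # ls) y0))
          \<longlongrightarrow> 0) N"
        using L unfolding limitin_frechet_space[OF F] by blast
      then have "\<forall>\<^sub>F p in N.
          frechet_seminorm F i (D (u (fst p) # map (\<lambda>w. w (fst p)) ws) (z p) - D (u0 # ls) y0) < e / 2"
        using e by (intro order_tendstoD(2)[where y = 0]) auto
      then have "\<forall>\<^sub>F t in at 0. \<forall>s\<in>{0..1}.
          frechet_seminorm F i (D (u t # map (\<lambda>w. w t) ws) (z (t, s)) - D (u0 # ls) y0) < e / 2"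
        unfolding N_def eventually_prod_principal by simp
      then show "\<forall>\<^sub>F t in at 0.
          dist (frechet_seminorm F i (G t 1 - G t 0 - D (u0 # ls) y0)) 0 < e"
        using ev_deriv ev_G
      proof eventually_elim
        case (elim t)
        have "frechet_seminorm F i (G t 1 - G t 0 - D (u0 # ls) y0) \<le> e / 2"
          by (rule frechet_mean_value[OF F,
                where \<gamma>' = "\<lambda>s. D (u t # map (\<lambda>w. w t) ws) (z (t, s))"])
             (use elim v in auto)
        moreover have "0 \<le> frechet_seminorm F i (G t 1 - G t 0 - D (u0 # ls) y0)"
          by (rule seminorm_nonneg[OF frechet_space_subspace[OF F] frechet_seminorm(1)[OF F]])
             (use elim v in \<open>simp add: subspace_diff frechet_space_subspace F\<close>)
        ultimately show ?case using e by simp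
      qed
    qed
  qed
qed

subsection \<open>Multilinearity\<close>

text \<open>The substitution of \<open>t * a\<close> for \<open>t\<close> in the difference quotient
  together with uniqueness of limits. It requires \<open>a \<noteq> 0\<close>; for
  \<open>a = 0\<close> the quotients vanish identically.\<close>

lemma frechet_derivs_scaleR_head:
  assumes E: "frechet_space E" and F: "frechet_space F" and D: "frechet_derivs E U F D"
    and mem: "h \<in> topspace E" "hs \<in> lists (topspace E)" "x \<in> U"
  shows "D ((a *\<^sub>R h) # hs) x = a *\<^sub>R D (h # hs) x"
proof -
  have ah: "a *\<^sub>R h \<in> topspace E"
    using mem frechet_space_subspace[OF E] by (simp add: subspace_scale)
  note lim = frechet_derivs_deriv[OF D mem(2) ah mem(3)]
  show ?thesis
  proof (cases "a = 0")
    case True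
    have "limitin F (\<lambda>t::real. 0) (D ((a *\<^sub>R h) # hs) x) (at 0)"
      using lim True by simp
    moreover have "limitin F (\<lambda>t::real. 0) 0 (at 0)"
      using F by (simp add: subspace_0 frechet_space_subspace)
    ultimately have "D ((a *\<^sub>R h) # hs) x = 0"
      by (rule limitin_frechet_unique[OF F _ _ at_neq_bot])
    then show ?thesis using True by simp
  next
    case False
    have "limitin F (\<lambda>t::real. a *\<^sub>R ((1 / (t * a)) *\<^sub>R (D hs (x + (t * a) *\<^sub>R h) - D hs x)))
        (a *\<^sub>R D (h # hs) x) (at 0)"
      by (intro limitin_scaleR_const[OF F]
          limitin_filterlim_compose[OF frechet_derivs_deriv[OF D mem(2,1,3)] filterlim_mult_at_0[OF False]])
    then have "limitin F (\<lambda>t::real. (1 / t) *\<^sub>R (D hs (x + t *\<^sub>R a *\<^sub>R h) - D hs x))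
        (a *\<^sub>R D (h # hs) x) (at 0)"
      using False by simp
    then show ?thesis
      using limitin_frechet_unique[OF F lim _ at_neq_bot] by blast
  qed
qed

text \<open>The increment from \<open>x\<close> to \<open>x + t (h + k)\<close> is made in two legs.
  The second leg starts at the moving point \<open>x + t h\<close>, which is why strict
  differentiability is used.\<close>

lemma frechet_derivs_add_head:
  assumes E: "frechet_space E" and F: "frechet_space F" and D: "frechet_derivs E U F D"
    and mem: "h \<in> topspace E" "k \<in> topspace E" "hs \<in> lists (topspace E)" "x \<in> U"
  shows "D ((h + k) # hs) x = D (h # hs) x + D (k # hs) x"
proof -
  have hk: "h + k \<in> topspace E"
    using mem frechet_space_subspace[OF E] by (simp add: subspace_add)
  have x: "x \<in> topspace E" using mem D frechet_derivs_openin openin_subset by blast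
  have "limitin E (\<lambda>t. x + t *\<^sub>R h) (x + 0 *\<^sub>R h) (at (0::real))"
    by (intro limitin_add[OF E] limitin_scaleR[OF E]) (use mem x in auto)
  then have "limitin F (\<lambda>t. (1 / t) *\<^sub>R
      (D (map (\<lambda>w. w t) (map (\<lambda>h t. h) hs)) ((x + t *\<^sub>R h) + t *\<^sub>R k) -
       D (map (\<lambda>w. w t) (map (\<lambda>h t. h) hs)) (x + t *\<^sub>R h))) (D (k # hs) x) (at 0)"
    by (intro frechet_derivs_increment[OF E F D] list_all2_limitin_const) (use mem in auto)
  then have "limitin F (\<lambda>t. (1 / t) *\<^sub>R (D hs (x + t *\<^sub>R h + t *\<^sub>R k) - D hs (x + t *\<^sub>R h)))
      (D (k # hs) x) (at 0)"
    by (simp add: o_def)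
  from limitin_add[OF F frechet_derivs_deriv[OF D mem(3,1,4)] this]
  have "limitin F (\<lambda>t. (1 / t) *\<^sub>R (D hs (x + t *\<^sub>R (h + k)) - D hs x))
      (D (h # hs) x + D (k # hs) x) (at 0)"
    by (simp add: algebra_simps)
  then show ?thesis
    using limitin_frechet_unique[OF F frechet_derivs_deriv[OF D mem(3) hk mem(4)] _ at_neq_bot] by blast
qed

text \<open>An inner slot inherits linearity from the head slot: the identity holds at all points
  near \<open>x\<close>, so it may be differentiated in the remaining directions \<open>ks\<close>
  one by one. Symmetry of higher derivatives does not enter.\<close>

lemma frechet_derivs_linear_slot:
  assumes E: "frechet_space E" and F: "frechet_space F" and D: "frechet_derivs E U F D"
    and mem: "h \<in> topspace E" "k \<in> topspace E" "hs \<in> lists (topspace E)" "ks \<in> lists (topspace E)"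
      "x \<in> U"
  shows "D (ks @ (a *\<^sub>R h + b *\<^sub>R k) # hs) x = a *\<^sub>R D (ks @ h # hs) x + b *\<^sub>R D (ks @ k # hs) x"
  using mem(4,5)
proof (induction ks arbitrary: x rule: list.induct)
  case Nil
  have "a *\<^sub>R h \<in> topspace E" "b *\<^sub>R k \<in> topspace E"
    using mem frechet_space_subspace[OF E] by (auto simp: subspace_scale)
  then show ?case
    using mem Nil by (simp add: frechet_derivs_add_head[OF E F D] frechet_derivs_scaleR_head[OF E F D])
next
  case (Cons g ks)
  note V = frechet_space_subspace[OF E]
  have g: "g \<in> topspace E" "ks \<in> lists (topspace E)" and x: "x \<in> U" using Cons.prems by auto
  have lists: "ks @ (a *\<^sub>R h + b *\<^sub>R k) # hs \<in> lists (topspace E)" "ks @ h # hs \<in> lists (topspace E)"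
    "ks @ k # hs \<in> lists (topspace E)"
    using mem g V by (auto simp: subspace_add subspace_scale)
  have "limitin F (\<lambda>t::real. a *\<^sub>R ((1 / t) *\<^sub>R (D (ks @ h # hs) (x + t *\<^sub>R g) - D (ks @ h # hs) x)) +
      b *\<^sub>R ((1 / t) *\<^sub>R (D (ks @ k # hs) (x + t *\<^sub>R g) - D (ks @ k # hs) x)))
      (a *\<^sub>R D (g # ks @ h # hs) x + b *\<^sub>R D (g # ks @ k # hs) x) (at 0)"
    by (intro limitin_add[OF F] limitin_scaleR_const[OF F] frechet_derivs_deriv[OF D] lists g x)
  moreover have "\<forall>\<^sub>F t::real in at 0. a *\<^sub>R ((1 / t) *\<^sub>R (D (ks @ h # hs) (x + t *\<^sub>R g) - D (ks @ h # hs) x)) +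
      b *\<^sub>R ((1 / t) *\<^sub>R (D (ks @ k # hs) (x + t *\<^sub>R g) - D (ks @ k # hs) x)) =
      (1 / t) *\<^sub>R (D (ks @ (a *\<^sub>R h + b *\<^sub>R k) # hs) (x + t *\<^sub>R g) - D (ks @ (a *\<^sub>R h + b *\<^sub>R k) # hs) x)"
  proof -
    have xE: "x \<in> topspace E" using x D frechet_derivs_openin openin_subset by blast
    have "limitin E (\<lambda>t. x + t *\<^sub>R g) (x + 0 *\<^sub>R g) (at (0::real))"
      by (intro limitin_add[OF E] limitin_scaleR[OF E]) (use g xE in auto)
    then have "\<forall>\<^sub>F t::real in at 0. x + t *\<^sub>R g \<in> U"
      by (rule limitinD[OF _ frechet_derivs_openin[OF D]]) (use x in simp)
    then show ?thesis
      by eventually_elim (simp add: Cons.IH[OF g(2)] x algebra_simps)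
  qed
  ultimately show ?case
    using limitin_frechet_unique[OF F frechet_derivs_deriv[OF D lists(1) g(1) x]
        limitin_transform_eventually at_neq_bot]
    by simp
qed

text \<open>Applied with \<open>c = 1 / t\<close>, this exchanges a difference quotient of values
  for a difference quotient inside a slot, to which joint continuity applies.\<close>

lemma frechet_derivs_quotient_slot:
  assumes E: "frechet_space E" and F: "frechet_space F" and D: "frechet_derivs E U F D"
    and mem: "h \<in> topspace E" "k \<in> topspace E" "hs \<in> lists (topspace E)" "ks \<in> lists (topspace E)"
      "x \<in> U"
  shows "D (ks @ (c *\<^sub>R (h - k)) # hs) x = c *\<^sub>R (D (ks @ h # hs) x - D (ks @ k # hs) x)"
  using frechet_derivs_linear_slot[OF E F D mem, of c "-c"] by (simp add: algebra_simps)

subsection \<open>Chain rule\<close>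

text \<open>Differentiating in direction \<open>h\<close> a term with one argument for each block
  hits one argument at a time, so \<open>h\<close> joins one block. It goes to the front of the
  block, as the latest direction does in \<open>D (h # hs)\<close>.\<close>

primrec insert_in_block :: "'a \<Rightarrow> 'a list list \<Rightarrow> 'a list list list"
  where
    "insert_in_block h [] = []"
  | "insert_in_block h (B # \<pi>) = ((h # B) # \<pi>) # map ((#) B) (insert_in_block h \<pi>)"

text \<open>The new direction either forms a block of its own, which comes from differentiating the
  outer map at its base point, or joins an existing block by the product rule. The singleton goes
  first, matching the position of the new direction in the derivative of the outer map.\<close>

primrec list_partitions :: "'a list \<Rightarrow> 'a list list list"
  where
    "list_partitions [] = [[]]"
  | "list_partitions (h # hs) = concat (map (\<lambda>\<pi>. ([h] # \<pi>) # insert_in_block h \<pi>) (list_partitions hs))"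

lemma map_insert_in_block:
  "insert_in_block (f h) (map (map f) \<pi>) = map (map (map f)) (insert_in_block h \<pi>)"
  by (induction \<pi>) (auto simp: o_def)

text \<open>Applied to \<open>[0..<k]\<close>, it makes the index set of the sum independent of the
  directions, so that joint continuity can be checked summand by summand.\<close>

lemma map_list_partitions: "list_partitions (map f hs) = map (map (map f)) (list_partitions hs)"
  by (induction hs) (auto simp: o_def map_concat map_insert_in_block)

lemma insert_in_block_lists:
  "\<pi>' \<in> set (insert_in_block h \<pi>) \<Longrightarrow> h \<in> V \<Longrightarrow> \<pi> \<in> lists (lists V) \<Longrightarrow> \<pi>' \<in> lists (lists V)"
  by (induction \<pi> arbitrary: \<pi>' rule: list.induct) (simp, simp, elim disjE imageE, simp_all)

lemma list_partitions_lists: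
  "\<pi> \<in> set (list_partitions hs) \<Longrightarrow> hs \<in> lists V \<Longrightarrow> \<pi> \<in> lists (lists V)"
proof (induction hs arbitrary: \<pi> rule: list.induct)
  case (Cons h hs)
  then obtain \<rho> where "\<rho> \<in> set (list_partitions hs)" "\<pi> = [h] # \<rho> \<or> \<pi> \<in> set (insert_in_block h \<rho>)"
    by auto
  moreover from this have "\<rho> \<in> lists (lists V)" using Cons by simp
  ultimately show ?case using Cons.prems insert_in_block_lists[of \<pi> h \<rho> V] by auto
qed simp

text \<open>Faa di Bruno's formula: the summands correspond to the partitions of the set of positions
  in \<open>hs\<close>.\<close>

definition comp_derivs ::
    "('f list \<Rightarrow> 'f \<Rightarrow> 'g::real_vector) \<Rightarrow> ('e list \<Rightarrow> 'e \<Rightarrow> 'f) \<Rightarrow> 'e list \<Rightarrow> 'e \<Rightarrow> 'g"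
  where "comp_derivs DG DF hs x = (\<Sum>\<pi>\<leftarrow>list_partitions hs. DG (map (\<lambda>B. DF B x) \<pi>) (DF [] x))"

lemma limitin_translate:
  assumes E: "frechet_space E" and "x \<in> topspace E" "h \<in> topspace E"
  shows "limitin E (\<lambda>t. x + t *\<^sub>R h) x (at (0::real))"
proof -
  have "limitin E (\<lambda>t. x + t *\<^sub>R h) (x + 0 *\<^sub>R h) (at (0::real))"
    by (intro limitin_add[OF E] limitin_scaleR[OF E]) (use assms in auto)
  then show ?thesis by simp
qed

lemma frechet_derivs_limitin_translate:
  assumes E: "frechet_space E" and D: "frechet_derivs E U F D"
    and x: "x \<in> U" and h: "h \<in> topspace E" and B: "B \<in> lists (topspace E)"
  shows "limitin F (\<lambda>t. D B (x + t *\<^sub>R h)) (D B x) (at (0::real))"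
proof -
  have "x \<in> topspace E" using x D frechet_derivs_openin openin_subset by blast
  then show ?thesis
    using frechet_derivs_limitin[OF D limitin_translate[OF E] x list_all2_limitin_const[OF B]] h
    by (simp add: o_def)
qed

lemma eventually_translate:
  assumes E: "frechet_space E" and U: "openin E U" and x: "x \<in> U" and h: "h \<in> topspace E"
  shows "\<forall>\<^sub>F t in at (0::real). x + t *\<^sub>R h \<in> U"
proof -
  have "x \<in> topspace E" using x U openin_subset by blast
  from limitinD[OF limitin_translate[OF E this h] U x] show ?thesis .
qed

context
  fixes E :: "'e::real_vector topology" and F :: "'f::real_vector topology"
    and G :: "'g::real_vector topology" and U V DF DG
  assumes E: "frechet_space E" and F: "frechet_space F" and G: "frechet_space G"
    and DF: "frechet_derivs E U F DF" and DG: "frechet_derivs F V G DG"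
begin

text \<open>The product rule with the base point of \<open>DG\<close> kept at
  \<open>DF [] x\<close>. Arguments are moved back from \<open>x + t h\<close> to \<open>x\<close>
  one slot at a time, \<open>\<sigma>\<close> being the slots already at \<open>x\<close>; each
  replacement contributes the term with \<open>h\<close> inserted in that block.\<close>

lemma limitin_telescope:
  assumes x: "x \<in> U" "DF [] x \<in> V" and h: "h \<in> topspace E"
    and lists: "\<sigma> \<in> lists (lists (topspace E))" "\<pi> \<in> lists (lists (topspace E))"
  shows "limitin G (\<lambda>t::real. (1 / t) *\<^sub>R
      (DG (map (\<lambda>B. DF B x) \<sigma> @ map (\<lambda>B. DF B (x + t *\<^sub>R h)) \<pi>) (DF [] x) -
       DG (map (\<lambda>B. DF B x) (\<sigma> @ \<pi>)) (DF [] x)))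
    (\<Sum>\<rho>\<leftarrow>insert_in_block h \<pi>. DG (map (\<lambda>B. DF B x) (\<sigma> @ \<rho>)) (DF [] x)) (at 0)"
  using lists
proof (induction \<pi> arbitrary: \<sigma> rule: list.induct)
  case Nil
  show ?case using G by (simp add: subspace_0 frechet_space_subspace)
next
  case (Cons B \<pi>)
  have B: "B \<in> lists (topspace E)" and \<pi>: "\<pi> \<in> lists (lists (topspace E))"
    and \<sigma>: "\<sigma> \<in> lists (lists (topspace E))"
    using Cons.prems by auto
  let ?y = "DF [] x" and ?\<sigma> = "map (\<lambda>B. DF B x) \<sigma>"
  let ?q = "\<lambda>t::real. (1 / t) *\<^sub>R (DF B (x + t *\<^sub>R h) - DF B x)"
  let ?R = "\<lambda>t::real. map (\<lambda>B. DF B (x + t *\<^sub>R h)) \<pi>"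
  have mem: "?\<sigma> \<in> lists (topspace F)"
    using \<sigma> x frechet_derivs_topspace[OF DF] by (auto simp: in_lists_conv_set)
  have y: "?y \<in> topspace F" using frechet_derivs_topspace[OF DF x(1), of "[]"] by simp
  have "list_all2 (\<lambda>w l. limitin F w l (at 0))
      (map (\<lambda>v t. v) ?\<sigma> @ ?q # map (\<lambda>B t. DF B (x + t *\<^sub>R h)) \<pi>)
      (?\<sigma> @ DF (h # B) x # map (\<lambda>B. DF B x) \<pi>)"
  proof (intro list_all2_appendI list_all2_limitin_const mem list_all2_Cons[THEN iffD2] conjI)
    show "limitin F ?q (DF (h # B) x) (at 0)"
      by (rule frechet_derivs_deriv[OF DF B h x(1)])
    show "list_all2 (\<lambda>w l. limitin F w l (at 0))
        (map (\<lambda>B t. DF B (x + t *\<^sub>R h)) \<pi>) (map (\<lambda>B. DF B x) \<pi>)"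
      using \<pi> by (auto simp: list_all2_map1 list_all2_map2 list_all2_same in_lists_conv_set
          intro!: frechet_derivs_limitin_translate[OF E DF x(1) h])
  qed
  then have "limitin G (\<lambda>t. DG (map (\<lambda>w. w t)
      (map (\<lambda>v t. v) ?\<sigma> @ ?q # map (\<lambda>B t. DF B (x + t *\<^sub>R h)) \<pi>)) ?y)
      (DG (?\<sigma> @ DF (h # B) x # map (\<lambda>B. DF B x) \<pi>) ?y) (at 0)"
    by (intro frechet_derivs_limitin[OF DG _ x(2)]) (use y in simp)
  then have 1: "limitin G (\<lambda>t. DG (?\<sigma> @ ?q t # ?R t) ?y)
      (DG (?\<sigma> @ DF (h # B) x # map (\<lambda>B. DF B x) \<pi>) ?y) (at 0)"
    by (simp add: o_def)
  have 2: "limitin G (\<lambda>t::real. (1 / t) *\<^sub>R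
      (DG (map (\<lambda>B. DF B x) (\<sigma> @ [B]) @ ?R t) ?y -
       DG (map (\<lambda>B. DF B x) ((\<sigma> @ [B]) @ \<pi>)) ?y))
    (\<Sum>\<rho>\<leftarrow>insert_in_block h \<pi>. DG (map (\<lambda>B. DF B x) ((\<sigma> @ [B]) @ \<rho>)) ?y) (at 0)"
    by (rule Cons.IH) (use \<sigma> B \<pi> in auto)
  \<comment> \<open>Linearity of the slot puts the quotient inside \<open>DG\<close>. The identity
    is needed only for small \<open>t\<close>, where \<open>x + t h\<close> stays in
    \<open>U\<close>.\<close>
  have "\<forall>\<^sub>F t::real in at 0. DG (?\<sigma> @ ?q t # ?R t) ?y =
      (1 / t) *\<^sub>R (DG (?\<sigma> @ DF B (x + t *\<^sub>R h) # ?R t) ?y - DG (?\<sigma> @ DF B x # ?R t) ?y)"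
    using eventually_translate[OF E frechet_derivs_openin[OF DF] x(1) h]
  proof eventually_elim
    case (elim t)
    show ?case
      by (rule frechet_derivs_quotient_slot[OF F G DG _ _ _ mem x(2)])
        (use \<pi> elim in \<open>auto simp: in_lists_conv_set
            intro!: frechet_derivs_topspace[OF DF _ B] frechet_derivs_topspace[OF DF] x\<close>)
  qed
  from limitin_add[OF G limitin_transform_eventually[OF this 1] 2]
  show ?case
    by (simp add: o_def algebra_simps)
qed

text \<open>Two effects are separated: the motion of the base point \<open>DF [] x\<close> gives the
  singleton block \<open>[h]\<close>, and the motion of the arguments is
  \<open>limitin_telescope\<close>.\<close>

lemma limitin_comp_term:
  assumes x: "x \<in> U" "DF [] x \<in> V" and h: "h \<in> topspace E" and \<pi>: "\<pi> \<in> lists (lists (topspace E))"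
  shows "limitin G (\<lambda>t::real. (1 / t) *\<^sub>R
      (DG (map (\<lambda>B. DF B (x + t *\<^sub>R h)) \<pi>) (DF [] (x + t *\<^sub>R h)) - DG (map (\<lambda>B. DF B x) \<pi>) (DF [] x)))
    (\<Sum>\<rho>\<leftarrow>([h] # \<pi>) # insert_in_block h \<pi>. DG (map (\<lambda>B. DF B x) \<rho>) (DF [] x)) (at 0)"
proof -
  \<comment> \<open>The moved base point equals \<open>?y + t *\<^sub>R ?u t\<close> for
    \<open>t \<noteq> 0\<close>. So \<open>?u\<close> is a convergent moving direction, as
    \<open>frechet_derivs_increment\<close> allows.\<close>
  let ?y = "DF [] x" and ?u = "\<lambda>t::real. (1 / t) *\<^sub>R (DF [] (x + t *\<^sub>R h) - DF [] x)"
  let ?R = "\<lambda>t::real. map (\<lambda>B. DF B (x + t *\<^sub>R h)) \<pi>"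
  have y: "?y \<in> topspace F" using frechet_derivs_topspace[OF DF x(1), of "[]"] by simp
  have "limitin G (\<lambda>t. (1 / t) *\<^sub>R
      (DG (map (\<lambda>w. w t) (map (\<lambda>B t. DF B (x + t *\<^sub>R h)) \<pi>)) (?y + t *\<^sub>R ?u t) -
       DG (map (\<lambda>w. w t) (map (\<lambda>B t. DF B (x + t *\<^sub>R h)) \<pi>)) ?y))
      (DG (DF [h] x # map (\<lambda>B. DF B x) \<pi>) ?y) (at 0)"
  proof (rule frechet_derivs_increment[OF F G DG _ x(2)])
    show "limitin F ?u (DF [h] x) (at 0)"
      by (rule frechet_derivs_deriv[OF DF _ h x(1)]) simp
    show "list_all2 (\<lambda>w l. limitin F w l (at 0))
        (map (\<lambda>B t. DF B (x + t *\<^sub>R h)) \<pi>) (map (\<lambda>B. DF B x) \<pi>)"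
      using \<pi> by (auto simp: list_all2_map1 list_all2_map2 list_all2_same in_lists_conv_set
          intro!: frechet_derivs_limitin_translate[OF E DF x(1) h])
  qed (use y in simp)
  moreover have "\<forall>\<^sub>F t::real in at 0. ?y + t *\<^sub>R ?u t = DF [] (x + t *\<^sub>R h)"
    using eventually_neq_at_within[of "0::real" 0 UNIV] by eventually_elim simp
  then have "\<forall>\<^sub>F t::real in at 0. (1 / t) *\<^sub>R
      (DG (map (\<lambda>w. w t) (map (\<lambda>B t. DF B (x + t *\<^sub>R h)) \<pi>)) (?y + t *\<^sub>R ?u t) -
       DG (map (\<lambda>w. w t) (map (\<lambda>B t. DF B (x + t *\<^sub>R h)) \<pi>)) ?y) =
      (1 / t) *\<^sub>R (DG (?R t) (DF [] (x + t *\<^sub>R h)) - DG (?R t) ?y)"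
    by eventually_elim (simp add: o_def)
  ultimately have 1: "limitin G (\<lambda>t. (1 / t) *\<^sub>R (DG (?R t) (DF [] (x + t *\<^sub>R h)) - DG (?R t) ?y))
      (DG (DF [h] x # map (\<lambda>B. DF B x) \<pi>) ?y) (at 0)"
    by (rule limitin_transform_eventually[rotated])
  from limitin_add[OF G 1 limitin_telescope[OF x h _ \<pi>, of "[]"]]
  show ?thesis by (simp add: algebra_simps)
qed

text \<open>The recursion of \<open>list_partitions\<close> is exactly the termwise derivative given
  by \<open>limitin_comp_term\<close>, so one closed formula supplies the derivatives of all
  orders.\<close>

lemma frechet_derivs_comp: "frechet_derivs E {x \<in> U. DF [] x \<in> V} G (comp_derivs DG DF)"
proof (rule frechet_derivsI)
  have "frechet_smooth E U F (DF [])" unfolding frechet_smooth_iff_derivs using DF by blast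
  then show "openin E {x \<in> U. DF [] x \<in> V}"
    by (rule openin_frechet_smooth_preimage[OF _ frechet_derivs_openin[OF DG]])
next
  fix hs h x assume hs: "hs \<in> lists (topspace E)" and h: "h \<in> topspace E"
    and x: "x \<in> {x \<in> U. DF [] x \<in> V}"
  have "limitin G (\<lambda>t::real. \<Sum>\<pi>\<leftarrow>list_partitions hs. (1 / t) *\<^sub>R
      (DG (map (\<lambda>B. DF B (x + t *\<^sub>R h)) \<pi>) (DF [] (x + t *\<^sub>R h)) - DG (map (\<lambda>B. DF B x) \<pi>) (DF [] x)))
    (\<Sum>\<pi>\<leftarrow>list_partitions hs. \<Sum>\<rho>\<leftarrow>([h] # \<pi>) # insert_in_block h \<pi>. DG (map (\<lambda>B. DF B x) \<rho>) (DF [] x)) (at 0)"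
    by (rule limitin_sum_list[OF G], rule limitin_comp_term)
       (use x h list_partitions_lists[OF _ hs] in auto)
  moreover have "(\<Sum>\<pi>\<leftarrow>ps. a *\<^sub>R (f \<pi> - g \<pi>)) = a *\<^sub>R ((\<Sum>\<pi>\<leftarrow>ps. f \<pi>) - (\<Sum>\<pi>\<leftarrow>ps. g \<pi>))"
    for a :: real and f g :: "'e list list \<Rightarrow> 'g" and ps
    by (induction ps) (auto simp: algebra_simps)
  moreover have "(\<Sum>\<rho>\<leftarrow>concat (map k ps). f \<rho>) = (\<Sum>\<pi>\<leftarrow>ps. \<Sum>\<rho>\<leftarrow>k \<pi>. f \<rho>)"
    for k :: "'e list list \<Rightarrow> 'e list list list" and f :: "'e list list \<Rightarrow> 'g" and ps
    by (induction ps) auto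
  ultimately show "limitin G (\<lambda>t::real. (1 / t) *\<^sub>R (comp_derivs DG DF hs (x + t *\<^sub>R h) - comp_derivs DG DF hs x))
      (comp_derivs DG DF (h # hs) x) (at 0)"
    by (simp only: comp_derivs_def list_partitions.simps)
next
  fix k x h and net :: "('e \<times> (nat \<Rightarrow> 'e)) filter"
  assume x: "x \<in> {x \<in> U. DF [] x \<in> V}" and lim: "limitin E fst x net"
    and "\<And>j. j < k \<Longrightarrow> h j \<in> topspace E"
    and h: "\<And>j. j < k \<Longrightarrow> limitin E (\<lambda>p. snd p j) (h j) net"
  have "limitin G (\<lambda>p. DG (map (\<lambda>B. DF (map (snd p) B) (fst p)) \<pi>) (DF [] (fst p)))
      (DG (map (\<lambda>B. DF (map h B) x) \<pi>) (DF [] x)) net"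
    if \<pi>: "\<pi> \<in> set (list_partitions [0..<k])" for \<pi>
  proof -
    have lims: "limitin F (\<lambda>p. DF (map (snd p) B) (fst p)) (DF (map h B) x) net"
      if "B \<in> lists {..<k}" for B
    proof -
      have "list_all2 (\<lambda>w l. limitin E w l net) (map (\<lambda>j p. snd p j) B) (map h B)"
        using h that by (auto simp: list_all2_map1 list_all2_map2 list_all2_same)
      from frechet_derivs_limitin[OF DF lim _ this] show ?thesis using x by (simp add: o_def)
    qed
    have "\<pi> \<in> lists (lists {..<k})" by (rule list_partitions_lists[OF \<pi>]) auto
    then have "list_all2 (\<lambda>w l. limitin F w l net)
        (map (\<lambda>B p. DF (map (snd p) B) (fst p)) \<pi>) (map (\<lambda>B. DF (map h B) x) \<pi>)"
      using lims by (auto simp: list_all2_map1 list_all2_map2 list_all2_same)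
    from frechet_derivs_limitin[OF DG lims[of "[]", simplified] _ this] show ?thesis
      using x by (simp add: o_def)
  qed
  then show "limitin G (\<lambda>p. comp_derivs DG DF (map (snd p) [0..<k]) (fst p))
      (comp_derivs DG DF (map h [0..<k]) x) net"
    unfolding comp_derivs_def map_list_partitions map_map
    by (intro limitin_sum_list[OF G]) (simp add: o_def)
qed

end

lemma frechet_smooth_compose:
  assumes "frechet_space E" "frechet_space F" "frechet_space G"
    and f: "frechet_smooth E U F f" and g: "frechet_smooth F V G g"
  shows "frechet_smooth E {x \<in> U. f x \<in> V} G (\<lambda>x. g (f x))"
proof -
  obtain DF where DF: "frechet_derivs E U F DF" "\<And>x. x \<in> U \<Longrightarrow> DF [] x = f x"
    using f unfolding frechet_smooth_iff_derivs by blast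
  obtain DG where DG: "frechet_derivs F V G DG" "\<And>x. x \<in> V \<Longrightarrow> DG [] x = g x"
    using g unfolding frechet_smooth_iff_derivs by blast
  have "{x \<in> U. DF [] x \<in> V} = {x \<in> U. f x \<in> V}" using DF(2) by auto
  then have "frechet_derivs E {x \<in> U. f x \<in> V} G (comp_derivs DG DF)"
    using frechet_derivs_comp[OF assms(1-3) DF(1) DG(1)] by simp
  moreover have "comp_derivs DG DF [] x = g (f x)" if "x \<in> {x \<in> U. f x \<in> V}" for x
    using that DF(2) DG(2) by (simp add: comp_derivs_def)
  ultimately show ?thesis unfolding frechet_smooth_iff_derivs by blast
qed

subsection \<open>Locality, restriction and products\<close>

text \<open>Built from \<open>F\<close> and \<open>f\<close> alone, with no mention of an open set.
  Families found on different open sets can therefore be compared with one and the same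
  candidate.\<close>

definition canonical_derivs ::
    "'f::real_vector topology \<Rightarrow> ('e::real_vector \<Rightarrow> 'f) \<Rightarrow> 'e list \<Rightarrow> 'e \<Rightarrow> 'f"
  where "canonical_derivs F f hs = rec_list f (\<lambda>h _ g x.
    SOME l. limitin F (\<lambda>t::real. (1 / t) *\<^sub>R (g (x + t *\<^sub>R h) - g x)) l (at 0)) hs"

lemma canonical_derivs_simps:
  "canonical_derivs F f [] = f"
  "canonical_derivs F f (h # hs) = (\<lambda>x. SOME l. limitin F (\<lambda>t::real. (1 / t) *\<^sub>R
    (canonical_derivs F f hs (x + t *\<^sub>R h) - canonical_derivs F f hs x)) l (at 0))"
  by (simp_all add: canonical_derivs_def)

text \<open>Difference quotients at \<open>x\<close> only see points of \<open>U\<close> once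
  \<open>t\<close> is small, and their limit is unique; so the chosen limit is forced to be the
  given derivative.\<close>

lemma canonical_derivs_eq:
  assumes E: "frechet_space E" and F: "frechet_space F" and D: "frechet_derivs E U F D"
    and f: "\<And>x. x \<in> U \<Longrightarrow> D [] x = f x" and x: "x \<in> U" and hs: "hs \<in> lists (topspace E)"
  shows "canonical_derivs F f hs x = D hs x"
  using x hs
proof (induction hs arbitrary: x rule: list.induct)
  case (Cons h hs)
  have h: "h \<in> topspace E" and hs: "hs \<in> lists (topspace E)" using Cons.prems by auto
  let ?q = "\<lambda>D (t::real). (1 / t) *\<^sub>R (D hs (x + t *\<^sub>R h) - D hs x)"
  have lim: "limitin F (?q D) (D (h # hs) x) (at 0)"
    by (rule frechet_derivs_deriv[OF D hs h \<open>x \<in> U\<close>])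
  have "\<forall>\<^sub>F t::real in at 0. ?q D t = ?q (canonical_derivs F f) t"
    using eventually_translate[OF E frechet_derivs_openin[OF D] \<open>x \<in> U\<close> h]
    by eventually_elim (simp add: Cons.IH Cons.prems hs)
  from limitin_transform_eventually[OF this lim]
  have "limitin F (?q (canonical_derivs F f)) l (at 0) \<longleftrightarrow> l = D (h # hs) x" for l
    using limitin_frechet_unique[OF F _ _ at_neq_bot] by blast
  then show ?case by (simp add: canonical_derivs_simps)
qed (simp add: canonical_derivs_simps f)

lemma frechet_smooth_canonical:
  assumes E: "frechet_space E" and F: "frechet_space F" and f: "frechet_smooth E U F f"
  shows "frechet_derivs E U F (canonical_derivs F f)"
proof -
  obtain D where D: "frechet_derivs E U F D" "\<And>x. x \<in> U \<Longrightarrow> D [] x = f x"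
    using f unfolding frechet_smooth_iff_derivs by blast
  have eq: "canonical_derivs F f hs x = D hs x" if "x \<in> U" "hs \<in> lists (topspace E)" for x hs
    by (rule canonical_derivs_eq[OF E F D(1) _ that]) (rule D(2))
  have U: "openin E U" by (rule frechet_derivs_openin[OF D(1)])
  show ?thesis
  proof (rule frechet_derivsI[OF U])
    fix hs h x assume hs: "hs \<in> lists (topspace E)" and h: "h \<in> topspace E" and x: "x \<in> U"
    have "\<forall>\<^sub>F t::real in at 0. (1 / t) *\<^sub>R (D hs (x + t *\<^sub>R h) - D hs x) =
        (1 / t) *\<^sub>R (canonical_derivs F f hs (x + t *\<^sub>R h) - canonical_derivs F f hs x)"
      using eventually_translate[OF E U x h] by eventually_elim (simp add: eq x hs)
    from limitin_transform_eventually[OF this frechet_derivs_deriv[OF D(1) hs h x]]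
    show "limitin F (\<lambda>t::real. (1 / t) *\<^sub>R (canonical_derivs F f hs (x + t *\<^sub>R h) - canonical_derivs F f hs x))
        (canonical_derivs F f (h # hs) x) (at 0)"
      using eq[OF x, of "h # hs"] hs h by simp
  next
    fix k x h and net :: "('a \<times> (nat \<Rightarrow> 'a)) filter"
    assume x: "x \<in> U" and lim: "limitin E fst x net"
      and hE: "\<And>j. j < k \<Longrightarrow> h j \<in> topspace E"
      and h: "\<And>j. j < k \<Longrightarrow> limitin E (\<lambda>p. snd p j) (h j) net"
    have "list_all2 (\<lambda>w l. limitin E w l net) (map (\<lambda>j p. snd p j) [0..<k]) (map h [0..<k])"
      using h by (auto simp: list_all2_map1 list_all2_map2 list_all2_same)
    from frechet_derivs_limitin[OF D(1) lim x this]
    have L: "limitin F (\<lambda>p. D (map (snd p) [0..<k]) (fst p)) (D (map h [0..<k]) x) net"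
      by (simp add: o_def)
    have "\<forall>\<^sub>F p in net. \<forall>j\<in>{..<k}. snd p j \<in> topspace E"
      by (intro eventually_ball_finite) (use h in \<open>auto dest: limitin_eventually_topspace\<close>)
    then have "\<forall>\<^sub>F p in net. D (map (snd p) [0..<k]) (fst p) =
        canonical_derivs F f (map (snd p) [0..<k]) (fst p)"
      using limitinD[OF lim U x]
      by eventually_elim (rule eq[symmetric], auto)
    from limitin_transform_eventually[OF this L]
    show "limitin F (\<lambda>p. canonical_derivs F f (map (snd p) [0..<k]) (fst p))
        (canonical_derivs F f (map h [0..<k]) x) net"
      by (subst eq[OF x]) (use hE in auto)
  qed
qed

text \<open>The local witnesses need not agree as given, but each may be replaced by
  \<open>canonical_derivs F f\<close>, which is the same for every \<open>V\<close>.\<close>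

lemma frechet_smooth_local:
  assumes E: "frechet_space E" and F: "frechet_space F"
    and loc: "\<And>x. x \<in> U \<Longrightarrow> \<exists>V. x \<in> V \<and> V \<subseteq> U \<and> frechet_smooth E V F f"
  shows "frechet_smooth E U F f"
proof -
  have "frechet_derivs E U F (canonical_derivs F f)"
  proof (rule frechet_derivsI)
    have "\<exists>T. openin E T \<and> x \<in> T \<and> T \<subseteq> U" if "x \<in> U" for x
      using loc[OF that] by (elim exE conjE) (intro exI conjI, rule frechet_smooth_openin)
    then show "openin E U" by (simp add: openin_subopen[of E U])
  next
    fix hs h x assume hs: "hs \<in> lists (topspace E)" and h: "h \<in> topspace E" and x: "x \<in> U"
    obtain V where V: "x \<in> V" "frechet_smooth E V F f" using loc[OF x] by blast
    show "limitin F (\<lambda>t::real. (1 / t) *\<^sub>R (canonical_derivs F f hs (x + t *\<^sub>R h) - canonical_derivs F f hs x))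
        (canonical_derivs F f (h # hs) x) (at 0)"
      by (rule frechet_derivs_deriv[OF frechet_smooth_canonical[OF E F V(2)] hs h V(1)])
  next
    fix k x h and net :: "('a \<times> (nat \<Rightarrow> 'a)) filter"
    assume x: "x \<in> U" and lim: "limitin E fst x net"
      and h: "\<And>j. j < k \<Longrightarrow> limitin E (\<lambda>p. snd p j) (h j) net"
    obtain V where V: "x \<in> V" "frechet_smooth E V F f" using loc[OF x] by blast
    have "list_all2 (\<lambda>w l. limitin E w l net) (map (\<lambda>j p. snd p j) [0..<k]) (map h [0..<k])"
      using h by (auto simp: list_all2_map1 list_all2_map2 list_all2_same)
    from frechet_derivs_limitin[OF frechet_smooth_canonical[OF E F V(2)] lim V(1) this]
    show "limitin F (\<lambda>p. canonical_derivs F f (map (snd p) [0..<k]) (fst p))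
        (canonical_derivs F f (map h [0..<k]) x) net"
      by (simp add: o_def)
  qed
  then show ?thesis
    unfolding frechet_smooth_iff_derivs using canonical_derivs_simps(1) by metis
qed

text \<open>The family \<open>D\<close> itself serves again. Along directions of \<open>E0\<close>
  its values are limits of quotients in \<open>F0\<close>, hence in \<open>F0\<close> by closedness.
  A limit in a subtopology is an ambient limit whose net and value lie in the subset.\<close>

lemma frechet_smooth_restrict:
  assumes E: "frechet_space E" and F: "frechet_space F" and f: "frechet_smooth E U F f"
    and E0: "subspace E0" "E0 \<subseteq> topspace E" and F0: "subspace F0" "closedin F F0"
    and image: "\<And>x. x \<in> U \<Longrightarrow> x \<in> E0 \<Longrightarrow> f x \<in> F0"
  shows "frechet_smooth (subtopology E E0) (U \<inter> E0) (subtopology F F0) f"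
proof -
  obtain D where D: "frechet_derivs E U F D" "\<And>x. x \<in> U \<Longrightarrow> D [] x = f x"
    using f unfolding frechet_smooth_iff_derivs by blast
  have U: "openin E U" by (rule frechet_derivs_openin[OF D(1)])
  have top: "topspace (subtopology E E0) = E0" using E0(2) by auto
  have step: "\<forall>\<^sub>F t::real in at 0. x + t *\<^sub>R h \<in> U \<inter> E0" if "x \<in> U \<inter> E0" "h \<in> E0" for x h
  proof -
    have "\<forall>\<^sub>F t::real in at 0. x + t *\<^sub>R h \<in> U"
      by (rule eventually_translate[OF E U]) (use that E0 in auto)
    then show ?thesis
      by eventually_elim (use that E0(1) in \<open>simp add: subspace_add subspace_scale\<close>)
  qed
  have val: "D hs x \<in> F0" if "hs \<in> lists E0" "x \<in> U \<inter> E0" for hs x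
    using that
  proof (induction hs arbitrary: x rule: list.induct)
    case Nil
    then show ?case using D(2) image by auto
  next
    case (Cons h hs)
    have "limitin F (\<lambda>t::real. (1 / t) *\<^sub>R (D hs (x + t *\<^sub>R h) - D hs x)) (D (h # hs) x) (at 0)"
      by (rule frechet_derivs_deriv[OF D(1)]) (use Cons.prems E0(2) in auto)
    moreover have "\<forall>\<^sub>F t::real in at 0. (1 / t) *\<^sub>R (D hs (x + t *\<^sub>R h) - D hs x) \<in> F0"
    proof -
      have "\<forall>\<^sub>F t::real in at 0. x + t *\<^sub>R h \<in> U \<inter> E0"
        by (rule step) (use Cons.prems in auto)
      then show ?thesis
        by eventually_elim
          (use Cons F0(1) in \<open>auto intro!: subspace_scale subspace_diff\<close>)
    qed
    ultimately show ?case
      using limitin_closedin[OF _ F0(2)] at_neq_bot by blast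
  qed
  have "frechet_derivs (subtopology E E0) (U \<inter> E0) (subtopology F F0) D"
  proof (rule frechet_derivsI)
    show "openin (subtopology E E0) (U \<inter> E0)"
      using U by (auto simp: openin_subtopology)
  next
    fix hs h x assume hs: "hs \<in> lists (topspace (subtopology E E0))"
      and h: "h \<in> topspace (subtopology E E0)" and x: "x \<in> U \<inter> E0"
    have lists: "hs \<in> lists E0" and hE: "h \<in> E0" using hs h top by auto
    have "\<forall>\<^sub>F t::real in at 0. (1 / t) *\<^sub>R (D hs (x + t *\<^sub>R h) - D hs x) \<in> F0"
      using step[OF x hE]
      by eventually_elim (auto intro!: subspace_scale subspace_diff F0 val[OF lists] x)
    moreover have "limitin F (\<lambda>t::real. (1 / t) *\<^sub>R (D hs (x + t *\<^sub>R h) - D hs x)) (D (h # hs) x) (at 0)"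
      by (rule frechet_derivs_deriv[OF D(1)]) (use lists hE x E0(2) in auto)
    ultimately show "limitin (subtopology F F0)
        (\<lambda>t::real. (1 / t) *\<^sub>R (D hs (x + t *\<^sub>R h) - D hs x)) (D (h # hs) x) (at 0)"
      unfolding limitin_subtopology using val[of "h # hs"] lists hE x by simp
  next
    fix k x h and net :: "('a \<times> (nat \<Rightarrow> 'a)) filter"
    assume x: "x \<in> U \<inter> E0" and lim: "limitin (subtopology E E0) fst x net"
      and hE: "\<And>j. j < k \<Longrightarrow> h j \<in> topspace (subtopology E E0)"
      and h: "\<And>j. j < k \<Longrightarrow> limitin (subtopology E E0) (\<lambda>p. snd p j) (h j) net"
    have lim': "limitin E fst x net" "\<forall>\<^sub>F p in net. fst p \<in> E0"
      using lim by (auto simp: limitin_subtopology)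
    have h': "limitin E (\<lambda>p. snd p j) (h j) net" "\<forall>\<^sub>F p in net. snd p j \<in> E0" if "j < k" for j
      using h[OF that] by (auto simp: limitin_subtopology)
    have "list_all2 (\<lambda>w l. limitin E w l net) (map (\<lambda>j p. snd p j) [0..<k]) (map h [0..<k])"
      using h' by (auto simp: list_all2_map1 list_all2_map2 list_all2_same)
    from frechet_derivs_limitin[OF D(1) lim'(1) _ this]
    have L: "limitin F (\<lambda>p. D (map (snd p) [0..<k]) (fst p)) (D (map h [0..<k]) x) net"
      using x by (simp add: o_def)
    have "\<forall>\<^sub>F p in net. \<forall>j\<in>{..<k}. snd p j \<in> E0"
      by (intro eventually_ball_finite) (use h' in auto)
    moreover have "\<forall>\<^sub>F p in net. fst p \<in> U"
      using limitinD[OF lim'(1) U] x by blast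
    ultimately have "\<forall>\<^sub>F p in net. D (map (snd p) [0..<k]) (fst p) \<in> F0"
      using lim'(2) by eventually_elim (rule val, auto)
    then show "limitin (subtopology F F0) (\<lambda>p. D (map (snd p) [0..<k]) (fst p))
        (D (map h [0..<k]) x) net"
      unfolding limitin_subtopology using L hE top x by (auto intro!: val)
  qed
  then show ?thesis
    unfolding frechet_smooth_iff_derivs using D(2) by blast
qed

text \<open>Serves to shrink domains, by composing with the identity of a smaller open set, and as
  the untouched factor of coordinate changes on a product.\<close>

lemma frechet_smooth_ident:
  assumes E: "frechet_space E" and U: "openin E U"
  shows "frechet_smooth E U E (\<lambda>x. x)"
proof -
  define D where "D hs x = (case hs of [] \<Rightarrow> x | [h] \<Rightarrow> h | _ \<Rightarrow> 0)" for hs and x :: 'a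
  have 0: "0 \<in> topspace E" using E by (simp add: subspace_0 frechet_space_subspace)
  have "frechet_derivs E U E D"
  proof (rule frechet_derivsI[OF U])
    fix hs h x assume *: "hs \<in> lists (topspace E)" "h \<in> topspace E" "x \<in> U"
    show "limitin E (\<lambda>t::real. (1 / t) *\<^sub>R (D hs (x + t *\<^sub>R h) - D hs x)) (D (h # hs) x) (at 0)"
    proof (cases hs)
      case Nil
      have "\<forall>\<^sub>F t::real in at 0. (1 / t) *\<^sub>R (D hs (x + t *\<^sub>R h) - D hs x) = h"
        using eventually_neq_at_within[of "0::real" 0 UNIV]
        by eventually_elim (simp add: D_def Nil)
      then show ?thesis
        using * by (intro limitin_eventually) (auto simp: D_def Nil)
    next
      case (Cons k ks)
      then show ?thesis using 0 by (auto simp: D_def split: list.split)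
    qed
  next
    fix k x h and net :: "('a \<times> (nat \<Rightarrow> 'a)) filter"
    assume *: "x \<in> U" "limitin E fst x net"
      "\<And>j. j < k \<Longrightarrow> limitin E (\<lambda>p. snd p j) (h j) net"
    consider "k = 0" | "k = 1" | m where "k = Suc (Suc m)"
      by (metis One_nat_def not0_implies_Suc)
    then show "limitin E (\<lambda>p. D (map (snd p) [0..<k]) (fst p)) (D (map h [0..<k]) x) net"
    proof cases
      case 3
      then show ?thesis using 0 by (simp add: D_def upt_rec split: list.split)
    qed (use * in \<open>auto simp: D_def\<close>)
  qed
  then show ?thesis
    unfolding frechet_smooth_iff_derivs by (intro exI[of _ D]) (simp add: D_def)
qed

lemma limitin_fst: "limitin (prod_topology E F) y z net \<Longrightarrow> limitin E (\<lambda>t. fst (y t)) (fst z) net"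
  and limitin_snd: "limitin (prod_topology E F) y z net \<Longrightarrow> limitin F (\<lambda>t. snd (y t)) (snd z) net"
  unfolding limitin_pairwise by (auto simp: o_def)

lemma frechet_smooth_map_prod:
  assumes f: "frechet_smooth E U F f" and g: "frechet_smooth E' U' F' g"
  shows "frechet_smooth (prod_topology E E') (U \<times> U') (prod_topology F F') (map_prod f g)"
proof -
  obtain D where D: "frechet_derivs E U F D" "\<And>x. x \<in> U \<Longrightarrow> D [] x = f x"
    using f unfolding frechet_smooth_iff_derivs by blast
  obtain D' where D': "frechet_derivs E' U' F' D'" "\<And>x. x \<in> U' \<Longrightarrow> D' [] x = g x"
    using g unfolding frechet_smooth_iff_derivs by blast
  define DD where "DD hs z = (D (map fst hs) (fst z), D' (map snd hs) (snd z))" for hs z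
  have "frechet_derivs (prod_topology E E') (U \<times> U') (prod_topology F F') DD"
  proof (rule frechet_derivsI)
    show "openin (prod_topology E E') (U \<times> U')"
      using frechet_derivs_openin[OF D(1)] frechet_derivs_openin[OF D'(1)]
      by (simp add: openin_prod_Times_iff)
  next
    fix hs h z assume hs: "hs \<in> lists (topspace (prod_topology E E'))"
      and h: "h \<in> topspace (prod_topology E E')" and z: "z \<in> U \<times> U'"
    have "map fst hs \<in> lists (topspace E)" "map snd hs \<in> lists (topspace E')"
      using hs by (auto simp: in_lists_conv_set)
    then show "limitin (prod_topology F F') (\<lambda>t::real. (1 / t) *\<^sub>R (DD hs (z + t *\<^sub>R h) - DD hs z))
        (DD (h # hs) z) (at 0)"
      unfolding limitin_pairwise
      using frechet_derivs_deriv[OF D(1), of "map fst hs" "fst h" "fst z"]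
        frechet_derivs_deriv[OF D'(1), of "map snd hs" "snd h" "snd z"] h z
      by (auto simp: DD_def o_def)
  next
    fix k z h and net :: "(('a \<times> 'c) \<times> (nat \<Rightarrow> 'a \<times> 'c)) filter"
    assume z: "z \<in> U \<times> U'" and lim: "limitin (prod_topology E E') fst z net"
      and h: "\<And>j. j < k \<Longrightarrow> limitin (prod_topology E E') (\<lambda>p. snd p j) (h j) net"
    have "list_all2 (\<lambda>w l. limitin E w l net) (map (\<lambda>j p. fst (snd p j)) [0..<k]) (map (\<lambda>j. fst (h j)) [0..<k])"
      using limitin_fst[OF h] by (auto simp: list_all2_map1 list_all2_map2 list_all2_same)
    from frechet_derivs_limitin[OF D(1) limitin_fst[OF lim] _ this]
    have 1: "limitin F (\<lambda>p. D (map (\<lambda>j. fst (snd p j)) [0..<k]) (fst (fst p)))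
        (D (map (\<lambda>j. fst (h j)) [0..<k]) (fst z)) net"
      using z by (auto simp: o_def)
    have "list_all2 (\<lambda>w l. limitin E' w l net) (map (\<lambda>j p. snd (snd p j)) [0..<k]) (map (\<lambda>j. snd (h j)) [0..<k])"
      using limitin_snd[OF h] by (auto simp: list_all2_map1 list_all2_map2 list_all2_same)
    from frechet_derivs_limitin[OF D'(1) limitin_snd[OF lim] _ this]
    have 2: "limitin F' (\<lambda>p. D' (map (\<lambda>j. snd (snd p j)) [0..<k]) (snd (fst p)))
        (D' (map (\<lambda>j. snd (h j)) [0..<k]) (snd z)) net"
      using z by (auto simp: o_def)
    show "limitin (prod_topology F F') (\<lambda>p. DD (map (snd p) [0..<k]) (fst p)) (DD (map h [0..<k]) z) net"
      unfolding limitin_pairwise using 1 2 by (simp add: DD_def o_def)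
  qed
  moreover have "DD [] z = map_prod f g z" if "z \<in> U \<times> U'" for z
    using that D(2) D'(2) by (auto simp: DD_def)
  ultimately show ?thesis unfolding frechet_smooth_iff_derivs by blast
qed

subsection \<open>Slices of compatible charts\<close>

definition restrict_fchart :: "('q, 'e) fchart \<Rightarrow> 'q set \<Rightarrow> 'e set \<Rightarrow> ('q, 'e) fchart"
  where "restrict_fchart c N F = FChart (fdom c \<inter> N) (fcoord c) (subtopology (fmodel c) F)"

lemma restrict_fchart_simps [simp]:
  "fdom (restrict_fchart c N F) = fdom c \<inter> N"
  "fcoord (restrict_fchart c N F) = fcoord c"
  "fmodel (restrict_fchart c N F) = subtopology (fmodel c) F"
  by (simp_all add: restrict_fchart_def)

text \<open>Compared with \<open>adapted_chart\<close>, closedness of \<open>F\<close> replaces the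
  existence of a continuous projection.\<close>

definition slice_fchart :: "('q, 'e::real_vector) fchart \<Rightarrow> 'q set \<Rightarrow> 'e set \<Rightarrow> bool"
  where "slice_fchart c N F \<longleftrightarrow> subspace F \<and> closedin (fmodel c) F \<and>
    fcoord c ` (fdom c \<inter> N) = fcoord c ` fdom c \<inter> F"

text \<open>The model type of the chart is independent of that of the atlas, because the charts that
  exhibit a submersion have a product as model space.\<close>

definition induced_fchart ::
    "('q, 'e::real_vector) fchart set \<Rightarrow> 'q set \<Rightarrow> ('q, 'f::real_vector) fchart \<Rightarrow> bool"
  where "induced_fchart A N c' \<longleftrightarrow>
    (\<exists>c F. compatible_chart A c \<and> slice_fchart c N F \<and> c' = restrict_fchart c N F)"

text \<open>Injectivity of the coordinate map turns the equation of images into a pointwise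
  criterion.\<close>

lemma slice_fchart_mem:
  assumes "is_fchart c" "slice_fchart c N F" "x \<in> fdom c"
  shows "x \<in> N \<longleftrightarrow> fcoord c x \<in> F"
proof
  assume "x \<in> N"
  then show "fcoord c x \<in> F" using assms(2,3) unfolding slice_fchart_def by blast
next
  assume "fcoord c x \<in> F"
  then have "fcoord c x \<in> fcoord c ` (fdom c \<inter> N)"
    using assms(2,3) unfolding slice_fchart_def by blast
  then obtain y where "y \<in> fdom c" "y \<in> N" "fcoord c x = fcoord c y" by blast
  then show "x \<in> N"
    using assms(1,3) by (metis inj_onD is_fchart_def)
qed

section \<open>Local representatives of maps in charts\<close>

lemma finv_fcoord: "is_fchart c \<Longrightarrow> x \<in> fdom c \<Longrightarrow> finv c (fcoord c x) = x"
  by (simp add: finv_def is_fchart_def)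

lemma is_fchart_restrict:
  assumes c: "is_fchart c" and s: "slice_fchart c N F"
  shows "is_fchart (restrict_fchart c N F)"
  unfolding is_fchart_def restrict_fchart_simps
proof (intro conjI)
  show "frechet_space (subtopology (fmodel c) F)"
    using c s by (simp add: frechet_space_subtopology is_fchart_def slice_fchart_def)
  show "inj_on (fcoord c) (fdom c \<inter> N)"
    using c by (meson Int_lower1 inj_on_subset is_fchart_def)
  show "openin (subtopology (fmodel c) F) (fcoord c ` (fdom c \<inter> N))"
    using c s by (simp add: is_fchart_def slice_fchart_def openin_subtopology_Int)
qed

text \<open>A common form for smooth maps and chart changes, the latter being representatives of the
  identity. Statements about maps thus also cover compatibility of charts.\<close>

definition fchart_smooth_rep ::
    "('q, 'e::real_vector) fchart \<Rightarrow> ('r, 'f::real_vector) fchart \<Rightarrow> ('q \<Rightarrow> 'r) \<Rightarrow> bool"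
  where "fchart_smooth_rep c d f \<longleftrightarrow>
    frechet_smooth (fmodel c) (fcoord c ` (fdom c \<inter> f -` fdom d)) (fmodel d)
      (fcoord d \<circ> f \<circ> finv c)"

lemma fchart_change_smooth_iff_rep: "fchart_change_smooth c d \<longleftrightarrow> fchart_smooth_rep c d (\<lambda>x. x)"
  by (simp add: fchart_change_smooth_def fchart_smooth_rep_def o_def vimage_def Int_def)

lemma frechet_smooth_map_iff_rep:
  "frechet_smooth_map X A Y B f \<longleftrightarrow> f ` X \<subseteq> Y \<and> (\<forall>c\<in>A. \<forall>d\<in>B. fchart_smooth_rep c d f)"
  by (simp add: frechet_smooth_map_def fchart_smooth_rep_def)

lemma fchart_smooth_rep_cong:
  assumes c: "is_fchart c" and f: "fchart_smooth_rep c d f" and eq: "\<And>x. x \<in> fdom c \<Longrightarrow> f x = g x"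
  shows "fchart_smooth_rep c d g"
proof -
  have "fdom c \<inter> f -` fdom d = fdom c \<inter> g -` fdom d" using eq by auto
  moreover have "frechet_smooth (fmodel c) (fcoord c ` (fdom c \<inter> f -` fdom d)) (fmodel d)
      (fcoord d \<circ> g \<circ> finv c)"
    by (rule frechet_smooth_cong[OF f[unfolded fchart_smooth_rep_def]])
       (use c eq in \<open>auto simp: finv_fcoord\<close>)
  ultimately show ?thesis by (simp add: fchart_smooth_rep_def)
qed

text \<open>Smoothness holds only where the route passes through the domain of \<open>b\<close>, so
  the conclusion is about this smaller set and not yet of the form
  \<open>fchart_smooth_rep\<close>.\<close>

lemma fchart_smooth_rep_compose:
  assumes charts: "is_fchart a" "is_fchart b" "is_fchart c"
    and f: "fchart_smooth_rep a b f" and g: "fchart_smooth_rep b c g"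
  shows "frechet_smooth (fmodel a) (fcoord a ` {x \<in> fdom a. f x \<in> fdom b \<and> g (f x) \<in> fdom c})
    (fmodel c) (fcoord c \<circ> (g \<circ> f) \<circ> finv a)"
proof -
  let ?U = "fcoord a ` (fdom a \<inter> f -` fdom b)" and ?V = "fcoord b ` (fdom b \<inter> g -` fdom c)"
  have "frechet_smooth (fmodel a) {x \<in> ?U. (fcoord b \<circ> f \<circ> finv a) x \<in> ?V} (fmodel c)
      (\<lambda>x. (fcoord c \<circ> g \<circ> finv b) ((fcoord b \<circ> f \<circ> finv a) x))"
    by (rule frechet_smooth_compose[OF _ _ _ f[unfolded fchart_smooth_rep_def]
          g[unfolded fchart_smooth_rep_def]])
       (use charts in \<open>auto simp: is_fchart_def\<close>)
  moreover have "{x \<in> ?U. (fcoord b \<circ> f \<circ> finv a) x \<in> ?V} =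
      fcoord a ` {x \<in> fdom a. f x \<in> fdom b \<and> g (f x) \<in> fdom c}" (is "?L = ?R")
  proof
    show "?L \<subseteq> ?R"
    proof
      fix z assume z: "z \<in> ?L"
      then obtain x where x: "x \<in> fdom a" "f x \<in> fdom b" "z = fcoord a x" by blast
      then have "fcoord b (f x) \<in> ?V" using z charts by (simp add: finv_fcoord)
      then obtain y where y: "y \<in> fdom b" "g y \<in> fdom c" "fcoord b (f x) = fcoord b y" by blast
      then have "y = f x" using charts(2) x(2) by (metis inj_onD is_fchart_def)
      then show "z \<in> ?R" using x y by blast
    qed
    show "?R \<subseteq> ?L" using charts by (auto simp: finv_fcoord)
  qed
  ultimately have "frechet_smooth (fmodel a) ?R (fmodel c)
      (\<lambda>x. (fcoord c \<circ> g \<circ> finv b) ((fcoord b \<circ> f \<circ> finv a) x))" by simp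
  then show ?thesis
    by (rule frechet_smooth_cong) (use charts in \<open>auto simp: finv_fcoord\<close>)
qed

text \<open>Around each point the representative factors as \<open>c\<close> to \<open>a\<close>,
  \<open>a\<close> to \<open>b\<close>, \<open>b\<close> to \<open>d\<close> with atlas charts
  \<open>a\<close> and \<open>b\<close>. These depend on the point, and locality glues the
  pieces.\<close>

lemma frechet_smooth_map_compatible:
  assumes AB: "\<And>a. a \<in> A \<Longrightarrow> is_fchart a" "\<And>b. b \<in> B \<Longrightarrow> is_fchart b"
    and f: "frechet_smooth_map X A Y B f" and X: "X = (\<Union>a\<in>A. fdom a)" and Y: "Y = (\<Union>b\<in>B. fdom b)"
    and c: "compatible_chart A c" and d: "compatible_chart B d"
  shows "fchart_smooth_rep c d f"
  unfolding fchart_smooth_rep_def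
proof (rule frechet_smooth_local)
  have cd: "is_fchart c" "is_fchart d" using c d by (auto simp: compatible_chart_def)
  then show "frechet_space (fmodel c)" "frechet_space (fmodel d)" by (auto simp: is_fchart_def)
  fix z assume "z \<in> fcoord c ` (fdom c \<inter> f -` fdom d)"
  then obtain x where x: "x \<in> fdom c" "f x \<in> fdom d" "z = fcoord c x" by blast
  obtain a where a: "a \<in> A" "x \<in> fdom a" using c x(1) by (auto simp: compatible_chart_def)
  then have "f x \<in> Y" using f X by (auto simp: frechet_smooth_map_def)
  then obtain b where b: "b \<in> B" "f x \<in> fdom b" using Y by blast
  have ab: "is_fchart a" "is_fchart b" using AB a b by auto
  \<comment> \<open>All points of \<open>fdom c\<close> for which the detour through
    \<open>a\<close> and \<open>b\<close> makes sense.\<close>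
  let ?T = "{x \<in> fdom c. x \<in> fdom a \<and> f x \<in> fdom b \<and> f x \<in> fdom d}"
  have ca: "fchart_smooth_rep c a (\<lambda>x. x)" and bd: "fchart_smooth_rep b d (\<lambda>x. x)"
    using c d a b by (auto simp: compatible_chart_def fchart_change_smooth_iff_rep)
  have fab: "fchart_smooth_rep a b f" using f a b by (simp add: frechet_smooth_map_iff_rep)
  have "frechet_smooth (fmodel a) (fcoord a ` {x \<in> fdom a. f x \<in> fdom b \<and> f x \<in> fdom d}) (fmodel d)
      (fcoord d \<circ> ((\<lambda>x. x) \<circ> f) \<circ> finv a)"
    by (rule fchart_smooth_rep_compose[OF ab cd(2) fab bd])
  then have 1: "frechet_smooth (fmodel a) (fcoord a ` {x \<in> fdom a. f x \<in> fdom b \<and> f x \<in> fdom d}) (fmodel d)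
      (fcoord d \<circ> f \<circ> finv a)"
    by (simp add: o_def)
  let ?U = "fcoord c ` (fdom c \<inter> fdom a)"
  have "frechet_smooth (fmodel c) ?U (fmodel a) (fcoord a \<circ> finv c)"
    using c a by (simp add: compatible_chart_def fchart_change_smooth_def)
  from frechet_smooth_compose[OF _ _ _ this 1]
  have "frechet_smooth (fmodel c)
      {x \<in> ?U. (fcoord a \<circ> finv c) x \<in> fcoord a ` {x \<in> fdom a. f x \<in> fdom b \<and> f x \<in> fdom d}}
      (fmodel d) (\<lambda>x. (fcoord d \<circ> f \<circ> finv a) ((fcoord a \<circ> finv c) x))"
    using cd ab by (simp add: is_fchart_def)
  moreover have "{x \<in> ?U. (fcoord a \<circ> finv c) x \<in> fcoord a ` {x \<in> fdom a. f x \<in> fdom b \<and> f x \<in> fdom d}} =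
      fcoord c ` ?T" (is "?L = ?R")
  proof
    show "?L \<subseteq> ?R"
    proof
      fix w assume w: "w \<in> ?L"
      then obtain y where y: "y \<in> fdom c" "y \<in> fdom a" "w = fcoord c y" by blast
      then have "fcoord a y \<in> fcoord a ` {x \<in> fdom a. f x \<in> fdom b \<and> f x \<in> fdom d}"
        using w cd by (simp add: finv_fcoord)
      then obtain y' where y': "y' \<in> fdom a" "f y' \<in> fdom b" "f y' \<in> fdom d" "fcoord a y = fcoord a y'"
        by blast
      then have "y' = y" using ab(1) y(2) by (metis inj_onD is_fchart_def)
      then show "w \<in> ?R" using y y' by blast
    qed
    show "?R \<subseteq> ?L" using cd by (auto simp: finv_fcoord)
  qed
  ultimately have "frechet_smooth (fmodel c) (fcoord c ` ?T) (fmodel d)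
      (\<lambda>x. (fcoord d \<circ> f \<circ> finv a) ((fcoord a \<circ> finv c) x))" by simp
  then have "frechet_smooth (fmodel c) (fcoord c ` ?T) (fmodel d) (fcoord d \<circ> f \<circ> finv c)"
    by (rule frechet_smooth_cong) (use cd ab in \<open>auto simp: finv_fcoord\<close>)
  then show "\<exists>V. z \<in> V \<and> V \<subseteq> fcoord c ` (fdom c \<inter> f -` fdom d) \<and>
      frechet_smooth (fmodel c) V (fmodel d) (fcoord d \<circ> f \<circ> finv c)"
    using x a b by (intro exI[of _ "fcoord c ` ?T"]) auto
qed

lemma fchart_smooth_rep_restrict:
  assumes c: "is_fchart c" "slice_fchart c N F" and d: "is_fchart d" "slice_fchart d K F'"
    and f: "fchart_smooth_rep c d f" and image: "\<And>x. x \<in> fdom c \<Longrightarrow> x \<in> N \<Longrightarrow> f x \<in> K"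
  shows "fchart_smooth_rep (restrict_fchart c N F) (restrict_fchart d K F') f"
proof -
  let ?U = "fcoord c ` (fdom c \<inter> f -` fdom d)"
  have "frechet_smooth (subtopology (fmodel c) F) (?U \<inter> F) (subtopology (fmodel d) F') (fcoord d \<circ> f \<circ> finv c)"
  proof (rule frechet_smooth_restrict[OF _ _ f[unfolded fchart_smooth_rep_def]])
    fix z assume z: "z \<in> ?U" "z \<in> F"
    then obtain x where x: "x \<in> fdom c" "f x \<in> fdom d" "z = fcoord c x" by blast
    then have "x \<in> N" using z slice_fchart_mem[OF c] by blast
    then have "f x \<in> K" using image x by blast
    then show "(fcoord d \<circ> f \<circ> finv c) z \<in> F'"
      using x slice_fchart_mem[OF d x(2)] c(1) by (simp add: finv_fcoord)
  qed (use c d closedin_subset in \<open>auto simp: is_fchart_def slice_fchart_def\<close>)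
  moreover have "?U \<inter> F = fcoord c ` (fdom c \<inter> N \<inter> f -` (fdom d \<inter> K))"
    using slice_fchart_mem[OF c] image by auto
  ultimately have "frechet_smooth (subtopology (fmodel c) F) (fcoord c ` (fdom c \<inter> N \<inter> f -` (fdom d \<inter> K)))
      (subtopology (fmodel d) F') (fcoord d \<circ> f \<circ> finv c)" by simp
  then have "frechet_smooth (subtopology (fmodel c) F) (fcoord c ` (fdom c \<inter> N \<inter> f -` (fdom d \<inter> K)))
      (subtopology (fmodel d) F') (fcoord d \<circ> f \<circ> finv (restrict_fchart c N F))"
    by (rule frechet_smooth_cong)
       (use finv_fcoord[OF c(1)] finv_fcoord[OF is_fchart_restrict[OF c]] in auto)
  then show ?thesis by (simp add: fchart_smooth_rep_def)
qed

lemma induced_is_fchart: "induced_fchart A N c \<Longrightarrow> is_fchart c"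
  by (auto simp: induced_fchart_def compatible_chart_def is_fchart_restrict)

lemma induced_smooth_rep:
  assumes AB: "\<And>a. a \<in> A \<Longrightarrow> is_fchart a" "\<And>b. b \<in> B \<Longrightarrow> is_fchart b"
    and f: "frechet_smooth_map X A Y B f" and X: "X = (\<Union>a\<in>A. fdom a)" and Y: "Y = (\<Union>b\<in>B. fdom b)"
    and c: "induced_fchart A N c" and d: "induced_fchart B K d" and image: "f ` N \<subseteq> K"
  shows "fchart_smooth_rep c d f"
proof -
  obtain c0 F where c0: "compatible_chart A c0" "slice_fchart c0 N F" "c = restrict_fchart c0 N F"
    using c unfolding induced_fchart_def by blast
  obtain d0 F' where d0: "compatible_chart B d0" "slice_fchart d0 K F'" "d = restrict_fchart d0 K F'"
    using d unfolding induced_fchart_def by blast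
  have "fchart_smooth_rep c0 d0 f"
    by (rule frechet_smooth_map_compatible[OF AB f X Y c0(1) d0(1)])
  then show ?thesis
    unfolding c0(3) d0(3)
    by (intro fchart_smooth_rep_restrict) (use c0 d0 image in \<open>auto simp: compatible_chart_def\<close>)
qed

text \<open>The source of the smoothness claims for the projection, the action and the
  trivializations. Letting \<open>g\<close> agree with \<open>f\<close> on \<open>N\<close> only
  accommodates \<open>inv_into\<close>, whose values elsewhere change with the domain.\<close>

lemma frechet_smooth_map_induced:
  assumes AB: "\<And>a. a \<in> A \<Longrightarrow> is_fchart a" "\<And>b. b \<in> B \<Longrightarrow> is_fchart b"
    and f: "frechet_smooth_map X A Y B f" and X: "X = (\<Union>a\<in>A. fdom a)" and Y: "Y = (\<Union>b\<in>B. fdom b)"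
    and A': "\<And>c. c \<in> A' \<Longrightarrow> induced_fchart A N c" and B': "\<And>d. d \<in> B' \<Longrightarrow> induced_fchart B K d"
    and image: "f ` N \<subseteq> K" and g: "\<And>x. x \<in> N \<Longrightarrow> g x = f x"
  shows "frechet_smooth_map N A' K B' g"
  unfolding frechet_smooth_map_iff_rep
proof (intro conjI ballI)
  show "g ` N \<subseteq> K" using image g by auto
  fix c d assume c: "c \<in> A'" and d: "d \<in> B'"
  have N: "fdom c \<subseteq> N" using A'[OF c] by (auto simp: induced_fchart_def)
  show "fchart_smooth_rep c d g"
    by (rule fchart_smooth_rep_cong[OF _ induced_smooth_rep[OF AB f X Y A'[OF c] B'[OF d] image]])
       (use A'[OF c] N g in \<open>auto intro: induced_is_fchart\<close>)
qed

lemma slice_fchart_topspace: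
  assumes "is_fchart c" "fdom c \<subseteq> N"
  shows "slice_fchart c N (topspace (fmodel c))" "restrict_fchart c N (topspace (fmodel c)) = c"
proof -
  have "fdom c \<inter> N = fdom c" using assms by blast
  moreover have "fcoord c ` fdom c \<subseteq> topspace (fmodel c)"
    using assms(1) openin_subset by (auto simp: is_fchart_def)
  ultimately show "slice_fchart c N (topspace (fmodel c))"
    using assms(1) by (auto simp: slice_fchart_def is_fchart_def frechet_space_subspace)
  show "restrict_fchart c N (topspace (fmodel c)) = c"
    using \<open>fdom c \<inter> N = fdom c\<close> by (cases c) (simp add: restrict_fchart_def subtopology_topspace)
qed

text \<open>A chart inside \<open>N\<close> is a slice by its whole model space. In this way the
  charts of the structure group count as induced, and products of the group with a submanifold need
  no separate treatment.\<close>

lemma compatible_chart_induced: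
  assumes "compatible_chart A c" "fdom c \<subseteq> N"
  shows "induced_fchart A N c"
  unfolding induced_fchart_def
  using assms slice_fchart_topspace[of c N] by (metis compatible_chart_def)

lemma frechet_manifold_compatible: "frechet_manifold X A \<Longrightarrow> c \<in> A \<Longrightarrow> compatible_chart A c"
  by (auto simp: frechet_manifold_def compatible_chart_def)

lemma frechet_manifold_is_fchart: "frechet_manifold X A \<Longrightarrow> c \<in> A \<Longrightarrow> is_fchart c"
  and frechet_manifold_Union: "frechet_manifold X A \<Longrightarrow> X = (\<Union>c\<in>A. fdom c)"
  by (auto simp: frechet_manifold_def)

lemma frechet_smooth_map_ident:
  assumes "frechet_manifold X A"
  shows "frechet_smooth_map X A X A (\<lambda>x. x)"
  using assms by (auto simp: frechet_smooth_map_iff_rep frechet_manifold_def fchart_change_smooth_iff_rep)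

text \<open>A chart change represents the identity, which maps \<open>N\<close> into
  \<open>N\<close>.\<close>

lemma induced_change_smooth:
  assumes A: "frechet_manifold X A" and c: "induced_fchart A N c" and d: "induced_fchart A N d"
  shows "fchart_change_smooth c d"
  unfolding fchart_change_smooth_iff_rep
  by (rule induced_smooth_rep[OF _ _ frechet_smooth_map_ident[OF A] _ _ c d])
     (use frechet_manifold_is_fchart[OF A] frechet_manifold_Union[OF A] in auto)

subsection \<open>Topology of an atlas\<close>

text \<open>The condition defines a topology because injective coordinate maps commute with
  intersections.\<close>

lemma openin_atlas_topology:
  assumes A: "\<And>c. c \<in> A \<Longrightarrow> is_fchart c"
  shows "openin (atlas_topology A) W \<longleftrightarrow> W \<subseteq> (\<Union>c\<in>A. fdom c) \<and>
    (\<forall>c\<in>A. openin (fmodel c) (fcoord c ` (W \<inter> fdom c)))"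
proof -
  have int: "fcoord c ` (S \<inter> T \<inter> fdom c) = fcoord c ` (S \<inter> fdom c) \<inter> fcoord c ` (T \<inter> fdom c)"
    if "c \<in> A" for c S T
    using A[OF that] unfolding is_fchart_def inj_on_def by blast
  have Un: "fcoord c ` (\<Union>\<K> \<inter> fdom c) = (\<Union>K\<in>\<K>. fcoord c ` (K \<inter> fdom c))" for c \<K>
    by blast
  have "istopology (\<lambda>W. W \<subseteq> (\<Union>c\<in>A. fdom c) \<and> (\<forall>c\<in>A. openin (fmodel c) (fcoord c ` (W \<inter> fdom c))))"
    unfolding istopology_def by (auto simp: int Un intro!: openin_Union openin_Int)
  then show ?thesis
    unfolding atlas_topology_def by (simp add: topology_inverse')
qed

text \<open>Openness is tested in atlas charts; the smooth change from \<open>c\<close> to an atlas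
  chart pulls it back to \<open>c\<close>.\<close>

lemma openin_compatible_chart:
  assumes A: "\<And>c. c \<in> A \<Longrightarrow> is_fchart c" and W: "openin (atlas_topology A) W"
    and c: "compatible_chart A c"
  shows "openin (fmodel c) (fcoord c ` (fdom c \<inter> W))"
proof (subst openin_subopen, intro ballI)
  fix z assume "z \<in> fcoord c ` (fdom c \<inter> W)"
  then obtain x where x: "x \<in> fdom c" "x \<in> W" "z = fcoord c x" by blast
  obtain a where a: "a \<in> A" "x \<in> fdom a" using c x(1) by (auto simp: compatible_chart_def)
  have c': "is_fchart c" using c by (simp add: compatible_chart_def)
  let ?U = "fcoord c ` (fdom c \<inter> fdom a)"
  let ?T = "{y \<in> ?U. (fcoord a \<circ> finv c) y \<in> fcoord a ` (W \<inter> fdom a)}"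
  have "frechet_smooth (fmodel c) ?U (fmodel a) (fcoord a \<circ> finv c)"
    using c a by (simp add: compatible_chart_def fchart_change_smooth_def)
  moreover have "openin (fmodel a) (fcoord a ` (W \<inter> fdom a))"
    using W a(1) by (simp add: openin_atlas_topology A)
  ultimately have "openin (fmodel c) ?T" by (rule openin_frechet_smooth_preimage)
  moreover have "z \<in> ?T" using x a c' by (auto simp: finv_fcoord)
  moreover have "?T \<subseteq> fcoord c ` (fdom c \<inter> W)"
  proof
    fix w assume w: "w \<in> ?T"
    then obtain y where y: "y \<in> fdom c" "y \<in> fdom a" "w = fcoord c y" by blast
    then have "fcoord a y \<in> fcoord a ` (W \<inter> fdom a)" using w c' by (simp add: finv_fcoord)
    then have "y \<in> W" using A[OF a(1)] y(2) unfolding is_fchart_def inj_on_def by blast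
    then show "w \<in> fcoord c ` (fdom c \<inter> W)" using y by blast
  qed
  ultimately show "\<exists>T. openin (fmodel c) T \<and> z \<in> T \<and> T \<subseteq> fcoord c ` (fdom c \<inter> W)" by blast
qed

lemma openin_atlas_smooth_preimage:
  assumes A: "\<And>a. a \<in> A \<Longrightarrow> is_fchart a" and B: "\<And>b. b \<in> B \<Longrightarrow> is_fchart b"
    and f: "frechet_smooth_map X A Y B f" and X: "X = (\<Union>a\<in>A. fdom a)" and Y: "Y = (\<Union>b\<in>B. fdom b)"
    and W: "openin (atlas_topology B) W"
  shows "openin (atlas_topology A) (X \<inter> f -` W)"
proof (subst openin_atlas_topology[OF A], assumption, intro conjI ballI)
  show "X \<inter> f -` W \<subseteq> (\<Union>a\<in>A. fdom a)" using X by blast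
  fix a assume a: "a \<in> A"
  show "openin (fmodel a) (fcoord a ` (X \<inter> f -` W \<inter> fdom a))"
  proof (subst openin_subopen, intro ballI)
    fix z assume "z \<in> fcoord a ` (X \<inter> f -` W \<inter> fdom a)"
    then obtain x where x: "x \<in> X" "x \<in> fdom a" "f x \<in> W" "z = fcoord a x" by blast
    then have "f x \<in> Y" using f by (auto simp: frechet_smooth_map_def)
    then obtain b where b: "b \<in> B" "f x \<in> fdom b" using Y by blast
    let ?U = "fcoord a ` (fdom a \<inter> f -` fdom b)"
    let ?T = "{y \<in> ?U. (fcoord b \<circ> f \<circ> finv a) y \<in> fcoord b ` (W \<inter> fdom b)}"
    have "frechet_smooth (fmodel a) ?U (fmodel b) (fcoord b \<circ> f \<circ> finv a)"
      using f a b by (simp add: frechet_smooth_map_def)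
    moreover have "openin (fmodel b) (fcoord b ` (W \<inter> fdom b))"
      using W b(1) by (simp add: openin_atlas_topology B)
    ultimately have "openin (fmodel a) ?T" by (rule openin_frechet_smooth_preimage)
    moreover have "z \<in> ?T" using x b A[OF a] by (auto simp: finv_fcoord)
    moreover have "?T \<subseteq> fcoord a ` (X \<inter> f -` W \<inter> fdom a)"
    proof
      fix w assume w: "w \<in> ?T"
      then obtain y where y: "y \<in> fdom a" "f y \<in> fdom b" "w = fcoord a y" by blast
      then have "fcoord b (f y) \<in> fcoord b ` (W \<inter> fdom b)" using w A[OF a] by (simp add: finv_fcoord)
      then have "f y \<in> W" using B[OF b(1)] y(2) unfolding is_fchart_def inj_on_def by blast
      moreover have "y \<in> X" using X a y(1) by blast
      ultimately show "w \<in> fcoord a ` (X \<inter> f -` W \<inter> fdom a)" using y by blast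
    qed
    ultimately show "\<exists>T. openin (fmodel a) T \<and> z \<in> T \<and> T \<subseteq> fcoord a ` (X \<inter> f -` W \<inter> fdom a)" by blast
  qed
qed

text \<open>The topology of an induced atlas is at least as fine as the subspace topology. This
  yields the Hausdorff property of submanifolds and the openness of \<open>U \<inter> N\<close> for
  trivializing sets \<open>U\<close>.\<close>

lemma openin_atlas_topology_induced:
  assumes A: "\<And>a. a \<in> A \<Longrightarrow> is_fchart a" and A': "\<And>c. c \<in> A' \<Longrightarrow> induced_fchart A N c"
    and N: "N = (\<Union>c\<in>A'. fdom c)" and W: "openin (atlas_topology A) W"
  shows "openin (atlas_topology A') (W \<inter> N)"
proof -
  have "openin (fmodel c) (fcoord c ` (W \<inter> N \<inter> fdom c))" if c: "c \<in> A'" for c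
  proof -
    obtain c0 F where c0: "compatible_chart A c0" "slice_fchart c0 N F" "c = restrict_fchart c0 N F"
      using A'[OF c] unfolding induced_fchart_def by blast
    have fc: "is_fchart c0" using c0(1) by (simp add: compatible_chart_def)
    have "fcoord c0 ` (W \<inter> N \<inter> fdom c0) = fcoord c0 ` (fdom c0 \<inter> W) \<inter> F"
      using slice_fchart_mem[OF fc c0(2)] by auto
    moreover have "W \<inter> N \<inter> (fdom c0 \<inter> N) = W \<inter> N \<inter> fdom c0" by blast
    moreover have "openin (fmodel c0) (fcoord c0 ` (fdom c0 \<inter> W))"
      by (rule openin_compatible_chart[OF A W c0(1)])
    ultimately show ?thesis
      by (simp add: c0(3) openin_subtopology_Int)
  qed
  then show ?thesis
    using N by (subst openin_atlas_topology) (auto intro: induced_is_fchart[OF A'])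
qed

lemma topspace_atlas_topology_subset:
  assumes "\<And>c. c \<in> A \<Longrightarrow> is_fchart c"
  shows "topspace (atlas_topology A) \<subseteq> (\<Union>c\<in>A. fdom c)"
  using openin_atlas_topology[of A "topspace (atlas_topology A)"] assms by auto

lemma topspace_atlas_topology:
  assumes A: "frechet_manifold X A"
  shows "topspace (atlas_topology A) = X"
proof
  show "topspace (atlas_topology A) \<subseteq> X"
    using topspace_atlas_topology_subset[OF frechet_manifold_is_fchart[OF A]]
      frechet_manifold_Union[OF A] by simp
  have "openin (fmodel c) (fcoord c ` (X \<inter> fdom c))" if "c \<in> A" for c
  proof -
    have "X \<inter> fdom c = fdom c" using frechet_manifold_Union[OF A] that by blast
    then show ?thesis using frechet_manifold_is_fchart[OF A that] by (simp add: is_fchart_def)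
  qed
  then have "openin (atlas_topology A) X"
    using frechet_manifold_Union[OF A]
    by (subst openin_atlas_topology) (auto intro: frechet_manifold_is_fchart[OF A])
  then show "X \<subseteq> topspace (atlas_topology A)" by (rule openin_subset)
qed

subsection \<open>Submanifolds, open subsets and products\<close>

text \<open>\<open>F\<close> is the fixed point set of a continuous linear projection, so it is a
  subspace, and it is closed as the equalizer of two continuous maps into a Hausdorff space.\<close>

lemma adapted_chart_slice:
  assumes "adapted_chart A N c F"
  shows "slice_fchart c N F"
proof -
  have c: "is_fchart c" using assms by (simp add: adapted_chart_def compatible_chart_def)
  then have E: "frechet_space (fmodel c)" by (simp add: is_fchart_def)
  note V = frechet_space_subspace[OF E]
  obtain P where P: "continuous_linear_map (fmodel c) (fmodel c) P" "P ` topspace (fmodel c) = F"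
    "\<And>x. x \<in> F \<Longrightarrow> P x = x"
    using assms unfolding adapted_chart_def complemented_in_def continuous_projection_def by blast
  have cont: "continuous_map (fmodel c) (fmodel c) P"
    and add: "\<And>x y. x \<in> topspace (fmodel c) \<Longrightarrow> y \<in> topspace (fmodel c) \<Longrightarrow> P (x + y) = P x + P y"
    and scale: "\<And>x a. x \<in> topspace (fmodel c) \<Longrightarrow> P (a *\<^sub>R x) = a *\<^sub>R P x"
    using P(1) by (auto simp: continuous_linear_map_def)
  have sub: "F \<subseteq> topspace (fmodel c)"
    using P(2) continuous_map_image_subset_topspace[OF cont] by blast
  then have F: "F = {x \<in> topspace (fmodel c). P x = x}"
  proof (intro equalityI subsetI)
    fix x assume "x \<in> {x \<in> topspace (fmodel c). P x = x}"
    then have "P x \<in> P ` topspace (fmodel c)" "P x = x" by blast+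
    then show "x \<in> F" using P(2) by simp
  qed (use sub P(3) in blast)
  have "closedin (fmodel c) {x \<in> topspace (fmodel c). P x = x}"
    by (rule closedin_continuous_maps_eq[OF frechet_space_Hausdorff[OF E] cont]) simp
  then have "closedin (fmodel c) F" using F by simp
  moreover have "subspace F"
    unfolding subspace_def
  proof (intro conjI ballI allI)
    have "P 0 = 0" using scale[of 0 0] V by (simp add: subspace_0)
    then show "0 \<in> F" using F V by (simp add: subspace_0)
  next
    fix x y assume "x \<in> F" "y \<in> F"
    then show "x + y \<in> F" using F V add by (auto simp: subspace_add)
  next
    fix x a assume "x \<in> F"
    then show "a *\<^sub>R x \<in> F" using F V scale by (auto simp: subspace_scale)
  qed
  ultimately show ?thesis using assms by (simp add: slice_fchart_def adapted_chart_def)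
qed

lemma submanifold_atlas_induced:
  assumes "c \<in> submanifold_atlas A N"
  shows "induced_fchart A N c"
proof -
  obtain c0 F where "adapted_chart A N c0 F" "c = restrict_fchart c0 N F"
    using assms by (auto simp: submanifold_atlas_def restrict_fchart_def)
  then show ?thesis
    unfolding induced_fchart_def using adapted_chart_slice adapted_chart_def by blast
qed

lemma submanifold_atlas_Union:
  assumes "codim_one_submanifold X A N"
  shows "N = (\<Union>c\<in>submanifold_atlas A N. fdom c)"
proof
  show "(\<Union>c\<in>submanifold_atlas A N. fdom c) \<subseteq> N" by (auto simp: submanifold_atlas_def)
  show "N \<subseteq> (\<Union>c\<in>submanifold_atlas A N. fdom c)"
  proof
    fix x assume x: "x \<in> N"
    then obtain c F where c: "x \<in> fdom c" "adapted_chart A N c F"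
      using assms unfolding codim_one_submanifold_def by blast
    then have "FChart (fdom c \<inter> N) (fcoord c) (subtopology (fmodel c) F) \<in> submanifold_atlas A N"
      by (auto simp: submanifold_atlas_def)
    then show "x \<in> (\<Union>c\<in>submanifold_atlas A N. fdom c)"
      by (rule UN_I) (use c x in simp)
  qed
qed

text \<open>Disjoint ambient neighbourhoods have disjoint open traces on \<open>N\<close>, and chart
  changes restrict from the ambient ones.\<close>

lemma frechet_manifold_submanifold:
  assumes A: "frechet_manifold X A" and N: "codim_one_submanifold X A N"
  shows "frechet_manifold N (submanifold_atlas A N)"
  unfolding frechet_manifold_def
proof (intro conjI ballI)
  let ?A' = "submanifold_atlas A N"
  show cover: "N = (\<Union>c\<in>?A'. fdom c)" by (rule submanifold_atlas_Union[OF N])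
  show ch: "is_fchart c" if "c \<in> ?A'" for c
    by (rule induced_is_fchart[OF submanifold_atlas_induced[OF that]])
  show "fchart_change_smooth c d" if "c \<in> ?A'" "d \<in> ?A'" for c d
    by (rule induced_change_smooth[OF A submanifold_atlas_induced submanifold_atlas_induced]) fact+
  show "Hausdorff_space (atlas_topology ?A')"
    unfolding Hausdorff_space_def
  proof (intro allI impI, elim conjE)
    fix x y assume xy: "x \<in> topspace (atlas_topology ?A')" "y \<in> topspace (atlas_topology ?A')" "x \<noteq> y"
    then have mem: "x \<in> N" "y \<in> N" using topspace_atlas_topology_subset[OF ch] cover by auto
    then have "x \<in> topspace (atlas_topology A)" "y \<in> topspace (atlas_topology A)"
      using N by (auto simp: topspace_atlas_topology[OF A] codim_one_submanifold_def)
    moreover have "Hausdorff_space (atlas_topology A)" using A by (simp add: frechet_manifold_def)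
    ultimately obtain S T where ST: "openin (atlas_topology A) S" "openin (atlas_topology A) T"
      "x \<in> S" "y \<in> T" "disjnt S T"
      using xy(3) unfolding Hausdorff_space_def by metis
    have "openin (atlas_topology ?A') (W \<inter> N)" if "openin (atlas_topology A) W" for W
      by (rule openin_atlas_topology_induced[OF frechet_manifold_is_fchart[OF A]
            submanifold_atlas_induced cover that])
    then show "\<exists>U V. openin (atlas_topology ?A') U \<and> openin (atlas_topology ?A') V \<and>
        x \<in> U \<and> y \<in> V \<and> disjnt U V"
      using ST mem by (intro exI[of _ "S \<inter> N"] exI[of _ "T \<inter> N"]) (auto simp: disjnt_iff)
  qed
qed

section \<open>Restriction of charts to open subsets\<close>

definition open_restrict_fchart :: "('q, 'e) fchart \<Rightarrow> 'q set \<Rightarrow> ('q, 'e) fchart"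
  where "open_restrict_fchart c W = FChart (fdom c \<inter> W) (fcoord c) (fmodel c)"

lemma open_restrict_fchart_simps [simp]:
  "fdom (open_restrict_fchart c W) = fdom c \<inter> W"
  "fcoord (open_restrict_fchart c W) = fcoord c"
  "fmodel (open_restrict_fchart c W) = fmodel c"
  by (simp_all add: open_restrict_fchart_def)

lemma open_subatlas_eq: "open_subatlas A W = (\<lambda>c. open_restrict_fchart c W) ` A"
  by (simp add: open_subatlas_def open_restrict_fchart_def)

lemma is_fchart_open_restrict:
  assumes "is_fchart c" "openin (fmodel c) (fcoord c ` (fdom c \<inter> W))"
  shows "is_fchart (open_restrict_fchart c W)"
  using assms by (auto simp: is_fchart_def intro: inj_on_subset)

lemma fchart_smooth_rep_open_restrict:
  assumes c: "is_fchart c" and W: "openin (fmodel c) (fcoord c ` (fdom c \<inter> W))"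
    and d: "is_fchart d" and f: "fchart_smooth_rep c d f" and image: "\<And>x. x \<in> fdom c \<Longrightarrow> x \<in> W \<Longrightarrow> f x \<in> Z"
  shows "fchart_smooth_rep (open_restrict_fchart c W) (open_restrict_fchart d Z) f"
proof -
  let ?U = "fcoord c ` (fdom c \<inter> f -` fdom d)" and ?W = "fcoord c ` (fdom c \<inter> W)"
  have E: "frechet_space (fmodel c)" "frechet_space (fmodel d)"
    using c d by (auto simp: is_fchart_def)
  have smooth: "frechet_smooth (fmodel c) ?U (fmodel d) (fcoord d \<circ> f \<circ> finv c)"
    using f by (simp add: fchart_smooth_rep_def)
  \<comment> \<open>Composition with the identity of the open set \<open>?W\<close> is restriction
    to it.\<close>
  have "frechet_smooth (fmodel c) {x \<in> ?W. x \<in> ?U} (fmodel d) (fcoord d \<circ> f \<circ> finv c)"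
    by (rule frechet_smooth_compose[OF E(1,1,2) frechet_smooth_ident[OF E(1) W] smooth])
  moreover have "{x \<in> ?W. x \<in> ?U} = fcoord c ` (fdom c \<inter> W \<inter> f -` (fdom d \<inter> Z))" (is "?L = ?R")
  proof
    show "?L \<subseteq> ?R"
    proof
      fix z assume z: "z \<in> ?L"
      then obtain x where x: "x \<in> fdom c" "x \<in> W" "z = fcoord c x" by blast
      obtain y where y: "y \<in> fdom c" "f y \<in> fdom d" "z = fcoord c y" using z by blast
      have "y = x" using c x y by (metis inj_onD is_fchart_def)
      then show "z \<in> ?R" using x y image by blast
    qed
  qed blast
  ultimately have "frechet_smooth (fmodel c) (fcoord c ` (fdom c \<inter> W \<inter> f -` (fdom d \<inter> Z))) (fmodel d)
      (fcoord d \<circ> f \<circ> finv c)" by simp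
  then have "frechet_smooth (fmodel c) (fcoord c ` (fdom c \<inter> W \<inter> f -` (fdom d \<inter> Z))) (fmodel d)
      (fcoord d \<circ> f \<circ> finv (open_restrict_fchart c W))"
    by (rule frechet_smooth_cong)
       (use finv_fcoord[OF c] finv_fcoord[OF is_fchart_open_restrict[OF c W]] in auto)
  then show ?thesis by (simp add: fchart_smooth_rep_def)
qed

lemma compatible_chart_open_restrict:
  assumes A: "\<And>a. a \<in> A \<Longrightarrow> compatible_chart A a" and W: "openin (atlas_topology A) W"
    and c: "compatible_chart A c"
  shows "compatible_chart (open_subatlas A W) (open_restrict_fchart c W)"
proof -
  have fc: "is_fchart a" if "a \<in> A" for a using A[OF that] by (simp add: compatible_chart_def)
  have op: "openin (fmodel a) (fcoord a ` (fdom a \<inter> W))" if "compatible_chart A a"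
    for a :: "('a, 'd::real_vector) fchart"
    by (rule openin_compatible_chart[OF fc W that])
  have op': "openin (fmodel a) (fcoord a ` (fdom a \<inter> W))" if "a \<in> A" for a
    by (rule openin_compatible_chart[OF fc W A[OF that]])
  have c': "is_fchart c" using c by (simp add: compatible_chart_def)
  have "fchart_change_smooth (open_restrict_fchart c W) (open_restrict_fchart a W)"
    "fchart_change_smooth (open_restrict_fchart a W) (open_restrict_fchart c W)" if a: "a \<in> A" for a
    using c a unfolding fchart_change_smooth_iff_rep compatible_chart_def
    by (auto intro!: fchart_smooth_rep_open_restrict c' fc[OF a] op[OF c] op'[OF a])
  then show ?thesis
    using c' is_fchart_open_restrict[OF c' op[OF c]] c
    by (auto simp: compatible_chart_def open_subatlas_eq)
qed

text \<open>Cutting down to a submanifold and to an open subset commute. \<open>W'\<close> is a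
  variable with an equation because the intersection takes other syntactic forms where the lemma is
  applied.\<close>

lemma induced_fchart_open_restrict:
  assumes A: "\<And>a. a \<in> A \<Longrightarrow> compatible_chart A a" and W: "openin (atlas_topology A) W"
    and c: "induced_fchart A N c" and W': "W' = N \<inter> W"
  shows "induced_fchart (open_subatlas A W) W' (open_restrict_fchart c W')"
proof -
  obtain c0 F where c0: "compatible_chart A c0" "slice_fchart c0 N F" "c = restrict_fchart c0 N F"
    using c unfolding induced_fchart_def by blast
  have "is_fchart c0" using c0(1) by (simp add: compatible_chart_def)
  note mem = slice_fchart_mem[OF this c0(2)]
  have "slice_fchart (open_restrict_fchart c0 W) W' F"
    using c0(2) mem unfolding slice_fchart_def W' by auto
  moreover have "open_restrict_fchart c W' = restrict_fchart (open_restrict_fchart c0 W) W' F"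
    by (auto simp: c0(3) open_restrict_fchart_def restrict_fchart_def W')
  ultimately show ?thesis
    unfolding induced_fchart_def using compatible_chart_open_restrict[OF A W c0(1)] by blast
qed

section \<open>Products of charts\<close>

definition prod_fchart :: "('q, 'e) fchart \<Rightarrow> ('r, 'f) fchart \<Rightarrow> ('q \<times> 'r, 'e \<times> 'f) fchart"
  where "prod_fchart c d =
    FChart (fdom c \<times> fdom d) (map_prod (fcoord c) (fcoord d)) (prod_topology (fmodel c) (fmodel d))"

lemma prod_fchart_simps [simp]:
  "fdom (prod_fchart c d) = fdom c \<times> fdom d"
  "fcoord (prod_fchart c d) = map_prod (fcoord c) (fcoord d)"
  "fmodel (prod_fchart c d) = prod_topology (fmodel c) (fmodel d)"
  by (simp_all add: prod_fchart_def)

lemma product_atlas_eq: "product_atlas A B = {prod_fchart c d | c d. c \<in> A \<and> d \<in> B}"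
  by (simp add: product_atlas_def prod_fchart_def)

lemma product_atlas_Union: "(\<Union>c\<in>product_atlas A B. fdom c) = (\<Union>c\<in>A. fdom c) \<times> (\<Union>d\<in>B. fdom d)"
  unfolding product_atlas_eq by fastforce

lemma map_prod_image_Times: "map_prod f g ` (S \<times> T) = f ` S \<times> g ` T"
  by auto

lemma is_fchart_prod:
  assumes "is_fchart c" "is_fchart d"
  shows "is_fchart (prod_fchart c d)"
  using assms
  by (auto simp: is_fchart_def frechet_space_prod_topology map_prod_inj_on map_prod_image_Times
      openin_prod_Times_iff)

lemma fchart_smooth_rep_prod:
  assumes c: "is_fchart c" "is_fchart c'"
    and f: "fchart_smooth_rep c d f" and g: "fchart_smooth_rep c' d' g"
  shows "fchart_smooth_rep (prod_fchart c c') (prod_fchart d d') (map_prod f g)"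
proof -
  let ?U = "fcoord c ` (fdom c \<inter> f -` fdom d)" and ?U' = "fcoord c' ` (fdom c' \<inter> g -` fdom d')"
  have "frechet_smooth (prod_topology (fmodel c) (fmodel c')) (?U \<times> ?U')
      (prod_topology (fmodel d) (fmodel d'))
      (map_prod (fcoord d \<circ> f \<circ> finv c) (fcoord d' \<circ> g \<circ> finv c'))"
    using f g unfolding fchart_smooth_rep_def by (rule frechet_smooth_map_prod)
  then have "frechet_smooth (prod_topology (fmodel c) (fmodel c')) (?U \<times> ?U')
      (prod_topology (fmodel d) (fmodel d'))
      (map_prod (fcoord d) (fcoord d') \<circ> map_prod f g \<circ> finv (prod_fchart c c'))"
  proof (rule frechet_smooth_cong)
    fix z assume "z \<in> ?U \<times> ?U'"
    then obtain x x' where x: "x \<in> fdom c" "x' \<in> fdom c'" "z = (fcoord c x, fcoord c' x')" by blast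
    then show "map_prod (fcoord d \<circ> f \<circ> finv c) (fcoord d' \<circ> g \<circ> finv c') z =
        (map_prod (fcoord d) (fcoord d') \<circ> map_prod f g \<circ> finv (prod_fchart c c')) z"
      using finv_fcoord[OF is_fchart_prod[OF c], of "(x, x')"] c by (simp add: finv_fcoord)
  qed
  moreover have "map_prod (fcoord c) (fcoord c') ` ((fdom c \<times> fdom c') \<inter> map_prod f g -` (fdom d \<times> fdom d')) =
      ?U \<times> ?U'"
  proof -
    have "(fdom c \<times> fdom c') \<inter> map_prod f g -` (fdom d \<times> fdom d') =
        (fdom c \<inter> f -` fdom d) \<times> (fdom c' \<inter> g -` fdom d')" by auto
    then show ?thesis by (simp add: map_prod_image_Times)
  qed
  ultimately show ?thesis by (simp add: fchart_smooth_rep_def)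
qed

lemma compatible_chart_prod:
  assumes A: "\<And>a. a \<in> A \<Longrightarrow> is_fchart a" and B: "\<And>b. b \<in> B \<Longrightarrow> is_fchart b"
    and c: "compatible_chart A c" and d: "compatible_chart B d"
  shows "compatible_chart (product_atlas A B) (prod_fchart c d)"
proof -
  have cd: "is_fchart c" "is_fchart d" using c d by (auto simp: compatible_chart_def)
  have id: "map_prod (\<lambda>x. x) (\<lambda>y. y) = (\<lambda>z::'a \<times> 'b. z)" by auto
  have "fchart_change_smooth (prod_fchart c d) (prod_fchart a b)"
    "fchart_change_smooth (prod_fchart a b) (prod_fchart c d)" if "a \<in> A" "b \<in> B" for a b
    using fchart_smooth_rep_prod[OF cd, of a "\<lambda>x. x" b "\<lambda>x. x"]
      fchart_smooth_rep_prod[OF A[OF that(1)] B[OF that(2)], of c "\<lambda>x. x" d "\<lambda>x. x"] c d that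
    by (auto simp: fchart_change_smooth_iff_rep compatible_chart_def id)
  moreover have "fdom (prod_fchart c d) \<subseteq> (\<Union>c\<in>product_atlas A B. fdom c)"
    using c d unfolding product_atlas_Union by (auto simp: compatible_chart_def)
  ultimately show ?thesis
    unfolding compatible_chart_def using is_fchart_prod[OF cd] by (auto simp: product_atlas_eq)
qed

lemma induced_fchart_prod:
  assumes A: "\<And>a. a \<in> A \<Longrightarrow> is_fchart a" and B: "\<And>b. b \<in> B \<Longrightarrow> is_fchart b"
    and c: "induced_fchart A N c" and d: "induced_fchart B K d"
  shows "induced_fchart (product_atlas A B) (N \<times> K) (prod_fchart c d)"
proof -
  obtain c0 F where c0: "compatible_chart A c0" "slice_fchart c0 N F" "c = restrict_fchart c0 N F"
    using c unfolding induced_fchart_def by blast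
  obtain d0 F' where d0: "compatible_chart B d0" "slice_fchart d0 K F'" "d = restrict_fchart d0 K F'"
    using d unfolding induced_fchart_def by blast
  have "slice_fchart (prod_fchart c0 d0) (N \<times> K) (F \<times> F')"
    using c0(2) d0(2)
    by (simp add: slice_fchart_def subspace_Times closedin_prod_Times_iff Times_Int_Times
        map_prod_image_Times)
  moreover have "prod_fchart c d = restrict_fchart (prod_fchart c0 d0) (N \<times> K) (F \<times> F')"
    by (simp add: c0(3) d0(3) prod_fchart_def restrict_fchart_def subtopology_Times Times_Int_Times)
  ultimately show ?thesis
    unfolding induced_fchart_def using compatible_chart_prod[OF A B c0(1) d0(1)] by blast
qed

text \<open>Admits slices by merely closed subspaces, of any model type, to the maximal atlas of the
  submanifold. The submersion condition asks for such charts.\<close>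

lemma induced_fchart_compatible_submanifold:
  assumes A: "frechet_manifold X A" and N: "codim_one_submanifold X A N" and c: "induced_fchart A N c"
  shows "compatible_chart (submanifold_atlas A N) c"
proof -
  have "fdom c \<subseteq> N" using c by (auto simp: induced_fchart_def)
  then show ?thesis
    unfolding compatible_chart_def
    using submanifold_atlas_Union[OF N] c induced_change_smooth[OF A] submanifold_atlas_induced
      induced_is_fchart[OF c] by metis
qed

subsection \<open>Restriction of a principal bundle to a submanifold of the base\<close>

text \<open>New coordinates \<open>c'\<close> arise from \<open>c\<close> by a smooth change with
  inverse: \<open>\<tau>\<close> leads from \<open>c'\<close> to \<open>c\<close>, and
  \<open>\<tau>'\<close> leads back. Chart changes with the atlas factor through these maps;
  \<open>image\<close> and \<open>dom'\<close> make the domains of the composites come out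
  exactly.\<close>

lemma compatible_chart_reparametrize:
  fixes c :: "('q, 'e::real_vector) fchart" and c' :: "('q, 'f::real_vector) fchart"
  assumes A: "\<And>a. a \<in> A \<Longrightarrow> is_fchart a" and c: "compatible_chart A c"
    and model: "frechet_space (fmodel c')" and dom: "fdom c' \<subseteq> fdom c"
    and \<tau>: "frechet_smooth (fmodel c') T (fmodel c) \<tau>"
    and \<tau>': "frechet_smooth (fmodel c) T' (fmodel c') \<tau>'"
    and coord: "\<And>x. x \<in> fdom c' \<Longrightarrow> fcoord c' x \<in> T \<and> \<tau> (fcoord c' x) = fcoord c x"
    and image: "\<And>z. z \<in> T \<Longrightarrow> \<tau> z \<in> fcoord c ` fdom c \<Longrightarrow> z \<in> fcoord c' ` fdom c'"
    and coord': "\<And>x. x \<in> fdom c' \<Longrightarrow> \<tau>' (fcoord c x) = fcoord c' x"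
    and dom': "\<And>x. x \<in> fdom c \<Longrightarrow> fcoord c x \<in> T' \<longleftrightarrow> x \<in> fdom c'"
  shows "compatible_chart A c'"
proof -
  have fc: "is_fchart c" using c by (simp add: compatible_chart_def)
  then have E: "frechet_space (fmodel c)" and inj: "inj_on (fcoord c) (fdom c)"
    and op: "openin (fmodel c) (fcoord c ` fdom c)" by (auto simp: is_fchart_def)
  have fc': "is_fchart c'"
    unfolding is_fchart_def
  proof (intro conjI model)
    show "inj_on (fcoord c') (fdom c')"
      using inj coord dom unfolding inj_on_def by (metis subsetD)
    \<comment> \<open>The image of \<open>c'\<close> is a preimage of the open image of
      \<open>c\<close> under \<open>\<tau>\<close>, hence open.\<close>
    have "{z \<in> T. \<tau> z \<in> fcoord c ` fdom c} = fcoord c' ` fdom c'"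
    proof (intro equalityI subsetI)
      fix z assume "z \<in> fcoord c' ` fdom c'"
      then obtain x where "x \<in> fdom c'" "z = fcoord c' x" by blast
      then show "z \<in> {z \<in> T. \<tau> z \<in> fcoord c ` fdom c}" using coord[of x] dom by auto
    qed (simp add: image)
    then show "openin (fmodel c') (fcoord c' ` fdom c')"
      using openin_frechet_smooth_preimage[OF \<tau> op] by simp
  qed
  have "fchart_change_smooth c' a" "fchart_change_smooth a c'" if a: "a \<in> A" for a
  proof -
    have fa: "is_fchart a" by (rule A[OF a])
    then have Ea: "frechet_space (fmodel a)" by (simp add: is_fchart_def)
    have ca: "frechet_smooth (fmodel c) (fcoord c ` (fdom c \<inter> fdom a)) (fmodel a) (fcoord a \<circ> finv c)"
      and ac: "frechet_smooth (fmodel a) (fcoord a ` (fdom a \<inter> fdom c)) (fmodel c) (fcoord c \<circ> finv a)"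
      using c a by (auto simp: compatible_chart_def fchart_change_smooth_def)
    have "{z \<in> T. \<tau> z \<in> fcoord c ` (fdom c \<inter> fdom a)} = fcoord c' ` (fdom c' \<inter> fdom a)"
    proof
      show "{z \<in> T. \<tau> z \<in> fcoord c ` (fdom c \<inter> fdom a)} \<subseteq> fcoord c' ` (fdom c' \<inter> fdom a)"
      proof
        fix z assume "z \<in> {z \<in> T. \<tau> z \<in> fcoord c ` (fdom c \<inter> fdom a)}"
        then obtain x where x: "z \<in> T" "x \<in> fdom c" "x \<in> fdom a" "\<tau> z = fcoord c x" by blast
        then obtain y where y: "y \<in> fdom c'" "z = fcoord c' y" using image by blast
        then have "fcoord c y = fcoord c x" using coord x by metis
        then have "y = x" using inj y(1) x(2) dom by (meson inj_onD subsetD)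
        then show "z \<in> fcoord c' ` (fdom c' \<inter> fdom a)" using x y by blast
      qed
      show "fcoord c' ` (fdom c' \<inter> fdom a) \<subseteq> {z \<in> T. \<tau> z \<in> fcoord c ` (fdom c \<inter> fdom a)}"
        using coord dom by auto
    qed
    then have "frechet_smooth (fmodel c') (fcoord c' ` (fdom c' \<inter> fdom a)) (fmodel a)
        (\<lambda>z. (fcoord a \<circ> finv c) (\<tau> z))"
      using frechet_smooth_compose[OF model E Ea \<tau> ca] by simp
    then show "fchart_change_smooth c' a"
      unfolding fchart_change_smooth_def
      by (rule frechet_smooth_cong)
         (use coord dom in \<open>auto simp: finv_fcoord[OF fc'] finv_fcoord[OF fc] subset_iff\<close>)
    have "{z \<in> fcoord a ` (fdom a \<inter> fdom c). (fcoord c \<circ> finv a) z \<in> T'} = fcoord a ` (fdom a \<inter> fdom c')"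
      using dom' dom by (auto simp: finv_fcoord[OF fa] subset_iff)
    then have "frechet_smooth (fmodel a) (fcoord a ` (fdom a \<inter> fdom c')) (fmodel c')
        (\<lambda>z. \<tau>' ((fcoord c \<circ> finv a) z))"
      using frechet_smooth_compose[OF Ea E model ac \<tau>'] by simp
    then show "fchart_change_smooth a c'"
      unfolding fchart_change_smooth_def
      by (rule frechet_smooth_cong) (use coord' in \<open>auto simp: finv_fcoord[OF fa]\<close>)
  qed
  then show ?thesis using fc' c dom by (auto simp: compatible_chart_def)
qed

lemma image_Int_eq: "(\<And>x. x \<in> D \<Longrightarrow> x \<in> N \<longleftrightarrow> f x \<in> K) \<Longrightarrow> f ` (D \<inter> N) = f ` D \<inter> K"
  by auto

lemma frechet_submersion_restrict:
  fixes AQ :: "('q, 'e::real_vector) fchart set" and AB :: "('b, 'f::real_vector) fchart set"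
  assumes Q: "frechet_manifold Q AQ" and B: "frechet_manifold B AB"
    and \<pi>: "frechet_submersion Q AQ B AB \<pi>" and N: "codim_one_submanifold B AB N"
    and Q0: "codim_one_submanifold Q AQ (Q \<inter> \<pi> -` N)"
  shows "frechet_submersion (Q \<inter> \<pi> -` N) (submanifold_atlas AQ (Q \<inter> \<pi> -` N)) N (submanifold_atlas AB N) \<pi>"
  unfolding frechet_submersion_def
proof (intro conjI ballI)
  let ?Q0 = "Q \<inter> \<pi> -` N"
  note fQ = frechet_manifold_is_fchart[OF Q] and fB = frechet_manifold_is_fchart[OF B]
  have smooth: "frechet_smooth_map Q AQ B AB \<pi>" using \<pi> by (simp add: frechet_submersion_def)
  show "frechet_smooth_map ?Q0 (submanifold_atlas AQ ?Q0) N (submanifold_atlas AB N) \<pi>"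
    by (rule frechet_smooth_map_induced[OF fQ fB smooth frechet_manifold_Union[OF Q]
          frechet_manifold_Union[OF B] submanifold_atlas_induced submanifold_atlas_induced]) auto
  fix q assume q: "q \<in> ?Q0"
  then have "q \<in> Q" by blast
  from bspec[OF conjunct2[OF \<pi>[unfolded frechet_submersion_def]] this]
  obtain c :: "('q, 'e \<times> 'f) fchart" and d :: "('b, 'f) fchart" and E :: "'e topology" where
    E: "frechet_space E" and c: "compatible_chart AQ c" and d: "compatible_chart AB d"
    and model: "fmodel c = prod_topology E (fmodel d)" and qc: "q \<in> fdom c"
    and dom: "\<pi> ` fdom c \<subseteq> fdom d" and proj: "\<And>x. x \<in> fdom c \<Longrightarrow> fcoord d (\<pi> x) = snd (fcoord c x)"
    by (elim exE conjE) (rule that; blast)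
  obtain d' F where qd': "\<pi> q \<in> fdom d'" and ad: "adapted_chart AB N d' F"
    using N q unfolding codim_one_submanifold_def by blast
  have d': "compatible_chart AB d'" using ad by (simp add: adapted_chart_def)
  have slice: "slice_fchart d' N F" by (rule adapted_chart_slice[OF ad])
  have fc: "is_fchart c" and fd: "is_fchart d" and fd': "is_fchart d'"
    using c d d' by (auto simp: compatible_chart_def)
  have Ed: "frechet_space (fmodel d)" "frechet_space (fmodel d')"
    and inj_d: "inj_on (fcoord d) (fdom d)" and inj_d': "inj_on (fcoord d') (fdom d')"
    using fd fd' by (auto simp: is_fchart_def)
  \<comment> \<open>\<open>d\<close> and \<open>d'\<close> are each related only to charts of
    \<open>AB\<close>; passing through these relates them to each other.\<close>
  have change: "fchart_change_smooth e e'" if "compatible_chart AB e" "compatible_chart AB e'"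
    for e e' :: "('b, 'f) fchart"
    unfolding fchart_change_smooth_iff_rep
    by (rule frechet_smooth_map_compatible[OF fB fB frechet_smooth_map_ident[OF B]
          frechet_manifold_Union[OF B] frechet_manifold_Union[OF B] that])
  let ?T = "topspace E \<times> fcoord d' ` (fdom d' \<inter> fdom d)"
    and ?T' = "topspace E \<times> fcoord d ` (fdom d \<inter> fdom d')"
  let ?\<tau> = "map_prod (\<lambda>x. x) (fcoord d \<circ> finv d')" and ?\<tau>' = "map_prod (\<lambda>x. x) (fcoord d' \<circ> finv d)"
  \<comment> \<open>The fibre component of \<open>c\<close> is kept and the base component is read
    in \<open>d'\<close> instead of \<open>d\<close>. The coordinate change is the identity of
    \<open>E\<close> times the change between \<open>d\<close> and \<open>d'\<close>.\<close>
  define c' where "c' = FChart (fdom c \<inter> \<pi> -` fdom d') (\<lambda>x. (fst (fcoord c x), fcoord d' (\<pi> x)))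
    (prod_topology E (fmodel d'))"
  have c'_simps: "fdom c' = fdom c \<inter> \<pi> -` fdom d'" "fmodel c' = prod_topology E (fmodel d')"
    "fcoord c' x = (fst (fcoord c x), fcoord d' (\<pi> x))" for x
    by (simp_all add: c'_def)
  have \<pi>d: "\<pi> x \<in> fdom d" if "x \<in> fdom c" for x using dom that by blast
  have mem_E: "fst (fcoord c x) \<in> topspace E" if "x \<in> fdom c" for x
  proof -
    have "fcoord c x \<in> topspace (fmodel c)"
      using fc that openin_subset unfolding is_fchart_def by blast
    then show ?thesis by (auto simp: model)
  qed
  have c': "compatible_chart AQ c'"
  proof (rule compatible_chart_reparametrize[OF fQ c, where T = ?T and T' = ?T' and \<tau> = ?\<tau> and \<tau>' = ?\<tau>'])
    show "frechet_space (fmodel c')" using E Ed by (simp add: c'_simps frechet_space_prod_topology)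
    show "frechet_smooth (fmodel c') ?T (fmodel c) ?\<tau>"
      unfolding c'_simps model
      by (intro frechet_smooth_map_prod frechet_smooth_ident E openin_topspace)
         (use change[OF d' d] in \<open>simp add: fchart_change_smooth_def\<close>)
    show "frechet_smooth (fmodel c) ?T' (fmodel c') ?\<tau>'"
      unfolding c'_simps model
      by (intro frechet_smooth_map_prod frechet_smooth_ident E openin_topspace)
         (use change[OF d d'] in \<open>simp add: fchart_change_smooth_def\<close>)
    show "fcoord c' x \<in> ?T \<and> ?\<tau> (fcoord c' x) = fcoord c x" if "x \<in> fdom c'" for x
      using that \<pi>d mem_E proj by (auto simp: c'_simps finv_fcoord[OF fd'] prod_eq_iff)
    show "?\<tau>' (fcoord c x) = fcoord c' x" if "x \<in> fdom c'" for x
      using that \<pi>d proj[of x, symmetric] by (auto simp: c'_simps finv_fcoord[OF fd] prod_eq_iff)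
    show "fcoord c x \<in> ?T' \<longleftrightarrow> x \<in> fdom c'" if x: "x \<in> fdom c" for x
    proof -
      have "fcoord c x \<in> ?T' \<longleftrightarrow> fcoord d (\<pi> x) \<in> fcoord d ` (fdom d \<inter> fdom d')"
        using mem_E[OF x] proj[OF x] by (simp add: mem_Times_iff)
      also have "\<dots> \<longleftrightarrow> \<pi> x \<in> fdom d'"
        using inj_d \<pi>d[OF x] unfolding inj_on_def by blast
      finally show ?thesis using x by (simp add: c'_simps)
    qed
    show "z \<in> fcoord c' ` fdom c'" if z: "z \<in> ?T" "?\<tau> z \<in> fcoord c ` fdom c" for z
    proof -
      obtain e y where y: "z = (e, fcoord d' y)" "y \<in> fdom d'" "y \<in> fdom d" using z(1) by blast
      obtain x where x: "x \<in> fdom c" "?\<tau> z = fcoord c x" using z(2) by blast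
      have e: "fst (fcoord c x) = e" and "snd (fcoord c x) = fcoord d y"
        using x(2)[symmetric] y by (simp_all add: finv_fcoord[OF fd'])
      then have "fcoord d (\<pi> x) = fcoord d y" using proj[OF x(1)] by simp
      then have "\<pi> x = y" using inj_d \<pi>d[OF x(1)] y(3) by (meson inj_onD)
      then show ?thesis using x y e by (intro image_eqI[of _ _ x]) (auto simp: c'_simps)
    qed
  qed (auto simp: c'_simps)
  then have fc': "is_fchart c'" by (simp add: compatible_chart_def)
  have domQ: "fdom c' \<subseteq> Q"
    using c' frechet_manifold_Union[OF Q] by (simp add: compatible_chart_def)
  \<comment> \<open>In the new coordinates the preimage of \<open>N\<close> is flat: membership
    depends on the base component alone, and the factor \<open>E\<close> is unconstrained.\<close>
  have slice': "slice_fchart c' ?Q0 (topspace E \<times> F)"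
    unfolding slice_fchart_def
  proof (intro conjI)
    show "subspace (topspace E \<times> F)"
      using slice E by (simp add: slice_fchart_def subspace_Times frechet_space_subspace)
    show "closedin (fmodel c') (topspace E \<times> F)"
      using slice by (simp add: slice_fchart_def c'_simps closedin_prod_Times_iff)
    have "x \<in> ?Q0 \<longleftrightarrow> fcoord c' x \<in> topspace E \<times> F" if x: "x \<in> fdom c'" for x
      using x domQ slice_fchart_mem[OF fd' slice, of "\<pi> x"] mem_E by (auto simp: c'_simps)
    then show "fcoord c' ` (fdom c' \<inter> ?Q0) = fcoord c' ` fdom c' \<inter> topspace E \<times> F"
      by (rule image_Int_eq)
  qed
  let ?c = "restrict_fchart c' ?Q0 (topspace E \<times> F)" and ?d = "restrict_fchart d' N F"
  have "induced_fchart AQ ?Q0 ?c" unfolding induced_fchart_def using c' slice' by blast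
  then have "compatible_chart (submanifold_atlas AQ ?Q0) ?c"
    by (rule induced_fchart_compatible_submanifold[OF Q Q0])
  moreover have "induced_fchart AB N ?d" unfolding induced_fchart_def using d' slice by blast
  then have "compatible_chart (submanifold_atlas AB N) ?d"
    by (rule induced_fchart_compatible_submanifold[OF B N])
  moreover have "fmodel ?c = prod_topology E (fmodel ?d)"
    by (simp add: c'_simps prod_topology_subtopology)
  moreover have "q \<in> fdom ?c" using q qc qd' by (simp add: c'_simps)
  moreover have "\<pi> ` fdom ?c \<subseteq> fdom ?d" by (auto simp: c'_simps)
  moreover have "\<forall>x\<in>fdom ?c. fcoord ?d (\<pi> x) = snd (fcoord ?c x)" by (simp add: c'_simps)
  ultimately show "\<exists>(c :: ('q, 'e \<times> 'f) fchart) (d :: ('b, 'f) fchart) (E :: 'e topology).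
      frechet_space E \<and> compatible_chart (submanifold_atlas AQ ?Q0) c \<and>
      compatible_chart (submanifold_atlas AB N) d \<and> fmodel c = prod_topology E (fmodel d) \<and>
      q \<in> fdom c \<and> \<pi> ` fdom c \<subseteq> fdom d \<and> (\<forall>x\<in>fdom c. fcoord d (\<pi> x) = snd (fcoord c x))"
    using E by blast
qed

lemma open_subatlas_Union: "(\<Union>c\<in>open_subatlas A W. fdom c) = (\<Union>c\<in>A. fdom c) \<inter> W"
  by (auto simp: open_subatlas_eq)

text \<open>The same \<open>\<Psi>\<close> serves: its second component is \<open>\<pi>\<close>, so
  it carries the part of \<open>Q\<close> over \<open>U \<inter> N\<close> onto
  \<open>carrier G \<times> (U \<inter> N)\<close>, and equivariance is inherited.\<close>

lemma local_trivialization_restrict: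
  assumes G: "frechet_manifold (carrier G) AG" and Q: "frechet_manifold Q AQ"
    and B: "frechet_manifold B AB" and \<pi>: "frechet_smooth_map Q AQ B AB \<pi>"
    and U: "openin (atlas_topology AB) U" and triv: "local_trivialization G AG Q AQ act AB \<pi> U \<Psi>"
  shows "local_trivialization G AG (Q \<inter> \<pi> -` N) (submanifold_atlas AQ (Q \<inter> \<pi> -` N)) act
    (submanifold_atlas AB N) \<pi> (U \<inter> N) \<Psi>"
proof -
  let ?Q0 = "Q \<inter> \<pi> -` N" and ?W = "Q \<inter> \<pi> -` U"
  let ?V = "?Q0 \<inter> \<pi> -` (U \<inter> N)"
  let ?AW = "open_subatlas AQ ?W" and ?AP = "product_atlas AG (open_subatlas AB U)"
  note fG = frechet_manifold_is_fchart[OF G] and fQ = frechet_manifold_is_fchart[OF Q]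
    and fB = frechet_manifold_is_fchart[OF B]
  have W: "openin (atlas_topology AQ) ?W"
    by (rule openin_atlas_smooth_preimage[OF fQ fB \<pi> frechet_manifold_Union[OF Q]
          frechet_manifold_Union[OF B] U])
  have bij: "bij_betw \<Psi> ?W (carrier G \<times> U)"
    and smooth: "frechet_smooth_map ?W ?AW (carrier G \<times> U) ?AP \<Psi>"
    and smooth': "frechet_smooth_map (carrier G \<times> U) ?AP ?W ?AW (inv_into ?W \<Psi>)"
    and snd_\<Psi>: "\<And>q. q \<in> ?W \<Longrightarrow> snd (\<Psi> q) = \<pi> q"
    and equivariant: "\<And>q g. q \<in> ?W \<Longrightarrow> g \<in> carrier G \<Longrightarrow> \<Psi> (act q g) = (fst (\<Psi> q) \<otimes>\<^bsub>G\<^esub> g, \<pi> q)"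
    using triv by (auto simp: local_trivialization_def frechet_diffeo_def)
  have W0: "?V \<subseteq> ?W" by blast
  have image: "\<Psi> ` ?V = carrier G \<times> (U \<inter> N)"
  proof (intro equalityI subsetI)
    fix z assume "z \<in> \<Psi> ` ?V"
    then obtain q where q: "q \<in> ?V" "z = \<Psi> q" by blast
    then have "z \<in> carrier G \<times> U" "snd z = \<pi> q"
      using bij_betw_imp_surj_on[OF bij] snd_\<Psi> by blast+
    then show "z \<in> carrier G \<times> (U \<inter> N)" using q by (auto simp: mem_Times_iff)
  next
    fix z assume z: "z \<in> carrier G \<times> (U \<inter> N)"
    then have "z \<in> \<Psi> ` ?W" using bij_betw_imp_surj_on[OF bij] by auto
    then obtain q where q: "q \<in> ?W" "z = \<Psi> q" by blast
    then have "\<pi> q \<in> N" using snd_\<Psi>[OF q(1)] z by (metis IntD2 mem_Times_iff)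
    then show "z \<in> \<Psi> ` ?V" using q by blast
  qed
  have inj: "inj_on \<Psi> ?W" by (rule bij_betw_imp_inj_on[OF bij])
  then have bij0: "bij_betw \<Psi> ?V (carrier G \<times> (U \<inter> N))"
    using image inj_on_subset[OF inj W0] by (simp add: bij_betw_def)
  \<comment> \<open>The two inverses are chosen over different domains; injectivity on the larger
    one makes them agree on the smaller image.\<close>
  have inv_eq: "inv_into ?V \<Psi> z = inv_into ?W \<Psi> z" if "z \<in> carrier G \<times> (U \<inter> N)" for z
  proof -
    obtain q where "q \<in> ?V" "z = \<Psi> q" using \<open>z \<in> carrier G \<times> (U \<inter> N)\<close> image by blast
    then show ?thesis
      using inv_into_f_f[OF inj] inv_into_f_f[OF inj_on_subset[OF inj W0]] W0 by auto
  qed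
  have inv_image: "inv_into ?W \<Psi> ` (carrier G \<times> (U \<inter> N)) \<subseteq> ?V"
    unfolding image[symmetric] using inv_into_f_f[OF inj] by auto
  have compQ: "compatible_chart AQ a" if "a \<in> AQ" for a
    by (rule frechet_manifold_compatible[OF Q that])
  have compB: "compatible_chart AB b" if "b \<in> AB" for b
    by (rule frechet_manifold_compatible[OF B that])
  have fAW: "is_fchart a" if "a \<in> ?AW" for a
    using that compatible_chart_open_restrict[OF compQ W compQ]
    by (auto simp: open_subatlas_eq compatible_chart_def)
  have fAU: "is_fchart b" if "b \<in> open_subatlas AB U" for b
    using that compatible_chart_open_restrict[OF compB U compB]
    by (auto simp: open_subatlas_eq compatible_chart_def)
  have fAP: "is_fchart p" if "p \<in> ?AP" for p
    using that fG fAU is_fchart_prod by (auto simp: product_atlas_eq)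
  have domW: "?W = (\<Union>a\<in>?AW. fdom a)"
    unfolding open_subatlas_Union using frechet_manifold_Union[OF Q] by blast
  have "U \<subseteq> B"
    using openin_subset[OF U] by (simp add: topspace_atlas_topology[OF B])
  then have domP: "carrier G \<times> U = (\<Union>p\<in>?AP. fdom p)"
    unfolding product_atlas_Union open_subatlas_Union
    using frechet_manifold_Union[OF G] frechet_manifold_Union[OF B] by blast
  \<comment> \<open>An open piece of the submanifold atlas is read as induced from the open piece
    \<open>?AW\<close> of the ambient atlas, on which \<open>\<Psi>\<close> is known to be
    smooth.\<close>
  have indW: "induced_fchart ?AW ?V c" if c: "c \<in> open_subatlas (submanifold_atlas AQ ?Q0) ?V" for c
  proof -
    obtain a where a: "a \<in> submanifold_atlas AQ ?Q0" "c = open_restrict_fchart a ?V"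
      using c by (auto simp: open_subatlas_eq)
    show ?thesis
      unfolding a(2)
      by (rule induced_fchart_open_restrict[OF _ W submanifold_atlas_induced[OF a(1)]])
         (use compQ in blast)+
  qed
  have indU: "induced_fchart (open_subatlas AB U) (U \<inter> N) c"
    if c: "c \<in> open_subatlas (submanifold_atlas AB N) (U \<inter> N)" for c
  proof -
    obtain a where a: "a \<in> submanifold_atlas AB N" "c = open_restrict_fchart a (U \<inter> N)"
      using c by (auto simp: open_subatlas_eq)
    show ?thesis
      unfolding a(2)
      by (rule induced_fchart_open_restrict[OF _ U submanifold_atlas_induced[OF a(1)]])
         (use compB in blast)+
  qed
  have indG: "induced_fchart AG (carrier G) g" if "g \<in> AG" for g
    by (rule compatible_chart_induced[OF frechet_manifold_compatible[OF G that]])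
       (use frechet_manifold_Union[OF G] that in blast)
  have indP: "induced_fchart ?AP (carrier G \<times> (U \<inter> N)) p"
    if "p \<in> product_atlas AG (open_subatlas (submanifold_atlas AB N) (U \<inter> N))" for p
    using that unfolding product_atlas_eq[of AG "open_subatlas (submanifold_atlas AB N) (U \<inter> N)"]
    by (auto intro!: induced_fchart_prod fG fAU indG indU)
  show ?thesis
    unfolding local_trivialization_def frechet_diffeo_def
  proof (intro conjI ballI bij0)
    show "frechet_smooth_map ?V (open_subatlas (submanifold_atlas AQ ?Q0) ?V) (carrier G \<times> (U \<inter> N))
        (product_atlas AG (open_subatlas (submanifold_atlas AB N) (U \<inter> N))) \<Psi>"
      by (rule frechet_smooth_map_induced[OF fAW fAP smooth domW domP indW indP]) (use image in auto)
    show "frechet_smooth_map (carrier G \<times> (U \<inter> N))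
        (product_atlas AG (open_subatlas (submanifold_atlas AB N) (U \<inter> N)))
        ?V (open_subatlas (submanifold_atlas AQ ?Q0) ?V) (inv_into ?V \<Psi>)"
      by (rule frechet_smooth_map_induced[OF fAP fAW smooth' domP domW indP indW inv_image inv_eq])
    fix q assume "q \<in> ?V"
    then have q: "q \<in> ?W" by blast
    show "snd (\<Psi> q) = \<pi> q" by (rule snd_\<Psi>[OF q])
    show "\<Psi> (act q g) = (fst (\<Psi> q) \<otimes>\<^bsub>G\<^esub> g, \<pi> q)" if "g \<in> carrier G" for g
      by (rule equivariant[OF q that])
  qed
qed

text \<open>Products of submanifold charts of \<open>Q0\<close> with group charts are induced from
  the ambient product, so smoothness of the action restricts from
  \<open>Q \<times> carrier G\<close>.\<close>

lemma smooth_right_action_restrict: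
  assumes G: "frechet_manifold (carrier G) AG" and Q: "frechet_manifold Q AQ"
    and act: "smooth_right_action G AG Q AQ act" and Q0: "Q0 \<subseteq> Q"
    and invariant: "\<And>q g. q \<in> Q0 \<Longrightarrow> g \<in> carrier G \<Longrightarrow> act q g \<in> Q0"
  shows "smooth_right_action G AG Q0 (submanifold_atlas AQ Q0) act"
proof -
  note fG = frechet_manifold_is_fchart[OF G] and fQ = frechet_manifold_is_fchart[OF Q]
  let ?AP = "product_atlas AQ AG"
  have smooth: "frechet_smooth_map (Q \<times> carrier G) ?AP Q AQ (\<lambda>(q, g). act q g)"
    using act by (simp add: smooth_right_action_def)
  have fAP: "is_fchart p" if "p \<in> ?AP" for p
    using that fG fQ is_fchart_prod by (auto simp: product_atlas_eq)
  have domP: "Q \<times> carrier G = (\<Union>p\<in>?AP. fdom p)"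
    unfolding product_atlas_Union using frechet_manifold_Union[OF G] frechet_manifold_Union[OF Q] by simp
  have indG: "induced_fchart AG (carrier G) g" if "g \<in> AG" for g
    by (rule compatible_chart_induced[OF frechet_manifold_compatible[OF G that]])
       (use frechet_manifold_Union[OF G] that in blast)
  have indP: "induced_fchart ?AP (Q0 \<times> carrier G) p"
    if "p \<in> product_atlas (submanifold_atlas AQ Q0) AG" for p
    using that unfolding product_atlas_eq[of "submanifold_atlas AQ Q0" AG]
    by (auto intro!: induced_fchart_prod fG fQ indG dest: submanifold_atlas_induced)
  have "frechet_smooth_map (Q0 \<times> carrier G) (product_atlas (submanifold_atlas AQ Q0) AG)
      Q0 (submanifold_atlas AQ Q0) (\<lambda>(q, g). act q g)"
    by (rule frechet_smooth_map_induced[OF fAP fQ smooth domP frechet_manifold_Union[OF Q] indP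
          submanifold_atlas_induced])
       (use invariant in auto)
  then show ?thesis
    using act Q0 unfolding smooth_right_action_def by blast
qed

text \<open>Constancy of \<open>\<pi>\<close> on orbits makes the preimage of \<open>N\<close>
  stable under the group. The submanifold structure upstairs is a hypothesis; in the application it
  is the one given on \<open>Emb0\<close>.\<close>

theorem frechet_principal_bundle_restrict:
  assumes P: "frechet_principal_bundle G AG Q AQ act B AB \<pi>"
    and invariant: "\<And>q g. q \<in> Q \<Longrightarrow> g \<in> carrier G \<Longrightarrow> \<pi> (act q g) = \<pi> q"
    and N: "codim_one_submanifold B AB N" and Q0: "codim_one_submanifold Q AQ (Q \<inter> \<pi> -` N)"
  shows "frechet_principal_bundle G AG (Q \<inter> \<pi> -` N) (submanifold_atlas AQ (Q \<inter> \<pi> -` N)) act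
    N (submanifold_atlas AB N) \<pi>"
  unfolding frechet_principal_bundle_def
proof (intro conjI ballI)
  let ?Q0 = "Q \<inter> \<pi> -` N"
  have G: "frechet_lie_group G AG" and Q: "frechet_manifold Q AQ" and B: "frechet_manifold B AB"
    and act: "smooth_right_action G AG Q AQ act" and surj: "\<pi> ` Q = B"
    and sub: "frechet_submersion Q AQ B AB \<pi>"
    and triv: "\<And>b. b \<in> B \<Longrightarrow> \<exists>U \<Psi>. openin (atlas_topology AB) U \<and> b \<in> U \<and>
      local_trivialization G AG Q AQ act AB \<pi> U \<Psi>"
    using P by (auto simp: frechet_principal_bundle_def)
  have G': "frechet_manifold (carrier G) AG" using G by (simp add: frechet_lie_group_def)
  have NB: "N \<subseteq> B" using N by (simp add: codim_one_submanifold_def)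
  show "frechet_lie_group G AG" by fact
  show "frechet_manifold ?Q0 (submanifold_atlas AQ ?Q0)" by (rule frechet_manifold_submanifold[OF Q Q0])
  show "frechet_manifold N (submanifold_atlas AB N)" by (rule frechet_manifold_submanifold[OF B N])
  have "act q g \<in> Q" if "q \<in> Q" "g \<in> carrier G" for q g
  proof -
    have "(\<lambda>(q, g). act q g) ` (Q \<times> carrier G) \<subseteq> Q"
      using act by (simp add: smooth_right_action_def frechet_smooth_map_def)
    then show ?thesis using that by blast
  qed
  then show "smooth_right_action G AG ?Q0 (submanifold_atlas AQ ?Q0) act"
    by (intro smooth_right_action_restrict[OF G' Q act]) (auto simp: invariant)
  show "\<pi> ` ?Q0 = N" using surj NB by blast
  show "frechet_submersion ?Q0 (submanifold_atlas AQ ?Q0) N (submanifold_atlas AB N) \<pi>"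
    by (rule frechet_submersion_restrict[OF Q B sub N Q0])
  fix b assume b: "b \<in> N"
  then obtain U \<Psi> where U: "openin (atlas_topology AB) U" "b \<in> U"
    "local_trivialization G AG Q AQ act AB \<pi> U \<Psi>"
    using triv NB by blast
  have \<pi>: "frechet_smooth_map Q AQ B AB \<pi>" using sub by (simp add: frechet_submersion_def)
  have "openin (atlas_topology (submanifold_atlas AB N)) (U \<inter> N)"
    by (rule openin_atlas_topology_induced[OF frechet_manifold_is_fchart[OF B]
          submanifold_atlas_induced submanifold_atlas_Union[OF N] U(1)])
  moreover have "local_trivialization G AG ?Q0 (submanifold_atlas AQ ?Q0) act
      (submanifold_atlas AB N) \<pi> (U \<inter> N) \<Psi>"
    by (rule local_trivialization_restrict[OF G' Q B \<pi> U(1,3)])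
  ultimately show "\<exists>U \<Psi>. openin (atlas_topology (submanifold_atlas AB N)) U \<and> b \<in> U \<and>
      local_trivialization G AG ?Q0 (submanifold_atlas AQ ?Q0) act (submanifold_atlas AB N) \<pi> U \<Psi>"
    using b U(2) by blast
qed

text \<open>The volume condition involves \<open>f\<close> only through \<open>range f\<close>; the
  assumption supplies the remaining membership in \<open>Gr\<close>.\<close>

lemma Emb0_eq_vimage_Gr0:
  assumes "range ` Emb A B \<subseteq> Gr A B"
  shows "Emb0 A \<mu> B \<mu>' = Emb A B \<inter> range -` Gr0 A \<mu> B \<mu>'"
  using assms by (auto simp: Emb0_def Gr0_def)

text \<open>The Frechet structure on \<open>Gr\<close> is characterized by making
  \<open>range\<close> a principal bundle, so it enters as an atlas \<open>AGr\<close> with that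
  property. The codimension one structures on \<open>Emb0\<close> and \<open>Gr0\<close> are
  likewise part of the given setting.\<close>

theorem proposition3p2:
  fixes AS :: "('s::{t2_space,second_countable_topology}, real ^ 'n::finite) chart set"
    and AM :: "('m::{t2_space,second_countable_topology}, real ^ 'n) chart set"
    and AGr :: "('m set, 'e::real_vector) fchart set"
    and \<mu> :: "('s, 'n) top_form"
    and \<mu>M :: "('m, 'n) top_form"
  assumes S: "smooth_manifold (UNIV :: 's set) AS" "connected (UNIV :: 's set)"
      "compact (UNIV :: 's set)" "manifold_boundary AS \<noteq> {}"
    and M: "smooth_manifold (UNIV :: 'm set) AM" "connected (UNIV :: 'm set)"
      "manifold_boundary AM = {}"
    and vol: "volume_form UNIV AS \<mu>" "volume_form UNIV AM \<mu>M"
    and Gr_structure: "frechet_principal_bundle (Diff AS) (Diff_atlas AS)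
      (Emb AS AM) (Emb_atlas AS AM) (\<lambda>f \<phi>. f \<circ> \<phi>) (Gr AS AM) AGr (\<lambda>f. range f)"
    and Emb0_submanifold:
      "codim_one_submanifold (Emb AS AM) (Emb_atlas AS AM) (Emb0 AS \<mu> AM \<mu>M)"
    and Gr0_submanifold:
      "codim_one_submanifold (Gr AS AM) AGr (Gr0 AS \<mu> AM \<mu>M)"
  shows "frechet_principal_bundle (Diff AS) (Diff_atlas AS)
    (Emb0 AS \<mu> AM \<mu>M) (submanifold_atlas (Emb_atlas AS AM) (Emb0 AS \<mu> AM \<mu>M)) (\<lambda>f \<phi>. f \<circ> \<phi>)
    (Gr0 AS \<mu> AM \<mu>M) (submanifold_atlas AGr (Gr0 AS \<mu> AM \<mu>M)) (\<lambda>f. range f)"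
proof -
  have "range ` Emb AS AM \<subseteq> Gr AS AM"
    using Gr_structure by (auto simp: frechet_principal_bundle_def)
  note eq = Emb0_eq_vimage_Gr0[OF this, of \<mu> \<mu>M]
  \<comment> \<open>Precomposition with a surjection leaves the image unchanged, so the projection
    is constant on orbits.\<close>
  have "range (f \<circ> \<phi>) = range f" if "\<phi> \<in> carrier (Diff AS)" for f :: "'s \<Rightarrow> 'm" and \<phi>
  proof -
    have "surj \<phi>" using that by (simp add: Diff_def diffeomorphism_def bij_betw_imp_surj_on)
    then show ?thesis by (metis image_comp)
  qed
  then show ?thesis
    unfolding eq
    by (intro frechet_principal_bundle_restrict[OF Gr_structure] Gr0_submanifold
        Emb0_submanifold[unfolded eq])
qed

end
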